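(* $M(\mathrm{odd})$ is spanned over $\mathbb{Z}/2$ by the products $F^{i}G^{j}$ with $i,j\ge 0$ and $i+j$ odd.
   Context: For even $k\ge 0$, $M_{k}$ is the set of $f\in\mathbb{Z}/2[[x]]$ for which there is a modular form of weight $k$ for $\Gamma_{0}(5)$ whose expansion at infinity (in $x=e^{2\pi i z}$) lies in $\mathbb{Z}[[x]]$ and reduces mod $2$ to $f$; $M=\bigcup_{m}M_{4m}$ and $M(\mathrm{odd})=M\cap x\,\mathbb{Z}/2[[x^{2}]]$. In $\mathbb{Z}/2[[x]]$ let $F=\sum_{n\ \mathrm{odd},\,n>0}x^{n^{2}}$ and $G=F(x^{5})$. *)

theory Defs
  imports "HOL-Complex_Analysis.Complex_Analysis" "HOL-Library.Z2"
    "HOL-Computational_Algebra.Formal_Power_Series"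
begin

definition upper_half_plane :: "complex set" where
  "upper_half_plane = {z. Im z > 0}"

text \<open>Holomorphic modular forms of weight k for Gamma_0(5):
  holomorphic on the upper half plane, invariant under the weight-k slash action
  of Gamma_0(5), and holomorphic at all cusps (for every gamma in SL_2(Z) the
  slashed function is bounded as Im z tends to infinity).\<close>
definition modular_form_Gamma0_5 :: "nat \<Rightarrow> (complex \<Rightarrow> complex) \<Rightarrow> bool" where
  "modular_form_Gamma0_5 k f \<longleftrightarrow>
     f holomorphic_on upper_half_plane \<and>
     (\<forall>a b c d :: int. a * d - b * c = 1 \<and> 5 dvd c \<longrightarrow>
        (\<forall>z. Im z > 0 \<longrightarrow>
           f ((of_int a * z + of_int b) / (of_int c * z + of_int d))
             = (of_int c * z + of_int d) ^ k * f z)) \<and>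
     (\<forall>a b c d :: int. a * d - b * c = 1 \<longrightarrow>
        (\<exists>B Y. \<forall>z. Im z \<ge> Y \<longrightarrow>
           norm (f ((of_int a * z + of_int b) / (of_int c * z + of_int d))
                 / (of_int c * z + of_int d) ^ k) \<le> B))"

definition int_q_expansion :: "(complex \<Rightarrow> complex) \<Rightarrow> (nat \<Rightarrow> int) \<Rightarrow> bool" where
  "int_q_expansion f a \<longleftrightarrow>
     (\<forall>z. Im z > 0 \<longrightarrow>
        (\<lambda>n. of_int (a n) * exp (2 * of_real pi * \<i> * of_nat n * z)) sums f z)"

definition Mk :: "nat \<Rightarrow> bit fps set" where
  "Mk k = {g. \<exists>f a. modular_form_Gamma0_5 k f \<and> int_q_expansion f a \<and>
                     g = Abs_fps (\<lambda>n. of_int (a n))}"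

definition M :: "bit fps set" where
  "M = (\<Union>m. Mk (4 * m))"

definition M_odd :: "bit fps set" where
  "M_odd = M \<inter> {g. \<forall>n. even n \<longrightarrow> fps_nth g n = 0}"

definition F :: "bit fps" where
  "F = Abs_fps (\<lambda>N. if \<exists>n::nat. odd n \<and> N = n ^ 2 then 1 else 0)"

definition G :: "bit fps" where
  "G = Abs_fps (\<lambda>N. if 5 dvd N then fps_nth F (N div 5) else 0)"

definition span_Z2 :: "bit fps set \<Rightarrow> bit fps set" where
  "span_Z2 S = {h. \<exists>A c. finite A \<and> A \<subseteq> S \<and> h = (\<Sum>g\<in>A. fps_const (c g) * g)}"

end

theory Submission
  imports Defs
begin

text \<open>Let \<open>A = \<eta>(z)\<^sup>1\<^sup>0 / \<eta>(5z)\<^sup>2\<close>, \<open>B = \<eta>(5z)\<^sup>1\<^sup>0 / \<eta>(z)\<^sup>2\<close> and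
  \<open>C = \<eta>(z)\<^sup>4 \<eta>(5z)\<^sup>4\<close>. These are forms of weight 4 with \<open>C\<^sup>2 = A B\<close>,
  \<open>\<Delta>(z) = A\<^sup>2 C\<close> and \<open>\<Delta>(5z) = B\<^sup>2 C\<close>, and they vanish at infinity to order
  0, 2 and 1. A form of weight \<open>4m\<close> vanishing to order greater than \<open>2m\<close> is zero: its quotient by
  \<open>B\<^sup>m\<close>, multiplied by the Fricke transform of that quotient, satisfies the maximum principle on a
  one-cusped quotient. Hence the monomials \<open>A\<^sup>i B\<^sup>j\<close> and \<open>A\<^sup>i B\<^sup>j C\<close> of weight \<open>4m\<close>
  are a \<open>\<int>\<close>-basis of the integral forms.

  Modulo 2, \<open>A\<close> and \<open>B\<close> are even series and \<open>C\<close> is odd. The weight 2 form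
  \<open>E = q d/dq log (C / A)\<close> is congruent to 1, which forces \<open>A + B = 1\<close>; so \<open>M(odd)\<close> is spanned by
  the \<open>C B\<^sup>n\<close>. Since \<open>F = A\<^sup>2 C\<close> and \<open>G = B\<^sup>2 C\<close> modulo 2 (Gauss's formula for the
  triangular numbers), \<open>C = F + G\<close>, and the span of the odd monomials in \<open>F\<close> and \<open>G\<close> is stable
  under multiplication by \<open>B\<close>.

  The transformation law of \<open>\<Delta>\<close> is obtained from that of a theta function, by Liouville's
  theorem for a quotient of two functions with the same quasi-periods. Invariance under
  \<open>\<Gamma>\<^sub>0(5)\<close> is checked on generators.\<close>

unbundle no vec_syntax
unbundle fps_syntax

section \<open>The q-Pochhammer symbol and theta functions\<close>

text \<open>Only \<open>discriminant\<close> gets its transformation law directly. The laws of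
  \<open>eta_a\<close>, \<open>eta_b\<close> and \<open>eta_c\<close> are roots of laws for products
  of the functions Delta(z) and Delta(5z): on the connected upper half plane a ratio with constant
  n-th power is itself constant. No branch of a root is chosen, at the price of an unknown
  multiplier. This is harmless: translations act trivially because q-expansions have integral
  exponents, any constant will do under the Fricke involution, and for the elliptic element a fixed
  point decides.

  Since \<open>M\<close> is a union over weights, even its closure under addition needs an argument.
  E serves twice: \<open>E_form ^ 2\<close> has weight 4 and reduces to 1, so its powers raise
  weights without changing reductions; and expanding it in the basis A, B, C of weight 4 gives A + B
  = 1.

  The basis is integral because each basis form has leading coefficient 1, so that elimination never
  divides. For this reason integer power series are the primary objects, and \<open>q_eval\<close>
  turns them into functions only where analysis is needed.\<close>

definition qpoch :: "complex \<Rightarrow> complex \<Rightarrow> complex" where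
  "qpoch q x = (\<Prod>n. 1 - x * q ^ n)"

lemma summable_qpoch:
  assumes "norm q < 1"
  shows "summable (\<lambda>n. norm ((1 - x * q ^ n) - 1 :: complex))"
  using assms by (simp add: norm_mult norm_power summable_mult)

lemma convergent_prod_qpoch:
  assumes "norm q < 1"
  shows "convergent_prod (\<lambda>n. 1 - x * q ^ n :: complex)"
  using summable_qpoch[OF assms, of x]
  by (intro abs_convergent_prod_imp_convergent_prod summable_imp_abs_convergent_prod)

lemma LIMSEQ_qpoch:
  assumes "norm q < 1"
  shows "(\<lambda>N. \<Prod>n<N. 1 - x * q ^ n) \<longlonglongrightarrow> qpoch q x"
proof -
  have "(\<lambda>N. \<Prod>n\<le>N. 1 - x * q ^ n) \<longlonglongrightarrow> qpoch q x"
    unfolding qpoch_def by (rule convergent_prod_LIMSEQ[OF convergent_prod_qpoch[OF assms]])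
  then show ?thesis
    by (subst filterlim_sequentially_Suc[symmetric]) (simp add: lessThan_Suc_atMost)
qed

lemma qpoch_rec:
  assumes "norm q < 1"
  shows "qpoch q x = (1 - x) * qpoch q (q * x)"
proof (rule LIMSEQ_unique)
  show "(\<lambda>N. \<Prod>n<Suc N. 1 - x * q ^ n) \<longlonglongrightarrow> qpoch q x"
    using LIMSEQ_qpoch[OF assms] by (rule LIMSEQ_Suc)
  have "(\<Prod>n<Suc N. 1 - x * q ^ n) = (1 - x) * (\<Prod>n<N. 1 - (q * x) * q ^ n)" for N
    by (subst prod.lessThan_Suc_shift) (simp add: mult_ac)
  then show "(\<lambda>N. \<Prod>n<Suc N. 1 - x * q ^ n) \<longlonglongrightarrow> (1 - x) * qpoch q (q * x)"
    using tendsto_mult_left[OF LIMSEQ_qpoch[OF assms, of "q * x"], of "1 - x"] by simp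
qed

lemma qpoch_eq_0_iff:
  assumes "norm q < 1"
  shows "qpoch q x = 0 \<longleftrightarrow> (\<exists>n. x * q ^ n = 1)"
proof
  assume "qpoch q x = 0"
  then show "\<exists>n. x * q ^ n = 1"
    unfolding qpoch_def using prodinf_nonzero[OF convergent_prod_qpoch[OF assms, of x]] by auto
next
  assume "\<exists>n. x * q ^ n = 1"
  then obtain n where n: "x * q ^ n = 1" by auto
  have "(\<lambda>n. 1 - x * q ^ n) has_prod qpoch q x"
    unfolding qpoch_def using convergent_prod_qpoch[OF assms] by (rule convergent_prod_has_prod)
  then show "qpoch q x = 0"
    using has_prod_eq_0_iff n by fastforce
qed

text \<open>Base and argument both vary with \<open>s\<close>: theta functions need the argument to
  vary, \<open>qpoch q q\<close> as a function of \<open>q\<close> needs both. The maxima over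
  \<open>K\<close> give a geometric majorant.\<close>

lemma uniform_limit_qpoch:
  assumes K: "compact K" and cont: "continuous_on K f" "continuous_on K g"
    and f: "\<And>s. s \<in> K \<Longrightarrow> norm (f s) < 1"
  shows "uniform_limit K (\<lambda>N s. \<Prod>n<N. 1 - g s * f s ^ n) (\<lambda>s. qpoch (f s) (g s)) sequentially"
proof (cases "K = {}")
  case False
  obtain s0 where s0: "s0 \<in> K" "\<And>s. s \<in> K \<Longrightarrow> norm (f s) \<le> norm (f s0)"
    using continuous_attains_sup[OF K False, of "\<lambda>s. norm (f s)"] cont by (auto intro: continuous_intros)
  obtain s1 where s1: "s1 \<in> K" "\<And>s. s \<in> K \<Longrightarrow> norm (g s) \<le> norm (g s1)"
    using continuous_attains_sup[OF K False, of "\<lambda>s. norm (g s)"] cont by (auto intro: continuous_intros)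
  have "uniformly_convergent_on K (\<lambda>N s. \<Prod>n<N. 1 - g s * f s ^ n)"
  proof (rule uniformly_convergent_on_prod')
    show "uniformly_convergent_on K (\<lambda>N s. \<Sum>n<N. norm ((1 - g s * f s ^ n) - 1))"
    proof (rule Weierstrass_m_test'_ev)
      show "summable (\<lambda>n. norm (g s1) * norm (f s0) ^ n)"
        using f[OF s0(1)] by (intro summable_mult summable_geometric) auto
      show "\<forall>\<^sub>F n in sequentially. \<forall>s\<in>K. norm (norm (1 - g s * f s ^ n - 1)) \<le> norm (g s1) * norm (f s0) ^ n"
        using s0 s1 by (intro always_eventually) (auto simp: norm_mult norm_power intro!: mult_mono power_mono)
    qed
  qed (use K cont in \<open>auto intro!: continuous_intros\<close>)
  then obtain h where h: "uniform_limit K (\<lambda>N s. \<Prod>n<N. 1 - g s * f s ^ n) h sequentially"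
    by (auto simp: uniformly_convergent_on_def)
  have "h s = qpoch (f s) (g s)" if "s \<in> K" for s
    using tendsto_uniform_limitI[OF h that] LIMSEQ_qpoch[OF f[OF that], of "g s"] LIMSEQ_unique by blast
  then show ?thesis using h uniform_limit_cong'[of K _ _ h] by (smt (verit) uniform_limit_cong')
qed (simp add: uniform_limit_iff)

lemma holomorphic_on_qpoch [holomorphic_intros]:
  assumes S: "open S" and hol: "f holomorphic_on S" "g holomorphic_on S"
    and f: "\<And>s. s \<in> S \<Longrightarrow> norm (f s) < 1"
  shows "(\<lambda>s. qpoch (f s) (g s)) holomorphic_on S"
proof (rule holomorphic_uniform_sequence[OF S])
  show "(\<lambda>s. \<Prod>n<N. 1 - g s * f s ^ n) holomorphic_on S" for N
    by (intro holomorphic_intros hol)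
  fix s assume "s \<in> S"
  then obtain d where d: "d > 0" "cball s d \<subseteq> S" using S open_contains_cball by blast
  have "uniform_limit (cball s d) (\<lambda>N s. \<Prod>n<N. 1 - g s * f s ^ n) (\<lambda>s. qpoch (f s) (g s)) sequentially"
    using d f hol by (intro uniform_limit_qpoch)
      (auto intro: holomorphic_on_imp_continuous_on holomorphic_on_subset continuous_on_subset)
  with d show "\<exists>d>0. cball s d \<subseteq> S \<and>
      uniform_limit (cball s d) (\<lambda>N s. \<Prod>n<N. 1 - g s * f s ^ n) (\<lambda>s. qpoch (f s) (g s)) sequentially"
    by blast
qed

lemma qpoch_mult_minus:
  assumes "norm q < 1"
  shows "qpoch q x * qpoch q (-x) = qpoch (q\<^sup>2) (x\<^sup>2)"
proof (rule LIMSEQ_unique)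
  have q2: "norm (q\<^sup>2) < 1" using assms by (simp add: norm_power power_less_one_iff)
  show "(\<lambda>N. (\<Prod>n<N. 1 - x * q ^ n) * (\<Prod>n<N. 1 - (-x) * q ^ n)) \<longlonglongrightarrow> qpoch q x * qpoch q (-x)"
    by (intro tendsto_mult LIMSEQ_qpoch assms)
  have "(\<Prod>n<N. 1 - x * q ^ n) * (\<Prod>n<N. 1 - (-x) * q ^ n) = (\<Prod>n<N. 1 - x\<^sup>2 * (q\<^sup>2) ^ n)" for N
    by (simp add: prod.distrib[symmetric] algebra_simps power2_eq_square power_mult_distrib)
  then show "(\<lambda>N. (\<Prod>n<N. 1 - x * q ^ n) * (\<Prod>n<N. 1 - (-x) * q ^ n)) \<longlonglongrightarrow> qpoch (q\<^sup>2) (x\<^sup>2)"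
    using LIMSEQ_qpoch[OF q2] by simp
qed

lemma qpoch_split:
  assumes "norm q < 1"
  shows "qpoch q x = qpoch (q\<^sup>2) x * qpoch (q\<^sup>2) (q * x)"
proof (rule LIMSEQ_unique)
  have q2: "norm (q\<^sup>2) < 1" using assms by (simp add: norm_power power_less_one_iff)
  show "(\<lambda>N. (\<Prod>n<2*N. 1 - x * q ^ n)) \<longlonglongrightarrow> qpoch q x"
    using LIMSEQ_subseq_LIMSEQ[OF LIMSEQ_qpoch[OF assms, of x], of "\<lambda>n. 2 * n"]
    by (simp add: o_def strict_mono_def)
  have "(\<Prod>n<2*N. 1 - x * q ^ n) = (\<Prod>n<N. 1 - x * (q\<^sup>2) ^ n) * (\<Prod>n<N. 1 - (q * x) * (q\<^sup>2) ^ n)" for N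
    by (induction N) (simp_all add: power_mult[symmetric] mult_ac)
  then show "(\<lambda>N. (\<Prod>n<2*N. 1 - x * q ^ n)) \<longlonglongrightarrow> qpoch (q\<^sup>2) x * qpoch (q\<^sup>2) (q * x)"
    using tendsto_mult[OF LIMSEQ_qpoch[OF q2] LIMSEQ_qpoch[OF q2]] by simp
qed

lemma qpoch_self_nonzero: "norm q < 1 \<Longrightarrow> qpoch q q \<noteq> 0"
proof
  assume q: "norm q < 1" and "qpoch q q = 0"
  then obtain n where "q ^ Suc n = 1" by (auto simp: qpoch_eq_0_iff)
  then have "norm q ^ Suc n = 1" by (metis norm_one norm_power)
  then show False using q by (metis norm_ge_zero power_eq_1_iff less_irrefl Zero_not_Suc abs_norm_cancel real_norm_def)
qed

text \<open>In classical notation (-q;q) (q;q^2) = 1. Splitting (q;q) by the parity of the exponent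
  and multiplying it by (-q;q) both produce (q^2;q^2), which is nonzero and cancels. The factor
  (q;q^2) is written as a product over the two square roots of \<open>q\<close>.\<close>

lemma qpoch_euler:
  assumes q: "norm q < 1" and r: "r\<^sup>2 = q"
  shows "qpoch q (-q) * qpoch q r * qpoch q (-r) = 1"
proof -
  have q2: "norm (q\<^sup>2) < 1" using q by (simp add: norm_power power_less_one_iff)
  have 1: "qpoch q r * qpoch q (-r) = qpoch (q\<^sup>2) q"
    using qpoch_mult_minus[OF q, of r] r by simp
  have 2: "qpoch q q = qpoch (q\<^sup>2) q * qpoch (q\<^sup>2) (q\<^sup>2)"
    using qpoch_split[OF q, of q] by (simp add: power2_eq_square)
  have 3: "qpoch q q * qpoch q (-q) = qpoch (q\<^sup>2) (q\<^sup>2)"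
    using qpoch_mult_minus[OF q, of q] by simp
  have "qpoch (q\<^sup>2) q * qpoch q (-q) * qpoch (q\<^sup>2) (q\<^sup>2) = 1 * qpoch (q\<^sup>2) (q\<^sup>2)"
    using 2 3 by (simp add: mult_ac)
  then have "qpoch (q\<^sup>2) q * qpoch q (-q) = 1"
    using qpoch_self_nonzero[OF q2] by (metis mult_right_cancel)
  then show ?thesis using 1 by (metis mult.assoc mult.commute)
qed

section \<open>Theta functions and Liouville's theorem\<close>

definition qtheta :: "complex \<Rightarrow> complex \<Rightarrow> complex" where
  "qtheta q x = qpoch q x * qpoch q (q / x)"

lemma qtheta_shift:
  assumes "norm q < 1" "q \<noteq> 0" "x \<noteq> 0"
  shows "qtheta q (q * x) = - qtheta q x / x"
proof -
  have "qtheta q (q * x) = qpoch q (q * x) * qpoch q (1 / x)"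
    using assms by (simp add: qtheta_def)
  also have "qpoch q (1 / x) = (1 - 1 / x) * qpoch q (q / x)"
    using qpoch_rec[OF assms(1), of "1 / x"] by simp
  also have "qpoch q (q * x) * ((1 - 1 / x) * qpoch q (q / x)) = - ((1 - x) * qpoch q (q * x)) * qpoch q (q / x) / x"
    using assms by (simp add: field_simps)
  also have "(1 - x) * qpoch q (q * x) = qpoch q x" using qpoch_rec[OF assms(1), of x] by simp
  finally show ?thesis by (simp add: qtheta_def)
qed

lemma qtheta_eq_0_iff:
  assumes "norm q < 1" "q \<noteq> 0" "x \<noteq> 0"
  shows "qtheta q x = 0 \<longleftrightarrow> (\<exists>n::int. x = q powi n)"
proof
  assume "qtheta q x = 0"
  then consider n where "x * q ^ n = 1" | n where "q / x * q ^ n = 1"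
    using assms by (auto simp: qtheta_def qpoch_eq_0_iff)
  then show "\<exists>n::int. x = q powi n"
  proof cases
    case 1
    then have "x = q powi (- int n)" using assms by (simp add: power_int_minus field_simps)
    then show ?thesis by blast
  next
    case 2
    then have "x = q powi (int (Suc n))" using assms by (simp add: field_simps power_int_def nat_add_distrib del: of_nat_Suc)
    then show ?thesis by blast
  qed
next
  assume "\<exists>n::int. x = q powi n"
  then obtain n :: int where n: "x = q powi n" by blast
  show "qtheta q x = 0"
  proof (cases "n \<le> 0")
    case True
    then have "x * q ^ nat (- n) = 1"
      using n assms by (cases "n = 0") (auto simp: power_int_def field_simps)
    then show ?thesis using assms by (auto simp: qtheta_def qpoch_eq_0_iff)
  next
    case False
    then have "nat n = Suc (nat (n - 1))" by linarith
    then have "x = q ^ Suc (nat (n - 1))" using n False by (simp add: power_int_def)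
    then have "q / x * q ^ nat (n - 1) = 1" using assms by (simp add: field_simps)
    then show ?thesis using assms by (auto simp: qtheta_def qpoch_eq_0_iff)
  qed
qed

text \<open>The quotient f/g is doubly periodic. Its only possible poles are lattice points, where
  the simple zero of \<open>g\<close> meets a zero of \<open>f\<close>; so it is entire and bounded.
  The constant is its limit at 0. At the zeros of \<open>g\<close> itself, \<open>f\<close> vanishes
  by quasi-periodicity.\<close>

lemma elliptic_proportional:
  fixes f g :: "complex \<Rightarrow> complex" and z :: complex
  assumes z: "Im z > 0"
    and hol: "f holomorphic_on UNIV" "g holomorphic_on UNIV"
    and per: "\<And>w. f (w + 1) = f w" "\<And>w. g (w + 1) = g w"
    and qper: "\<And>w. f (w + z) = u w * f w" "\<And>w. g (w + z) = u w * g w" "\<And>w. u w \<noteq> 0"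
    and zeros: "\<And>w. g w = 0 \<Longrightarrow> \<exists>m n :: int. w = of_int m + of_int n * z"
    and f0: "f 0 = 0" and g0: "g 0 = 0"
    and f': "(f has_field_derivative f') (at 0)"
    and g': "(g has_field_derivative g') (at 0)" "g' \<noteq> 0"
  shows "f w = f' / g' * g w"
proof -
  define h where "h w = (if g w = 0 then f' / g' else f w / g w)" for w
  have h1: "h (w + 1) = h w" for w by (simp add: h_def per)
  have hz: "h (w + z) = h w" for w using qper(3)[of w] by (simp add: h_def qper)
  have h1n: "h (w + of_nat n) = h w" for w n
  proof (induction n)
    case (Suc n)
    have "h (w + of_nat (Suc n)) = h ((w + of_nat n) + 1)" by (simp add: add_ac)
    then show ?case using Suc h1 by metis
  qed simp
  have hzn: "h (w + of_nat n * z) = h w" for w n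
  proof (induction n)
    case (Suc n)
    have "h (w + of_nat (Suc n) * z) = h ((w + of_nat n * z) + z)" by (simp add: algebra_simps)
    then show ?case using Suc hz by metis
  qed simp
  have h1i: "h (w + of_int m) = h w" for w m
    using h1n[of w "nat m"] h1n[of "w + of_int m" "nat (- m)"] by (cases "m \<ge> 0") auto
  have hzi: "h (w + of_int m * z) = h w" for w m
    using hzn[of w "nat m"] hzn[of "w + of_int m * z" "nat (- m)"] by (cases "m \<ge> 0") auto
  have hper: "h (w + of_int m + of_int n * z) = h w" for w m n by (simp add: h1i hzi)
  have loc0: "\<exists>e>0. h holomorphic_on ball 0 e"
  proof -
    have q1: "(\<lambda>w. g w / w) \<midarrow>0\<rightarrow> g'" and q2: "(\<lambda>w. f w / w) \<midarrow>0\<rightarrow> f'"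
      using f' g'(1) f0 g0 by (simp_all add: has_field_derivative_iff)
    have "\<forall>\<^sub>F w in at 0. g w / w \<noteq> 0"
      by (rule tendsto_imp_eventually_ne[OF q1 g'(2)])
    then obtain e where e: "e > 0" "\<And>w. w \<noteq> 0 \<Longrightarrow> dist w 0 < e \<Longrightarrow> g w \<noteq> 0"
      unfolding eventually_at by (metis div_0 UNIV_I)
    have lim: "(h \<longlongrightarrow> h 0) (at 0)"
    proof -
      have "(\<lambda>w. (f w / w) / (g w / w)) \<midarrow>0\<rightarrow> f' / g'"
        by (rule tendsto_divide[OF q2 q1 g'(2)])
      moreover have "\<forall>\<^sub>F w in at 0. (f w / w) / (g w / w) = h w"
        unfolding eventually_at using e by (intro exI[of _ e]) (auto simp: h_def)
      ultimately have "(h \<longlongrightarrow> f' / g') (at 0)" by (rule Lim_transform_eventually)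
      then show ?thesis using g0 by (simp add: h_def)
    qed
    have "h holomorphic_on ball 0 e"
    proof (rule no_isolated_singularity'[where K = "{0}"])
      have "(\<lambda>w. f w / g w) holomorphic_on ball 0 e - {0}"
        by (intro holomorphic_intros holomorphic_on_subset[OF hol(1)] holomorphic_on_subset[OF hol(2)])
          (use e in auto)
      then show "h holomorphic_on ball 0 e - {0}"
        by (rule holomorphic_transform) (use e in \<open>auto simp: h_def\<close>)
      show "(h \<longlongrightarrow> h w) (at w within ball 0 e)" if "w \<in> {0}" for w
        using that lim tendsto_within_subset[OF lim] by auto
    qed auto
    with e show ?thesis by blast
  qed
  have "h holomorphic_on UNIV"
  proof -
    have "h field_differentiable at w" for w
    proof (cases "g w = 0")
      case False
      have "\<forall>\<^sub>F v in nhds w. g v \<noteq> 0"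
        using False holomorphic_on_imp_continuous_on[OF hol(2)]
        by (intro tendsto_imp_eventually_ne[of g "g w"])
          (auto simp: continuous_on_eq_continuous_at continuous_at tendsto_at_iff_tendsto_nhds)
      then have ev: "\<forall>\<^sub>F v in nhds w. h v = f v / g v"
        by eventually_elim (simp add: h_def)
      have "(\<lambda>v. f v / g v) field_differentiable at w"
        using False hol by (intro field_differentiable_divide) (auto simp: holomorphic_on_def)
      then show ?thesis
        unfolding field_differentiable_def DERIV_cong_ev[OF refl ev refl] .
    next
      case True
      then obtain m n :: int where w: "w = of_int m + of_int n * z" using zeros by blast
      obtain e where e: "e > 0" "h holomorphic_on ball 0 e" using loc0 by blast
      have "h field_differentiable at 0"
        using e holomorphic_on_imp_differentiable_at[OF e(2), of 0] by auto
      then have "(\<lambda>v. h (v - w)) field_differentiable at w"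
        using field_differentiable_compose[of "\<lambda>v. v - w" w h]
        by (simp add: o_def field_differentiable_diff field_differentiable_ident field_differentiable_const)
      moreover have "h (v - w) = h v" for v
        using hper[of "v - w" m n] by (simp add: w algebra_simps)
      ultimately show ?thesis by simp
    qed
    then show ?thesis by (simp add: holomorphic_on_def field_differentiable_at_within)
  qed
  moreover have "bounded (range h)"
  proof -
    \<comment> \<open>A closed period parallelogram; fractional parts of the coordinates with
      respect to 1 and \<open>z\<close> move any point into it.\<close>
    define K where "K = (\<lambda>(s, t). complex_of_real s + complex_of_real t * z) ` ({0..1} \<times> {0..1})"
    have "compact K" unfolding K_def
      by (intro compact_continuous_image compact_Times) (auto simp: case_prod_unfold intro!: continuous_intros)
    then have "bounded (h ` K)"
      using \<open>h holomorphic_on UNIV\<close>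
      by (intro compact_imp_bounded compact_continuous_image)
        (auto intro: holomorphic_on_imp_continuous_on continuous_on_subset)
    moreover have "h w \<in> h ` K" for w
    proof -
      define t where "t = Im w / Im z"
      define s where "s = Re w - t * Re z"
      have w: "w = of_real s + of_real t * z"
        using z by (simp add: complex_eq_iff s_def t_def)
      have "w = (of_real (frac s) + of_real (frac t) * z) + of_int \<lfloor>s\<rfloor> + of_int \<lfloor>t\<rfloor> * z"
        unfolding w by (simp add: frac_def algebra_simps)
      then have "h w = h (of_real (frac s) + of_real (frac t) * z)" using hper by metis
      moreover have "of_real (frac s) + of_real (frac t) * z \<in> K"
        unfolding K_def by (auto intro!: image_eqI[of _ _ "(frac s, frac t)"] simp: frac_ge_0 less_imp_le[OF frac_lt_1])
      ultimately show ?thesis by auto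
    qed
    ultimately show ?thesis by (auto intro: bounded_subset)
  qed
  ultimately have "h constant_on UNIV" by (rule Liouville_theorem)
  then have "h w = h 0" by (auto simp: constant_on_def)
  then have hw: "h w = f' / g'" using g0 by (simp add: h_def)
  show ?thesis
  proof (cases "g w = 0")
    case False
    then show ?thesis using hw by (metis h_def nonzero_divide_eq_eq)
  next
    case True
    then obtain m n :: int where w: "w = of_int m + of_int n * z" using zeros by blast
    have f1: "f (w + of_int m) = f w" for w and m :: int
    proof -
      have *: "f (w + of_nat n) = f w" for w n
        by (induction n) (use per(1) in \<open>auto simp: add.assoc[symmetric] add.commute[of 1]\<close>)
      show ?thesis using *[of w "nat m"] *[of "w + of_int m" "nat (- m)"] by (cases "m \<ge> 0") auto
    qed
    have fz: "f (w + of_nat n * z) = 0 \<longleftrightarrow> f w = 0" for w n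
    proof (induction n)
      case (Suc n)
      have "f (w + of_nat (Suc n) * z) = u (w + of_nat n * z) * f (w + of_nat n * z)"
        by (subst qper(1)[symmetric]) (simp add: algebra_simps)
      then show ?case using Suc qper(3) by simp
    qed simp
    have "f w = 0"
      using fz[of "of_int m" "nat n"] fz[of w "nat (- n)"] f1[of 0 m] f0 w by (cases "n \<ge> 0") auto
    then show ?thesis using True by simp
  qed
qed

section \<open>The nome and the inversion formula\<close>

definition nome :: "complex \<Rightarrow> complex" where
  "nome z = exp (2 * of_real pi * \<i> * z)"

lemma nome_nonzero [simp]: "nome z \<noteq> 0" by (simp add: nome_def)

lemma norm_nome: "norm (nome z) = exp (- 2 * pi * Im z)"
  by (simp add: nome_def)

lemma norm_nome_less_1: "Im z > 0 \<Longrightarrow> norm (nome z) < 1"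
  by (simp add: norm_nome)

lemma nome_add: "nome (z + w) = nome z * nome w"
  by (simp add: nome_def exp_add algebra_simps)

lemma nome_minus: "nome (- z) = inverse (nome z)"
  by (simp add: nome_def exp_minus)

lemma nome_diff: "nome (z - w) = nome z / nome w"
  using nome_add[of z "- w"] by (simp add: nome_minus field_simps)

lemma nome_mult_nat: "nome (of_nat n * z) = nome z ^ n"
  by (simp add: nome_def exp_of_nat_mult[symmetric] mult_ac)

lemma nome_mult_int: "nome (of_int n * z) = nome z powi n"
  by (simp add: nome_def exp_power_int mult_ac)

lemma nome_eq_1_iff: "nome z = 1 \<longleftrightarrow> z \<in> \<int>"
proof
  assume "nome z = 1"
  then obtain n :: int where "Re z = of_int n" "Im z = 0"
    unfolding nome_def exp_eq_1 by auto
  then have "z = of_int n" by (simp add: complex_eq_iff)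
  then show "z \<in> \<int>" by simp
next
  assume "z \<in> \<int>"
  then obtain n where "z = of_int n" by (elim Ints_cases)
  then show "nome z = 1" using nome_mult_int[of n 1] by (simp add: nome_def)
qed

lemma nome_half: "nome (1 / 2) = -1"
  by (simp add: nome_def exp_pi_i)

lemma holomorphic_on_nome [holomorphic_intros]:
  "f holomorphic_on S \<Longrightarrow> (\<lambda>z. nome (f z)) holomorphic_on S"
  by (auto simp: nome_def intro!: holomorphic_intros)

text \<open>A theta function has a simple zero at 0. Once the vanishing factor is split off, its
  derivative there involves only the value \<open>H 0\<close> of the cofactor.\<close>

lemma has_field_derivative_one_minus_nome:
  assumes "H holomorphic_on UNIV"
  shows "((\<lambda>w. (1 - nome (c * w)) * H w) has_field_derivative (- 2 * of_real pi * \<i> * c * H 0)) (at 0)"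
proof -
  have H: "(H has_field_derivative deriv H 0) (at 0)"
    using assms by (simp add: holomorphic_derivI)
  show ?thesis unfolding nome_def
    by (rule derivative_eq_intros H refl | simp)+
qed

lemma Im_neg_inverse_pos: "Im z > 0 \<Longrightarrow> Im (- 1 / z) > 0"
  by (simp add: Im_divide power2_eq_square add_pos_nonneg add_nonneg_pos field_simps sum_squares_gt_zero_iff)

text \<open>The exponential factor is chosen so that both sides acquire the same multipliers under
  \<open>w \<mapsto> w + 1\<close> and \<open>w \<mapsto> w + z\<close>.\<close>

lemma qtheta_inversion:
  assumes z: "Im z > 0"
  defines "q \<equiv> nome z" and "q' \<equiv> nome (- 1 / z)"
  shows "nome ((- w\<^sup>2 / z + w - w / z) / 2) * qtheta q' (nome (w / z)) =
    qpoch q' q' ^ 2 / (z * qpoch q q ^ 2) * qtheta q (nome w)"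
proof -
  have q: "norm q < 1" "q \<noteq> 0" and q': "norm q' < 1" "q' \<noteq> 0"
    using z Im_neg_inverse_pos[OF z] by (auto simp: q_def q'_def intro!: norm_nome_less_1)
  have z0: "z \<noteq> 0" using z by auto
  define E where "E w = nome ((- w\<^sup>2 / z + w - w / z) / 2)" for w
  define f where "f w = E w * qtheta q' (nome (w / z))" for w
  define g where "g w = qtheta q (nome w)" for w
  have split: "qtheta a x = (1 - x) * (qpoch a (a * x) * qpoch a (a / x))" if "norm a < 1" for a x
    using qpoch_rec[OF that, of x] by (simp add: qtheta_def mult_ac)
  define F where "F w = E w * (qpoch q' (q' * nome (w / z)) * qpoch q' (q' / nome (w / z)))" for w
  define G where "G w = qpoch q (q * nome w) * qpoch q (q / nome w)" for w
  have hol: "F holomorphic_on UNIV" "G holomorphic_on UNIV"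
    unfolding F_def G_def E_def using z0 q q' by (auto intro!: holomorphic_intros)
  have fF: "f = (\<lambda>w. (1 - nome (1 / z * w)) * F w)"
    by (auto simp: f_def F_def split[OF q'(1)] fun_eq_iff)
  have gG: "g = (\<lambda>w. (1 - nome (1 * w)) * G w)"
    by (auto simp: g_def G_def split[OF q(1)] fun_eq_iff)
  have f': "(f has_field_derivative (- 2 * of_real pi * \<i> * (1 / z) * F 0)) (at 0)"
    unfolding fF by (rule has_field_derivative_one_minus_nome[OF hol(1)])
  have g': "(g has_field_derivative (- 2 * of_real pi * \<i> * 1 * G 0)) (at 0)"
    unfolding gG by (rule has_field_derivative_one_minus_nome[OF hol(2)])
  have nome0: "nome 0 = 1" by (simp add: nome_def)
  have F0: "F 0 = qpoch q' q' ^ 2" and G0: "G 0 = qpoch q q ^ 2"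
    by (simp_all add: F_def G_def E_def nome0 power2_eq_square)
  have "f w = (- 2 * of_real pi * \<i> * (1 / z) * F 0) / (- 2 * of_real pi * \<i> * 1 * G 0) * g w"
  \<comment> \<open>The multiplier \<open>- nome (- w)\<close> is the factor -1/x of
    \<open>qtheta_shift\<close> at \<open>x = nome w\<close>.\<close>
  proof (rule elliptic_proportional[OF z, where f = f and g = g and u = "\<lambda>w. - nome (- w)"])
    show "f holomorphic_on UNIV" "g holomorphic_on UNIV"
      unfolding fF gG using hol by (auto intro!: holomorphic_intros)
    show "g (w + 1) = g w" for w
      using nome_eq_1_iff[of 1] by (simp add: g_def nome_add)
    show "g (w + z) = - nome (- w) * g w" for w
      using qtheta_shift[OF q, of "nome w"] by (simp add: g_def nome_add nome_minus q_def[symmetric] mult_ac field_simps)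
    show "f (w + 1) = f w" for w
    proof -
      \<comment> \<open>Adding 1 to \<open>w\<close> divides \<open>nome (w / z)\<close> by
        \<open>q'\<close>, so the shift is applied backwards, starting from
        \<open>y\<close>.\<close>
      define y where "y = nome ((w + 1) / z)"
      have y0: "y \<noteq> 0" by (simp add: y_def)
      have 1: "nome (w / z) = q' * y"
        unfolding y_def q'_def nome_add[symmetric] using z0 by (simp add: field_simps)
      have 2: "qtheta q' y = - y * qtheta q' (nome (w / z))"
        unfolding 1 using qtheta_shift[OF q' y0] y0 by simp
      have "E (w + 1) = E w * nome (1 / 2) * nome (- (w + 1) / z)"
        unfolding E_def nome_add[symmetric] using z0
        by (intro arg_cong[of _ _ nome]) (simp add: field_simps power2_eq_square)
      moreover have "nome (- (w + 1) / z) = 1 / y"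
        unfolding y_def by (metis minus_divide_left nome_minus inverse_eq_divide)
      ultimately have "E (w + 1) = - E w / y" by (simp add: nome_half)
      then show ?thesis using y0 by (simp add: f_def y_def[symmetric] 2)
    qed
    show "f (w + z) = - nome (- w) * f w" for w
    proof -
      have "E (w + z) = E w * nome (- w) * nome (- (1 / 2))"
        unfolding E_def nome_add[symmetric] using z0
        by (intro arg_cong[of _ _ nome]) (simp add: field_simps power2_eq_square)
      moreover have "nome (- (1/2)) = -1" by (simp add: nome_minus nome_half)
      moreover have "nome ((w + z) / z) = nome (w / z)"
        using z0 nome_eq_1_iff[of 1] by (simp add: add_divide_distrib nome_add)
      ultimately show ?thesis by (simp add: f_def mult_ac)
    qed
    show "\<exists>m n :: int. w = of_int m + of_int n * z" if "g w = 0" for w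
    proof -
      from that obtain n :: int where "nome w = q powi n"
        using qtheta_eq_0_iff[OF q, of "nome w"] by (auto simp: g_def)
      then have "nome (w - of_int n * z) = 1"
        by (simp add: nome_diff nome_mult_int q_def)
      then obtain m where "w - of_int n * z = of_int m"
        by (auto simp: nome_eq_1_iff elim: Ints_cases)
      then show ?thesis by (metis diff_add_cancel)
    qed
    show "f 0 = 0" "g 0 = 0" by (simp_all add: fF gG nome0)
    show "- 2 * of_real pi * \<i> * 1 * G 0 \<noteq> 0"
      using qpoch_self_nonzero[OF q(1)] by (simp add: G0)
  qed (use f' g' in \<open>simp_all\<close>)
  then show ?thesis using z0 by (simp add: f_def g_def E_def F0 G0 field_simps)
qed

text \<open>Evaluation at the three points \<open>w = 1/2, z/2, (1 + z)/2\<close> of order two: by Euler's identity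
  the product of the three theta values is elementary, which determines the twelfth power of the
  constant \<open>K\<close>.\<close>

lemma qpoch_inversion:
  assumes z: "Im z > 0"
  defines "q \<equiv> nome z" and "q' \<equiv> nome (- 1 / z)"
  shows "q' * qpoch q' q' ^ 24 = z ^ 12 * (q * qpoch q q ^ 24)"
proof -
  have q: "norm q < 1" "q \<noteq> 0" and q': "norm q' < 1" "q' \<noteq> 0"
    using z Im_neg_inverse_pos[OF z] by (auto simp: q_def q'_def intro!: norm_nome_less_1)
  have z0: "z \<noteq> 0" using z by auto
  define K where "K = qpoch q' q' ^ 2 / (z * qpoch q q ^ 2)"
  define r where "r = nome (z / 2)"
  define r' where "r' = nome (- 1 / z / 2)"
  have r: "r\<^sup>2 = q" "r \<noteq> 0" and r': "r'\<^sup>2 = q'" "r' \<noteq> 0"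
    by (simp_all add: r_def r'_def q_def q'_def nome_mult_nat[symmetric])
  \<comment> \<open>Fourth powers turn the exponential prefactor at the half-periods into a monomial
    in \<open>r\<close> and \<open>r'\<close>, absorbing its root of unity.\<close>
  have qt: "nome (4 * ((- w\<^sup>2 / z + w - w / z) / 2)) * qtheta q' (nome (w / z)) ^ 4 = K ^ 4 * qtheta q (nome w) ^ 4" for w
  proof -
    have "(nome ((- w\<^sup>2 / z + w - w / z) / 2) * qtheta q' (nome (w / z))) ^ 4 = (K * qtheta q (nome w)) ^ 4"
      unfolding K_def q_def q'_def qtheta_inversion[OF z] ..
    then show ?thesis
      using nome_mult_nat[of 4 "(- w\<^sup>2 / z + w - w / z) / 2"] by (simp only: power_mult_distrib of_nat_numeral)
  qed
  have tm1: "qtheta a (-1) = 2 * qpoch a (-a) ^ 2" if "norm a < 1" for a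
    using qpoch_rec[OF that, of "-1"] by (simp add: qtheta_def power2_eq_square)
  have tr: "qtheta a s = qpoch a s ^ 2" if "s\<^sup>2 = a" "s \<noteq> 0" for a s
    using that by (auto simp: qtheta_def power2_eq_square)
  have ti: "qtheta a (1 / s) ^ 4 = qpoch a s ^ 8 / s ^ 4" if "norm a < 1" "s\<^sup>2 = a" "s \<noteq> 0" for a s
  proof -
    have "a * (1 / s) = s" using that by (auto simp: power2_eq_square)
    then have "qtheta a s = - qtheta a (1 / s) * s"
      using qtheta_shift[of a "1/s"] that by auto
    then have "qtheta a (1 / s) = - (qpoch a s ^ 2 / s)" using tr[OF that(2,3)] that by (simp add: field_simps)
    then show ?thesis by (simp add: power_divide)
  qed
  have r34: "r' ^ 3 * x / r' ^ 4 = x / r'" for x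
    using r'(2) by (simp add: power_numeral_reduce)
  have a: "qpoch q' r' ^ 8 / r' = 16 * K ^ 4 * qpoch q (-q) ^ 8"
  proof -
    have "nome (4 * ((- (1/2)\<^sup>2 / z + 1/2 - 1/2 / z) / 2)) = nome (of_nat 3 * (- 1 / z / 2)) * nome 1"
      unfolding nome_add[symmetric] by (intro arg_cong[of _ _ nome]) (simp add: field_simps power2_eq_square z0)
    then have 1: "nome (4 * ((- (1/2)\<^sup>2 / z + 1/2 - 1/2 / z) / 2)) = r' ^ 3"
      unfolding nome_mult_nat using nome_eq_1_iff[of 1] by (simp add: r'_def)
    have 2: "nome (1/2 / z) = 1 / r'"
      unfolding r'_def using nome_minus[of "- 1 / z / 2"] by (simp add: field_simps)
    show ?thesis using qt[of "1/2"] unfolding 1 2 nome_half ti[OF q'(1) r'] tm1[OF q(1)]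
      by (simp add: power_mult_distrib mult_ac r34)
  qed
  have b: "16 * r * qpoch q' (-q') ^ 8 = K ^ 4 * qpoch q r ^ 8"
  proof -
    have "nome (4 * ((- (z/2)\<^sup>2 / z + z/2 - z/2 / z) / 2)) = nome (z / 2) * nome (- 1)"
      unfolding nome_add[symmetric] by (intro arg_cong[of _ _ nome]) (simp add: field_simps power2_eq_square z0)
    then have 1: "nome (4 * ((- (z/2)\<^sup>2 / z + z/2 - z/2 / z) / 2)) = r"
      using nome_eq_1_iff[of "-1"] by (simp add: r_def)
    have 2: "nome (z/2 / z) = -1" using z0 nome_half by (simp add: field_simps)
    show ?thesis using qt[of "z/2"] unfolding 1 2 tm1[OF q'(1)] r_def[symmetric] tr[OF r]
      by (simp add: power_mult_distrib mult_ac)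
  qed
  have c: "qpoch q' (-r') ^ 8 * r / r' = K ^ 4 * qpoch q (-r) ^ 8"
  proof -
    have "nome (4 * ((- ((1+z)/2)\<^sup>2 / z + (1+z)/2 - (1+z)/2 / z) / 2)) = nome (of_nat 3 * (- 1 / z / 2)) * nome (z / 2) * nome (-1)"
      unfolding nome_add[symmetric] by (intro arg_cong[of _ _ nome]) (simp add: field_simps power2_eq_square z0)
    then have 1: "nome (4 * ((- ((1+z)/2)\<^sup>2 / z + (1+z)/2 - (1+z)/2 / z) / 2)) = r' ^ 3 * r"
      unfolding nome_mult_nat using nome_eq_1_iff[of "-1"] by (simp add: r'_def r_def)
    have "nome ((1+z)/2 / z) = nome (1/2/z) * nome (1/2)"
      unfolding nome_add[symmetric] by (intro arg_cong[of _ _ nome]) (simp add: field_simps z0)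
    then have 2: "nome ((1+z)/2 / z) = 1 / (- r')"
      unfolding r'_def using nome_minus[of "- 1 / z / 2"] by (simp add: field_simps nome_half)
    have "nome ((1+z)/2) = nome (1/2) * nome (z/2)"
      unfolding nome_add[symmetric] by (intro arg_cong[of _ _ nome]) (simp add: field_simps z0)
    then have 3: "nome ((1+z)/2) = - r" by (simp add: nome_half r_def)
    have r'm: "(- r')\<^sup>2 = q'" "- r' \<noteq> 0" and rm: "(- r)\<^sup>2 = q" "- r \<noteq> 0" using r r' by auto
    show ?thesis using qt[of "(1+z)/2"] unfolding 1 2 3 ti[OF q'(1) r'm] tr[OF rm]
      using r34[of "r * qpoch q' (-r') ^ 8"] by (simp add: mult_ac)
  qed
  define X where "X = qpoch q (-q) * qpoch q r * qpoch q (-r)"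
  define X' where "X' = qpoch q' (-q') * qpoch q' r' * qpoch q' (-r')"
  have X: "X = 1" "X' = 1" unfolding X_def X'_def using qpoch_euler q q' r r' by auto
  have "16 * (r\<^sup>2 / r'\<^sup>2) * X' ^ 8 =
      (qpoch q' r' ^ 8 / r') * (16 * r * qpoch q' (-q') ^ 8) * (qpoch q' (-r') ^ 8 * r / r')"
    by (simp add: X'_def power_mult_distrib power2_eq_square mult_ac)
  also have "\<dots> = 16 * (K ^ 4 * K ^ 4 * K ^ 4) * X ^ 8"
    unfolding a b c by (simp add: X_def power_mult_distrib mult_ac)
  also have "K ^ 4 * K ^ 4 * K ^ 4 = K ^ 12" by (simp add: power_add[symmetric])
  finally have "16 * (q / q') = 16 * K ^ 12" using X r r' by simp
  then have "q / q' = K ^ 12" by (metis mult_left_cancel zero_neq_numeral)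
  then show ?thesis using z0 q'(2) qpoch_self_nonzero[OF q(1)]
    by (simp add: K_def power_divide power_mult_distrib field_simps power_mult[symmetric])
qed

section \<open>Power series modulo 2\<close>

text \<open>Shanks's finite form of Gauss's product formula for the generating function of the triangular
  numbers, with denominators cleared. On the left all terms but \<open>s = 0\<close> vanish to order
  \<open>2n + 1\<close> at \<open>x = 0\<close>.\<close>

lemma shanks_identity:
  fixes x :: "'a :: comm_ring_1"
  defines "m \<equiv> \<lambda>s::nat. \<Prod>k<s. 1 - x ^ (2 * k + 1)"
    and "v \<equiv> \<lambda>s n::nat. \<Prod>k=s..n. 1 - x ^ (2 * k)"
  shows "(\<Sum>s<n. x ^ (s * (2 * n + 1)) * m s * v (Suc s) n) = m n * (\<Sum>j<2*n. x ^ (j * (j + 1) div 2))"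
proof (induction n)
  case (Suc n)
  \<comment> \<open>Passing from n to n + 1 changes each summand, up to the factor 1 - x^(2n+1), by
    the telescoping difference \<open>w (Suc s) - w s\<close>.\<close>
  define w where "w s = x ^ (s * (2 * n + 1)) * m s * v s n" for s
  have "x ^ (s * (2 * Suc n + 1)) * m s * v (Suc s) (Suc n) =
      (1 - x ^ (2 * n + 1)) * (x ^ (s * (2 * n + 1)) * m s * v (Suc s) n) + (w (Suc s) - w s)" if "s < n" for s
  proof -
    have 1: "v (Suc s) (Suc n) = v (Suc s) n * (1 - x ^ (2 * n + 2))"
      using that by (simp add: v_def prod.nat_ivl_Suc')
    have 2: "v s n = (1 - x ^ (2 * s)) * v (Suc s) n"
      using that unfolding v_def by (subst prod.atLeast_Suc_atMost) auto
    have 3: "m (Suc s) = m s * (1 - x ^ (2 * s + 1))" by (simp add: m_def)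
    have 4: "x ^ (s * (2 * Suc n + 1)) = x ^ (s * (2 * n + 1)) * x ^ (2 * s)"
      by (simp add: power_add[symmetric] algebra_simps)
    have 5: "x ^ (Suc s * (2 * n + 1)) = x ^ (s * (2 * n + 1)) * x ^ (2 * n + 1)"
      by (simp add: power_add[symmetric] algebra_simps)
    have 6: "x ^ (2 * n + 2) = x ^ (2 * n + 1) * x" "x ^ (2 * s + 1) = x ^ (2 * s) * x" by (simp_all add: mult_ac)
    show ?thesis unfolding w_def 1 2 3 4 5 6 by (simp only: ring_distribs) (simp add: algebra_simps)
  qed
  then have "(\<Sum>s<n. x ^ (s * (2 * Suc n + 1)) * m s * v (Suc s) (Suc n)) =
      (1 - x ^ (2 * n + 1)) * (\<Sum>s<n. x ^ (s * (2 * n + 1)) * m s * v (Suc s) n) + (\<Sum>s<n. w (Suc s) - w s)"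
    by (simp add: sum.distrib sum_distrib_left)
  also have "(\<Sum>s<n. w (Suc s) - w s) = w n - w 0"
    by (rule sum_lessThan_telescope)
  \<comment> \<open>\<open>v 0 n\<close> contains the factor for \<open>k = 0\<close>, which is 1 -
    x^0 = 0.\<close>
  also have "w 0 = 0" by (simp add: w_def v_def prod.atLeast_Suc_atMost[of 0 n])
  finally have "(\<Sum>s<Suc n. x ^ (s * (2 * Suc n + 1)) * m s * v (Suc s) (Suc n)) =
      (1 - x ^ (2 * n + 1)) * (m n * (\<Sum>j<2*n. x ^ (j * (j + 1) div 2))) +
      (x ^ (n * (2 * n + 1)) * m n * (1 - x ^ (2 * n)) + x ^ (n * (2 * Suc n + 1)) * m n * (1 - x ^ (2 * n + 2)))"
    using Suc by (simp add: w_def v_def)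
  also have "x ^ (n * (2 * Suc n + 1)) = x ^ (n * (2 * n + 1)) * x ^ (2 * n)"
    by (simp add: power_add[symmetric] algebra_simps)
  also have "x ^ (n * (2 * n + 1)) * m n * (1 - x ^ (2 * n)) + x ^ (n * (2 * n + 1)) * x ^ (2 * n) * m n * (1 - x ^ (2 * n + 2)) =
      (1 - x ^ (2 * n + 1)) * m n * (x ^ (n * (2 * n + 1)) + x ^ (n * (2 * n + 1)) * x ^ (2 * n + 1))"
  proof -
    have "x ^ (2 * n) * x ^ (2 * n + 2) = x ^ (2 * n + 1) * x ^ (2 * n + 1)"
      by (simp add: power_add[symmetric])
    then show ?thesis by (simp only: ring_distribs mult.assoc) (simp add: algebra_simps)
  qed
  also have "x ^ (n * (2 * n + 1)) * x ^ (2 * n + 1) = x ^ ((2 * n + 1) * (2 * n + 1 + 1) div 2)"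
  proof -
    have "(2 * n + 1) * (2 * n + 1 + 1) div 2 = n * (2 * n + 1) + (2 * n + 1)" by (simp add: algebra_simps)
    then show ?thesis by (simp only: power_add[symmetric])
  qed
  also have "x ^ (n * (2 * n + 1)) = x ^ ((2 * n) * (2 * n + 1) div 2)"
    by (simp only: mult.assoc nonzero_mult_div_cancel_left[OF zero_neq_numeral[symmetric]])
  finally have "(\<Sum>s<Suc n. x ^ (s * (2 * Suc n + 1)) * m s * v (Suc s) (Suc n)) =
      (1 - x ^ (2 * n + 1)) * (m n * (\<Sum>j<2*n. x ^ (j * (j + 1) div 2))) +
      (1 - x ^ (2 * n + 1)) * m n * (x ^ ((2 * n) * (2 * n + 1) div 2) + x ^ ((2 * n + 1) * (2 * n + 1 + 1) div 2))" .
  moreover have "d * (k * t) + d * k * (y + z) = (k * d) * (t + y + z)" for d k t y z :: 'a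
    by (simp add: algebra_simps)
  moreover have "(\<Sum>j<2 * Suc n. h j) = (\<Sum>j<2*n. h j) + h (2 * n) + h (2 * n + 1)" for h :: "nat \<Rightarrow> 'a"
    by simp
  moreover have "m (Suc n) = m n * (1 - x ^ (2 * n + 1))" by (simp add: m_def)
  ultimately show ?case by (simp only:)
qed simp

text \<open>The n-th coefficient of the infinite product is already final in the n-th partial
  product. The coefficient ring is left general so that the integral series and its reduction share
  one definition.\<close>

definition euler_fps :: "'a::comm_ring_1 fps" where
  "euler_fps = Abs_fps (\<lambda>n. (\<Prod>k=1..n. 1 - fps_X ^ k) $ n)"

lemma fps_mult_nth_cong:
  assumes "\<And>i. i \<le> n \<Longrightarrow> a $ i = a' $ i" "\<And>i. i \<le> n \<Longrightarrow> b $ i = b' $ i" "i \<le> n"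
  shows "(a * b) $ i = (a' * b') $ i"
  using assms by (simp add: fps_mult_nth)

lemma fps_power_nth_cong:
  assumes "\<And>i. i \<le> n \<Longrightarrow> a $ i = a' $ i" "i \<le> n"
  shows "(a ^ k) $ i = (a' ^ k) $ i"
  using assms(2) by (induction k arbitrary: i) (auto intro!: fps_mult_nth_cong[where n = n] assms(1))

lemma fps_mult_X_power_nth_less: "i < k \<Longrightarrow> (fps_X ^ k * a) $ i = 0"
  by (simp add: fps_X_power_mult_nth)

lemma euler_fps_nth:
  assumes "n \<le> N"
  shows "euler_fps $ n = (\<Prod>k=1..N. 1 - fps_X ^ k :: 'a::comm_ring_1 fps) $ n"
  using assms
proof (induction N rule: dec_induct)
  case base
  then show ?case by (simp add: euler_fps_def)
next
  case (step N)
  have "(\<Prod>k=1..Suc N. 1 - fps_X ^ k :: 'a fps) $ n =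
      (\<Prod>k=1..N. 1 - fps_X ^ k :: 'a fps) $ n - (fps_X ^ Suc N * (\<Prod>k=1..N. 1 - fps_X ^ k :: 'a fps)) $ n"
    by (simp add: prod.nat_ivl_Suc' algebra_simps del: power_Suc)
  also have "(fps_X ^ Suc N * (\<Prod>k=1..N. 1 - fps_X ^ k :: 'a fps)) $ n = 0"
    using step by (intro fps_mult_X_power_nth_less) auto
  finally show ?case using step by simp
qed

lemma bit_fps_add_self [simp]: "f + f = (0 :: bit fps)"
  by (rule fps_ext) simp

lemma bit_fps_minus [simp]: "- f = (f :: bit fps)"
  by (rule fps_ext) simp

lemma bit_fps_diff [simp]: "f - g = f + (g :: bit fps)"
  by (rule fps_ext) simp

lemma bit_fps_add_left_self [simp]: "f + (f + g) = (g :: bit fps)"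
  by (simp add: add.assoc[symmetric])

lemma bit_fps_two [simp]: "2 = (0 :: bit fps)"
  using bit_fps_add_self[of 1] by (simp only: one_add_one)

lemma bit_fps_power2_add: "(f + g) ^ 2 = f ^ 2 + (g ^ 2 :: bit fps)"
  by (simp add: power2_sum)

text \<open>Frobenius: squaring substitutes x^2 for x. The induction peels off the constant term, as
  the square of c + x h is c + x^2 h^2.\<close>

lemma bit_fps_square_nth: "(f ^ 2) $ n = (if even n then f $ (n div 2) else (0 :: bit))"
proof (induction n arbitrary: f rule: less_induct)
  case (less n)
  have f: "f = fps_const (f $ 0) + fps_X * fps_shift 1 f"
    by (rule fps_ext) simp
  have "f ^ 2 = fps_const (f $ 0) ^ 2 + fps_X ^ 2 * fps_shift 1 f ^ 2"
    by (subst f) (simp add: bit_fps_power2_add power_mult_distrib)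
  also have "fps_const (f $ 0) ^ 2 = fps_const (f $ 0)"
    by (cases "f $ 0") (simp_all)
  finally have eq: "(f ^ 2) $ n = (fps_const (f $ 0)) $ n + (fps_X ^ 2 * fps_shift 1 f ^ 2) $ n" by simp
  show ?case
  proof (cases "n < 2")
    case True
    then have "n = 0 \<or> n = 1" by auto
    then show ?thesis using eq by (auto simp: fps_X_power_mult_nth)
  next
    case False
    then obtain k where k: "n = Suc (Suc k)" by (metis One_nat_def Suc_1 add_2_eq_Suc le_Suc_ex not_le)
    then have "(f ^ 2) $ n = (fps_shift 1 f ^ 2) $ k"
      using eq by (simp add: fps_X_power_mult_nth)
    also have "\<dots> = (if even n then f $ (n div 2) else 0)"
      using less[of k "fps_shift 1 f"] by (simp add: k)
    finally show ?thesis .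
  qed
qed

lemma bit_fps_power8_nth: "(f ^ 8) $ n = (if 8 dvd n then f $ (n div 8) else (0 :: bit))"
proof -
  have "f ^ 8 = ((f ^ 2) ^ 2) ^ 2" by (simp add: power_mult[symmetric])
  also have "\<dots> $ n = (if 8 dvd n then f $ (n div 8) else 0)"
    unfolding bit_fps_square_nth by (auto simp: div_mult2_eq[symmetric] elim!: evenE)
  finally show ?thesis .
qed

text \<open>Modulo 2 the even part \<open>v 1 n\<close> of the Euler product is the square of
  \<open>Q n\<close>, and \<open>m n * v 1 n = Q (2 * n)\<close>. Multiplying Shanks's identity by
  \<open>v 1 n\<close> gives, up to order n, that P^4 = P T for the Euler product P and the
  triangular series T; then P cancels.\<close>

lemma euler_fps_cubed:
  "(euler_fps :: bit fps) ^ 3 = Abs_fps (\<lambda>n. if \<exists>k. n = k * (k + 1) div 2 then 1 else 0)"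
proof -
  let ?T = "Abs_fps (\<lambda>n. if \<exists>k. n = k * (k + 1) div 2 then 1 else 0) :: bit fps"
  let ?x = "fps_X :: bit fps"
  define Q where "Q N = (\<Prod>k=1..N. 1 - ?x ^ k)" for N
  have "(euler_fps * ?T) $ n = (euler_fps ^ 4) $ n" for n
  proof -
    define m where "m s = (\<Prod>k<s. 1 - ?x ^ (2 * k + 1))" for s
    define v where "v s n = (\<Prod>k=s..n. 1 - ?x ^ (2 * k))" for s n :: nat
    have vQ: "v 1 n = Q n ^ 2"
      unfolding v_def Q_def prod_power_distrib
      by (intro prod.cong) (auto simp: bit_fps_power2_add power_mult[symmetric] mult.commute)
    have mv: "m n * v 1 n = Q (2 * n)"
      unfolding m_def v_def Q_def
      by (induction n) (simp_all add: prod.nat_ivl_Suc' mult_ac)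
    have tri: "(\<Sum>j<2*n. ?x ^ (j * (j + 1) div 2)) $ i = ?T $ i" if "i \<le> n" "n > 0" for i
    proof -
      have inj: "j = j'" if "j * (j + 1) div 2 = j' * (j' + 1) div (2::nat)" for j j' :: nat
      proof -
        have "2 * (j * (j + 1) div 2) = j * (j + 1)" for j :: nat
          by (rule even_two_times_div_two) simp
        then have eq: "j * (j + 1) = j' * (j' + 1)" using that by metis
        have "a * (a + 1) < b * (b + 1)" if "a < b" for a b :: nat
          using that by (intro mult_strict_mono) auto
        then show ?thesis using eq by (metis less_irrefl linorder_neqE_nat)
      qed
      have big: "j < 2 * n" if "i = j * (j + 1) div 2" for j
      proof (rule ccontr)
        assume "\<not> j < 2 * n"
        then have "(2 * n) * (2 * n + 1) div 2 \<le> j * (j + 1) div 2" by (intro div_le_mono mult_mono) auto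
        then have "n * (2 * n + 1) \<le> i" using that by (simp add: mult.assoc)
        moreover have "n * (2 * n + 1) > n * 1" using \<open>n > 0\<close> by (intro mult_strict_left_mono) auto
        ultimately show False using \<open>i \<le> n\<close> by linarith
      qed
      have "(\<Sum>j<2*n. ?x ^ (j * (j + 1) div 2)) $ i = (\<Sum>j<2*n. if i = j * (j + 1) div 2 then 1 else 0)"
        by (simp add: fps_sum_nth)
      also have "\<dots> = ?T $ i"
      proof (cases "\<exists>k. i = k * (k + 1) div 2")
        case True
        then obtain k where k: "i = k * (k + 1) div 2" by blast
        have "i = j * (j + 1) div 2 \<longleftrightarrow> j = k" for j
        proof
          assume "i = j * (j + 1) div 2"
          then show "j = k" using k inj[of j k] by (simp only:)
        qed (simp only: k)
        then have "(\<Sum>j<2*n. if i = j * (j + 1) div 2 then 1 else 0) = (\<Sum>j<2*n. if j = k then 1 else (0::bit))"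
          by (simp only:)
        also have "\<dots> = 1" using big[OF k] by simp
        finally show ?thesis using True by simp
      qed auto
      finally show ?thesis .
    qed
    show ?thesis
    proof (cases "n = 0")
      case True
      have "\<exists>k. 0 = k * (k + 1) div (2::nat)" by (rule exI[of _ 0]) simp
      then have "?T $ 0 = 1" unfolding fps_nth_Abs_fps by (rule if_P)
      moreover have "euler_fps $ 0 = (1 :: bit)" by (simp add: euler_fps_def)
      ultimately show ?thesis using True by (simp add: fps_power_zeroth)
    next
      case False
      let ?S = "\<Sum>s<n. ?x ^ (s * (2 * n + 1)) * m s * v (Suc s) n"
      obtain l where n: "n = Suc l" using False by (cases n) auto
      have Seq: "?S = v 1 n + ?x ^ (2 * n + 1) * (\<Sum>s<l. ?x ^ (s * (2 * n + 1)) * m (Suc s) * v (Suc (Suc s)) n)"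
        unfolding n sum.lessThan_Suc_shift
        by (simp add: m_def sum_distrib_left power_add mult_ac)
      have S: "?S $ i = v 1 n $ i" if "i \<le> n" for i
      proof -
        have "i < 2 * n + 1" using that by simp
        then show ?thesis
          by (simp only: Seq fps_add_nth fps_mult_X_power_nth_less add_0_right)
      qed
      have "?S = m n * (\<Sum>j<2*n. ?x ^ (j * (j + 1) div 2))"
        using shanks_identity[of ?x n] by (simp add: m_def v_def)
      then have vS: "v 1 n * ?S = Q (2 * n) * (\<Sum>j<2*n. ?x ^ (j * (j + 1) div 2))"
        unfolding mv[symmetric] by (simp only: mult_ac)
      have "(v 1 n * ?S) $ n = (v 1 n * v 1 n) $ n"
        by (rule fps_mult_nth_cong[OF refl S order_refl])
      then have "(Q (2 * n) * (\<Sum>j<2*n. ?x ^ (j * (j + 1) div 2))) $ n = (v 1 n * v 1 n) $ n"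
        by (simp only: vS)
      moreover have "(euler_fps * ?T) $ n = (Q (2 * n) * (\<Sum>j<2*n. ?x ^ (j * (j + 1) div 2))) $ n"
        using tri False by (intro fps_mult_nth_cong[where n = n]) (auto simp: euler_fps_nth[of _ "2 * n"] Q_def)
      moreover have "v 1 n * v 1 n = Q n ^ 4" unfolding vQ by (simp add: power2_eq_square power_numeral_reduce mult_ac)
      moreover have "(Q n ^ 4) $ n = (euler_fps ^ 4) $ n"
        by (intro fps_power_nth_cong[where n = n]) (auto simp: euler_fps_nth[of _ n] Q_def)
      ultimately show ?thesis by simp
    qed
  qed
  then have "euler_fps * ?T = euler_fps * euler_fps ^ 3"
    by (intro fps_ext) (simp add: power_numeral_reduce)
  moreover have "(euler_fps :: bit fps) \<noteq> 0"
  proof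
    assume "(euler_fps :: bit fps) = 0"
    then have "(euler_fps :: bit fps) $ 0 = 0" by simp
    then show False by (simp add: euler_fps_def)
  qed
  ultimately show ?thesis by simp
qed

text \<open>Odd squares are (2k+1)^2 = 1 + 8 (k(k+1)/2), so \<open>F\<close> is x T(x^8) for the
  triangular series T, and T(x^8) is the eighth power of T modulo 2.\<close>

lemma F_eq: "F = fps_X * euler_fps ^ 24"
proof (rule fps_ext)
  fix n
  have sq: "(\<exists>k::nat. odd k \<and> Suc m = k ^ 2) \<longleftrightarrow> 8 dvd m \<and> (\<exists>k. m div 8 = k * (k + 1) div 2)" for m
  proof
    assume "\<exists>k::nat. odd k \<and> Suc m = k ^ 2"
    then obtain l where "Suc m = (2 * l + 1) ^ 2" by (auto elim!: oddE)
    then have m: "m = 4 * (l * (l + 1))" by (simp add: power2_eq_square algebra_simps)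
    obtain t where t: "l * (l + 1) = 2 * t" by (metis evenE even_mult_iff even_plus_one_iff)
    have "m = 8 * t" using m t by simp
    moreover have "t = l * (l + 1) div 2" using t by simp
    ultimately show "8 dvd m \<and> (\<exists>k. m div 8 = k * (k + 1) div 2)" by auto
  next
    assume "8 dvd m \<and> (\<exists>k. m div 8 = k * (k + 1) div 2)"
    then obtain k t where m: "m = 8 * t" "t = k * (k + 1) div 2" by auto
    have "2 * t = k * (k + 1)" using m by simp
    then have "Suc m = (2 * k + 1) ^ 2" using m(1) by (simp add: power2_eq_square algebra_simps)
    then show "\<exists>k::nat. odd k \<and> Suc m = k ^ 2" by (intro exI[of _ "2 * k + 1"]) auto
  qed
  have "(euler_fps :: bit fps) ^ 24 = (euler_fps ^ 3) ^ 8" by (simp add: power_mult[symmetric])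
  then show "F $ n = (fps_X * euler_fps ^ 24) $ n"
    using sq by (cases n) (auto simp: F_def bit_fps_power8_nth euler_fps_cubed)
qed

section \<open>Spans over the field with two elements\<close>

lemma span_Z2_base: "x \<in> S \<Longrightarrow> x \<in> span_Z2 S"
  unfolding span_Z2_def by (auto intro!: exI[of _ "{x}"] exI[of _ "\<lambda>_. 1"])

lemma span_Z2_0: "0 \<in> span_Z2 S"
  unfolding span_Z2_def by (auto intro!: exI[of _ "{}"])

lemma span_Z2_add:
  assumes "x \<in> span_Z2 S" "y \<in> span_Z2 S"
  shows "x + y \<in> span_Z2 S"
proof -
  from assms obtain A B c d where A: "finite A" "A \<subseteq> S" "x = (\<Sum>g\<in>A. fps_const (c g) * g)"
    and B: "finite B" "B \<subseteq> S" "y = (\<Sum>g\<in>B. fps_const (d g) * g)"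
    by (auto simp: span_Z2_def)
  define c' where "c' g = (if g \<in> A then c g else 0)" for g
  define d' where "d' g = (if g \<in> B then d g else 0)" for g
  have "x = (\<Sum>g\<in>A \<union> B. fps_const (c' g) * g)" "y = (\<Sum>g\<in>A \<union> B. fps_const (d' g) * g)"
    unfolding A(3) B(3) using A(1) B(1)
    by (auto simp: c'_def d'_def intro!: sum.mono_neutral_cong_left)
  then have "x + y = (\<Sum>g\<in>A \<union> B. fps_const (c' g + d' g) * g)"
    by (simp only: sum.distrib distrib_right fps_const_add[symmetric])
  then show ?thesis
    unfolding span_Z2_def using A B by (intro CollectI exI[of _ "A \<union> B"] exI[of _ "\<lambda>g. c' g + d' g"]) auto
qed

text \<open>The only scalars are 0 and 1, so an element of the span is built from 0 by adding one
  member of \<open>S\<close> at a time.\<close>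

lemma span_Z2_induct [consumes 1, case_names 0 add]:
  assumes "h \<in> span_Z2 S" "P 0" "\<And>x y. x \<in> S \<Longrightarrow> P y \<Longrightarrow> P (x + y)"
  shows "P h"
proof -
  from assms(1) obtain A c where A: "finite A" "A \<subseteq> S" and h: "h = (\<Sum>g\<in>A. fps_const (c g) * g)"
    by (auto simp: span_Z2_def)
  have "P (\<Sum>g\<in>A. fps_const (c g) * g)"
    using A
  proof (induction A rule: finite_induct)
    case (insert x A)
    then show ?case using assms(3)[of x] by (cases "c x") auto
  qed (use assms in auto)
  then show ?thesis using h by simp
qed

text \<open>With \<open>A + B = 1\<close> modulo 2, the \<open>\<int>/2\<close>-span of the odd monomials in \<open>F = A\<^sup>2 C\<close> and
  \<open>G = B\<^sup>2 C\<close> contains \<open>C = F + G\<close>, and it is stable under multiplication by \<open>B\<close> because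
  \<open>B C = C\<^sup>3 + G\<close> and \<open>B G = C\<^sup>2 G + C\<^sup>5 + G\<close>.\<close>

lemma odd_span_contains:
  fixes a b c f g :: "bit fps"
  assumes ab: "a + b = 1" and c2: "c ^ 2 = a * b" and f: "f = a ^ 2 * c" and g: "g = b ^ 2 * c"
  shows "c * b ^ n \<in> span_Z2 {f ^ i * g ^ j | i j. odd (i + j)}"
proof -
  let ?S = "{f ^ i * g ^ j | i j. odd (i + j)}"
  have a: "a = 1 + b" using ab by (metis bit_fps_add_left_self add.commute)
  \<comment> \<open>The relation c^2 = b + b^2, with a trailing factor so that as a rewrite rule it
    lowers the degree in \<open>c\<close> inside any product.\<close>
  have c2': "c * (c * x) = b * x + b * (b * x)" for x
  proof -
    have "c * (c * x) = c ^ 2 * x" by (simp only: power2_eq_square mult.assoc)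
    then show ?thesis by (simp add: c2 a algebra_simps)
  qed
  have c: "c = f + g" unfolding f g a by (simp add: algebra_simps power2_eq_square)
  have mono: "f ^ i * g ^ j * (f ^ k * g ^ l) \<in> span_Z2 ?S" if "odd (i + j)" "even (k + l)" for i j k l
    using that by (intro span_Z2_base CollectI exI[of _ "i + k"] exI[of _ "j + l"])
      (auto simp: power_add mult_ac)
  have even_mult: "x * (f ^ k * g ^ l) \<in> span_Z2 ?S" if "x \<in> span_Z2 ?S" "even (k + l)" for x k l
    using that(1)
  proof (induction rule: span_Z2_induct)
    case (add x y)
    then show ?case using mono that(2) by (auto simp: distrib_right intro!: span_Z2_add)
  qed (simp add: span_Z2_0)
  have F: "f \<in> span_Z2 ?S"
    by (intro span_Z2_base CollectI exI[of _ 1] exI[of _ 0]) simp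
  have G: "g \<in> span_Z2 ?S"
    by (intro span_Z2_base CollectI exI[of _ 0] exI[of _ 1]) simp
  have C: "c \<in> span_Z2 ?S" unfolding c by (intro span_Z2_add F G)
  \<comment> \<open>Modulo 2, \<open>c ^ 2 = f ^ 2 + g ^ 2\<close>, a sum of even monomials, and
    these preserve the odd span.\<close>
  have csq: "x * c ^ 2 \<in> span_Z2 ?S" if "x \<in> span_Z2 ?S" for x
  proof -
    have "x * c ^ 2 = x * (f ^ 2 * g ^ 0) + x * (f ^ 0 * g ^ 2)"
      unfolding c by (simp add: bit_fps_power2_add distrib_left)
    also have "\<dots> \<in> span_Z2 ?S" by (intro span_Z2_add even_mult that) auto
    finally show ?thesis .
  qed
  have bc: "b * c = c * c ^ 2 + g"
    unfolding g by (simp add: power2_eq_square c2' algebra_simps)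
  have bg: "b * g = g * c ^ 2 + (c * c ^ 2 * c ^ 2 + g)"
    unfolding g by (simp add: power2_eq_square c2' algebra_simps)
  have BG: "b * g \<in> span_Z2 ?S" unfolding bg by (intro span_Z2_add csq C G)
  have "b * f = b * c + b * g" unfolding c by (simp add: algebra_simps)
  also have "\<dots> \<in> span_Z2 ?S" unfolding bc by (intro span_Z2_add csq C G BG)
  finally have BF: "b * f \<in> span_Z2 ?S" .
  have stable: "b * x \<in> span_Z2 ?S" if "x \<in> span_Z2 ?S" for x
    using that
  proof (induction rule: span_Z2_induct)
    case (add x y)
    then obtain i j where x: "x = f ^ i * g ^ j" "odd (i + j)" by auto
    \<comment> \<open>An odd monomial has a factor \<open>f\<close> or \<open>g\<close>, and the
      cofactor is even; so \<open>BF\<close> and \<open>BG\<close> suffice.\<close>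
    have "b * x \<in> span_Z2 ?S"
    proof (cases i)
      case (Suc k)
      then show ?thesis using even_mult[OF BF, of k j] x by (simp add: mult_ac)
    next
      case 0
      then obtain l where "j = Suc l" using x by (cases j) auto
      then show ?thesis using even_mult[OF BG, of 0 l] x 0 by (simp add: mult_ac)
    qed
    then show ?case using add by (auto simp: distrib_left intro: span_Z2_add)
  qed (simp add: span_Z2_0)
  show ?thesis
    by (induction n) (use C stable in \<open>auto simp: mult.left_commute\<close>)
qed

section \<open>The group \<open>\<Gamma>\<^sub>0(5)\<close>\<close>

definition moebius :: "int \<Rightarrow> int \<Rightarrow> int \<Rightarrow> int \<Rightarrow> complex \<Rightarrow> complex" where
  "moebius a b c d z = (of_int a * z + of_int b) / (of_int c * z + of_int d)"

lemma moebius_denominator_nonzero: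
  assumes "a * d - b * c = (1::int)" "Im z > 0"
  shows "of_int c * z + of_int d \<noteq> 0"
proof
  assume *: "of_int c * z + of_int d = 0"
  then have "Im (of_int c * z + of_int d) = 0" by simp
  then have "c = 0" using assms by simp
  with * assms show False by simp
qed

lemma Im_moebius:
  assumes "a * d - b * c = (1::int)"
  shows "Im (moebius a b c d z) = Im z / (norm (of_int c * z + of_int d))\<^sup>2"
proof -
  let ?D = "of_int c * z + of_int d"
  have "Im ((of_int a * z + of_int b) * cnj ?D) = of_int (a * d - b * c) * Im z"
    by (simp add: algebra_simps)
  then have "Im ((of_int a * z + of_int b) * cnj ?D) = Im z" using assms by simp
  moreover have "moebius a b c d z = (of_int a * z + of_int b) * cnj ?D / of_real ((norm ?D)\<^sup>2)"
    unfolding moebius_def by (subst complex_div_cnj) simp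
  ultimately show ?thesis by (metis Im_divide_of_real)
qed

lemma Im_moebius_pos:
  assumes "a * d - b * c = (1::int)" "Im z > 0"
  shows "Im (moebius a b c d z) > 0"
  using moebius_denominator_nonzero[OF assms] assms(2) by (simp add: Im_moebius[OF assms(1)])

lemma moebius_compose:
  assumes "p * s - q * r = (1::int)" "Im z > 0"
  shows "moebius a b c d (moebius p q r s z) =
    moebius (a * p + b * r) (a * q + b * s) (c * p + d * r) (c * q + d * s) z"
proof -
  let ?D = "of_int r * z + of_int s" and ?N = "of_int p * z + of_int q"
  have D: "?D \<noteq> 0" by (rule moebius_denominator_nonzero[OF assms])
  have "of_int x * (?N / ?D) + of_int y = (of_int (x * p + y * r) * z + of_int (x * q + y * s)) / ?D" for x y
    using D by (simp add: field_simps)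
  then show ?thesis unfolding moebius_def using D by simp
qed

lemma moebius_denominator_compose:
  assumes "p * s - q * r = (1::int)" "Im z > 0"
  shows "(of_int c * moebius p q r s z + of_int d) * (of_int r * z + of_int s) =
    of_int (c * p + d * r) * z + of_int (c * q + d * s)"
  using moebius_denominator_nonzero[OF assms] unfolding moebius_def by (simp add: field_simps)

lemma moebius_one: "moebius 1 0 0 1 z = z"
  by (simp add: moebius_def)

lemma moebius_inverse:
  assumes "p * s - q * r = (1::int)" "Im z > 0"
  shows "moebius p q r s (moebius s (- q) (- r) p z) = z"
proof -
  have "s * p - (- q) * (- r) = 1" using assms(1) by (simp add: algebra_simps)
  from moebius_compose[OF this assms(2), of p q r s] assms(1) show ?thesis
    by (simp add: algebra_simps moebius_one)
qed

definition slash_invariant :: "nat \<Rightarrow> (complex \<Rightarrow> complex) \<Rightarrow> int \<Rightarrow> int \<Rightarrow> int \<Rightarrow> int \<Rightarrow> bool" where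
  "slash_invariant k f a b c d \<longleftrightarrow>
    (\<forall>z. Im z > 0 \<longrightarrow> f (moebius a b c d z) = (of_int c * z + of_int d) ^ k * f z)"

text \<open>If the product and its right factor act trivially, so does the left factor. This is the
  shape of the steps in \<open>Gamma0_5_induct\<close>, where the premise concerns a matrix
  multiplied on the right by a generator.\<close>

lemma slash_invariant_cancel:
  assumes det: "p * s - q * r = (1::int)" and inv: "slash_invariant k f p q r s"
    and prod: "slash_invariant k f (a * p + b * r) (a * q + b * s) (c * p + d * r) (c * q + d * s)"
  shows "slash_invariant k f a b c d"
  unfolding slash_invariant_def
proof (intro allI impI)
  fix z assume z: "Im z > 0"
  define w where "w = moebius s (- q) (- r) p z"
  have w: "Im w > 0" unfolding w_def using det z by (intro Im_moebius_pos) (auto simp: algebra_simps)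
  have zw: "z = moebius p q r s w" unfolding w_def by (rule moebius_inverse[OF det z, symmetric])
  have "f (moebius a b c d z) = (of_int (c * p + d * r) * w + of_int (c * q + d * s)) ^ k * f w"
    using prod w unfolding zw moebius_compose[OF det w] slash_invariant_def by blast
  also have "\<dots> = (of_int c * z + of_int d) ^ k * ((of_int r * w + of_int s) ^ k * f w)"
    unfolding zw moebius_denominator_compose[OF det w, symmetric] by (simp add: power_mult_distrib)
  also have "(of_int r * w + of_int s) ^ k * f w = f z"
    using inv w unfolding zw slash_invariant_def by simp
  finally show "f (moebius a b c d z) = (of_int c * z + of_int d) ^ k * f z" .
qed

lemma int_round:
  fixes c d :: int assumes "c \<noteq> 0"
  obtains n where "2 * \<bar>c * n + d\<bar> \<le> \<bar>c\<bar>"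
proof -
  define r where "r = d mod \<bar>c\<bar>"
  have r: "0 \<le> r" "r < \<bar>c\<bar>" using assms by (auto simp: r_def)
  have d: "d = \<bar>c\<bar> * (d div \<bar>c\<bar>) + r" by (simp add: r_def)
  have c: "\<bar>c\<bar> = c * sgn c" by (simp add: abs_sgn)
  show ?thesis
  proof (cases "2 * r \<le> \<bar>c\<bar>")
    case True
    have "c * (- sgn c * (d div \<bar>c\<bar>)) + d = r" using d c by (simp add: algebra_simps)
    then show ?thesis using that True r by (metis abs_of_nonneg)
  next
    case False
    have "c * (- sgn c * (d div \<bar>c\<bar>) - sgn c) + d = r - \<bar>c\<bar>"
      using d c by (simp add: algebra_simps)
    then show ?thesis using that[of "- sgn c * (d div \<bar>c\<bar>) - sgn c"] False r by simp
  qed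
qed

text \<open>Reduction of \<open>|c|\<close> by right multiplication with translations, \<open>(1 0; \<mp>5 1)\<close> and the
  elliptic element \<open>(2 -1; 5 -2)\<close>; with \<open>t = -d/c\<close>, the bounds used are
  \<open>|1 - 5t| < 1\<close> for \<open>0 < t < 2/5\<close> and
  \<open>|2 - 5t| \<le> 1\<close> for \<open>2/5 \<le> t \<le> 3/5\<close>, with equality at \<open>t = 3/5\<close> only for \<open>|c| = 5\<close>.\<close>

lemma Gamma0_5_induct:
  fixes P :: "int \<Rightarrow> int \<Rightarrow> int \<Rightarrow> int \<Rightarrow> bool"
  assumes one: "P 1 0 0 1" and minus_one: "P (-1) 0 0 (-1)"
    and T: "\<And>a b c d n. P a (a * n + b) c (c * n + d) \<Longrightarrow> P a b c d"
    and V: "\<And>a b c d. P (a - 5 * b) b (c - 5 * d) d \<Longrightarrow> P a b c d"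
    and V': "\<And>a b c d. P (a + 5 * b) b (c + 5 * d) d \<Longrightarrow> P a b c d"
    and E: "\<And>a b c d. P (2 * a + 5 * b) (- a - 2 * b) (2 * c + 5 * d) (- c - 2 * d) \<Longrightarrow> P a b c d"
    and det: "a * d - b * c = 1" and c: "5 dvd c"
  shows "P a b c d"
  using det c
proof (induction "nat \<bar>c\<bar>" arbitrary: a b c d rule: less_induct)
  case less
  have IH: "P a' b' c' d'" if "a' * d' - b' * c' = 1" "5 dvd c'" "\<bar>c'\<bar> < \<bar>c\<bar>" for a' b' c' d'
    using less.hyps[of c' a' d' b'] that by simp
  show ?case
  proof (cases "c = 0")
    case True
    then have "a * d = 1" using less by simp
    then have "a = 1 \<and> d = 1 \<or> a = -1 \<and> d = -1" using zmult_eq_1_iff by blast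
    then show ?thesis
      using T[of 1 "- b" b 0 1] T[of "-1" b b 0 "-1"] one minus_one True by auto
  next
    case False
    obtain n where n: "2 * \<bar>c * n + d\<bar> \<le> \<bar>c\<bar>" using int_round[OF False] by blast
    define b' where "b' = a * n + b"
    define d' where "d' = c * n + d"
    have det': "a * d' - b' * c = 1" using less.prems by (simp add: b'_def d'_def algebra_simps)
    have d': "2 * \<bar>d'\<bar> \<le> \<bar>c\<bar>" using n by (simp add: d'_def)
    have "d' \<noteq> 0"
    proof
      assume "d' = 0"
      then have "c dvd 1" using det' by (metis diff_0 dvd_minus_iff dvd_triv_right mult_zero_right)
      then have "5 dvd (1::int)" using less.prems dvd_trans by blast
      then show False by simp
    qed
    have "P a b' c d'"
    proof (cases "5 * \<bar>d'\<bar> < 2 * \<bar>c\<bar>")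
      case True
      show ?thesis
      proof (cases "c > 0 \<longleftrightarrow> d' > 0")
        case pos: True
        then have "\<bar>c - 5 * d'\<bar> < \<bar>c\<bar>" using True \<open>d' \<noteq> 0\<close> False by (smt (verit))
        then show ?thesis using det' less.prems
          by - (rule V[OF IH], auto simp: algebra_simps)
      next
        case neg: False
        then have "\<bar>c + 5 * d'\<bar> < \<bar>c\<bar>" using True \<open>d' \<noteq> 0\<close> False by (smt (verit))
        then show ?thesis using det' less.prems
          by - (rule V'[OF IH], auto simp: algebra_simps)
      qed
    next
      case big: False
      show ?thesis
      proof (cases "c > 0 \<longleftrightarrow> d' > 0")
        case neg: False
        then have "\<bar>2 * c + 5 * d'\<bar> < \<bar>c\<bar>" using big d' \<open>d' \<noteq> 0\<close> False by (smt (verit))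
        then show ?thesis using det' less.prems
          by - (rule E[OF IH], auto simp: algebra_simps)
      next
        case pos: True
        show ?thesis
        proof (cases "5 * d' = 2 * c")
          case False
          \<comment> \<open>Here t = -d'/c lies in [-1/2, -2/5]; translation by -1 moves it into
            [1/2, 3/5], where \<open>E\<close> applies.\<close>
          define b2 where "b2 = a * (-1) + b'"
          define d2 where "d2 = c * (-1) + d'"
          have det2: "a * d2 - b2 * c = 1" using det' by (simp add: b2_def d2_def algebra_simps)
          have "\<bar>2 * c + 5 * d2\<bar> < \<bar>c\<bar>"
            using pos big d' \<open>d' \<noteq> 0\<close> \<open>c \<noteq> 0\<close> False unfolding d2_def by (smt (verit))
          then have "P a b2 c d2" using det2 less.prems
            by - (rule E[OF IH], auto simp: algebra_simps)
          then show ?thesis unfolding b2_def d2_def by (rule T)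
        next
          case True
          \<comment> \<open>At the endpoint t = 3/5 after translation, \<open>E\<close> only turns c
            into -c. The determinant forces c = 5 or c = -5, and then a further \<open>V'\<close>
            makes the entry 0.\<close>
          obtain e where e: "c = 5 * e" using less.prems by auto
          then have d'e: "d' = 2 * e" using True by simp
          have "e dvd a * d' - b' * c" unfolding e d'e by simp
          then have "e = 1 \<or> e = -1" using det' by auto
          then have "P a (a * (-1) + b') c (c * (-1) + d')"
          proof
            assume "e = 1"
            then show ?thesis using det' e d'e
              by - (rule E[OF V'[OF IH]], auto)
          next
            assume "e = -1"
            then show ?thesis using det' e d'e
              by - (rule E[OF V'[OF IH]], auto)
          qed
          then show ?thesis by (rule T)
        qed
      qed
    qed
    then show ?thesis unfolding b'_def d'_def by (rule T)
  qed
qed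

lemma periodic_int:
  fixes f :: "complex \<Rightarrow> complex"
  assumes "\<And>z. Im z > 0 \<Longrightarrow> f (z + 1) = f z" "Im z > 0"
  shows "f (z + of_int n) = f z"
proof -
  have *: "f (z + of_nat n) = f z" if "Im z > 0" for z n
  proof (induction n)
    case (Suc n)
    have "f (z + of_nat (Suc n)) = f ((z + of_nat n) + 1)" by (simp add: add_ac)
    also have "\<dots> = f (z + of_nat n)" using that by (intro assms(1)) simp
    finally show ?case using Suc by simp
  qed simp
  show ?thesis
    using *[of z "nat n"] *[of "z + of_int n" "nat (- n)"] assms(2) by (cases "n \<ge> 0") auto
qed

text \<open>Invariance under \<open>(1 0; -5 1)\<close>, the conjugate of the translation by the Fricke
  involution \<open>z \<mapsto> -1/(5z)\<close>, is encoded by the second function \<open>g\<close> being periodic.\<close>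

locale fricke_pair =
  fixes k :: nat and f g :: "complex \<Rightarrow> complex" and \<kappa> :: complex
  assumes even_weight: "even k"
    and periodic: "\<And>z. Im z > 0 \<Longrightarrow> f (z + 1) = f z" "\<And>z. Im z > 0 \<Longrightarrow> g (z + 1) = g z"
    and elliptic: "\<And>z. Im z > 0 \<Longrightarrow> f ((2 * z - 1) / (5 * z - 2)) = (5 * z - 2) ^ k * f z"
    and fricke: "\<And>z. Im z > 0 \<Longrightarrow> f (- 1 / (5 * z)) = \<kappa> * z ^ k * g z"
begin

lemma unipotent: "slash_invariant k f 1 0 5 1" "slash_invariant k f 1 0 (-5) 1"
proof -
  have aux: "f (moebius 1 0 (- 5 * n) 1 z) = (of_int (- 5 * n) * z + 1) ^ k * f z" if z: "Im z > 0" for z and n :: int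
  proof -
    have z0: "z \<noteq> 0" using z by auto
    define v where "v = - 1 / (5 * z)"
    define u where "u = v + of_int n"
    have v: "Im v > 0" using Im_moebius_pos[of 0 0 "-1" 1 "5 * z"] z by (simp add: v_def moebius_def)
    have u: "Im u > 0" using v by (simp add: u_def)
    have v0: "v \<noteq> 0" and u0: "u \<noteq> 0" using u v by auto
    have zv: "z = - 1 / (5 * v)" using z0 by (simp add: v_def)
    have den: "of_int (- 5 * n) * z + 1 = u / v" using v0 by (simp add: zv u_def field_simps)
    have "moebius 1 0 (- 5 * n) 1 z = z / (u / v)" unfolding den[symmetric] by (simp add: moebius_def)
    also have "\<dots> = - 1 / (5 * u)" using v0 u0 by (simp add: zv field_simps)
    finally have "f (moebius 1 0 (- 5 * n) 1 z) = \<kappa> * u ^ k * g u" using fricke[OF u] by simp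
    also have "g u = g v" unfolding u_def by (rule periodic_int[of g v n, OF periodic(2) v])
    also have "\<kappa> * u ^ k * g v = (u / v) ^ k * (\<kappa> * v ^ k * g v)"
      using v0 by (simp add: power_divide)
    also have "\<kappa> * v ^ k * g v = f z" using fricke[OF v] zv by simp
    finally show ?thesis unfolding den .
  qed
  show "slash_invariant k f 1 0 5 1" "slash_invariant k f 1 0 (-5) 1"
    unfolding slash_invariant_def using aux[of _ 1] aux[of _ "-1"] by auto
qed

lemma slash_invariant_Gamma0_5:
  assumes "a * d - b * c = 1" "5 dvd c"
  shows "slash_invariant k f a b c d"
proof (rule Gamma0_5_induct[where P = "slash_invariant k f", OF _ _ _ _ _ _ assms])
  show "slash_invariant k f 1 0 0 1" by (simp add: slash_invariant_def moebius_def)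
  show "slash_invariant k f (-1) 0 0 (-1)" using even_weight by (simp add: slash_invariant_def moebius_def)
  show "slash_invariant k f a b c d" if "slash_invariant k f a (a * n + b) c (c * n + d)" for a b c d n
  proof (rule slash_invariant_cancel[of 1 1 n 0])
    show "slash_invariant k f 1 n 0 1"
      using periodic_int[of f _ n, OF periodic(1)] by (simp add: slash_invariant_def moebius_def)
  qed (use that in simp_all)
  show "slash_invariant k f a b c d" if "slash_invariant k f (a - 5 * b) b (c - 5 * d) d" for a b c d
    by (rule slash_invariant_cancel[of 1 1 0 "-5"]) (use that unipotent in \<open>simp_all add: algebra_simps\<close>)
  show "slash_invariant k f a b c d" if "slash_invariant k f (a + 5 * b) b (c + 5 * d) d" for a b c d
    by (rule slash_invariant_cancel[of 1 1 0 5]) (use that unipotent in \<open>simp_all add: algebra_simps\<close>)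
  show "slash_invariant k f a b c d"
    if "slash_invariant k f (2 * a + 5 * b) (- a - 2 * b) (2 * c + 5 * d) (- c - 2 * d)" for a b c d
  proof (rule slash_invariant_cancel[of 2 "-2" "-1" 5])
    show "slash_invariant k f 2 (-1) 5 (-2)"
      using elliptic by (simp add: slash_invariant_def moebius_def)
  qed (use that in \<open>simp_all add: algebra_simps\<close>)
qed

text \<open>There are two cusps. If 5 divides \<open>c\<close>, the slashed function is
  \<open>f\<close> again. Otherwise some \<open>j\<close> makes \<open>d - j * c\<close> divisible
  by 5, and the matrix is an element of the group times an inversion and a translation by
  \<open>j\<close>; boundedness then comes from \<open>g\<close> through the Fricke relation. The
  height 5 ensures that \<open>u / 5\<close> has height at least 1.\<close>

lemma modular_form:
  assumes hol: "f holomorphic_on upper_half_plane"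
    and bdd: "\<And>z. Im z \<ge> 1 \<Longrightarrow> norm (f z) \<le> Bf" "\<And>z. Im z \<ge> 1 \<Longrightarrow> norm (g z) \<le> Bg"
  shows "modular_form_Gamma0_5 k f"
  unfolding modular_form_Gamma0_5_def
proof (intro conjI allI impI hol)
  fix a b c d :: int and z assume "a * d - b * c = 1 \<and> 5 dvd c" "Im z > 0"
  then show "f ((of_int a * z + of_int b) / (of_int c * z + of_int d)) = (of_int c * z + of_int d) ^ k * f z"
    using slash_invariant_Gamma0_5[of a d b c] by (simp add: slash_invariant_def moebius_def)
next
  fix a b c d :: int assume det: "a * d - b * c = 1"
  show "\<exists>B Y. \<forall>z. Im z \<ge> Y \<longrightarrow> norm (f ((of_int a * z + of_int b) / (of_int c * z + of_int d))
      / (of_int c * z + of_int d) ^ k) \<le> B"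
  proof (cases "5 dvd c")
    case True
    have "norm (f ((of_int a * z + of_int b) / (of_int c * z + of_int d)) / (of_int c * z + of_int d) ^ k) \<le> Bf"
      if "Im z \<ge> 1" for z
      using slash_invariant_Gamma0_5[OF det True] moebius_denominator_nonzero[OF det, of z] bdd(1)[OF that] that
      by (simp add: slash_invariant_def moebius_def)
    then show ?thesis by blast
  next
    case False
    have "\<exists>j. 5 dvd d - j * c"
    proof -
      have "prime (5::int)" by simp
      then have "coprime c 5" using False prime_imp_coprime coprime_commute by blast
      then obtain x y where xy: "x * c + y * 5 = 1" using bezout_int[of c 5] by auto
      have "d - (x * d) * c = d * (1 - x * c)" by (simp add: algebra_simps)
      also have "1 - x * c = y * 5" using xy by simp
      finally have "5 dvd d - (x * d) * c" by simp
      then show ?thesis by blast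
    qed
    then obtain j where j: "5 dvd d - j * c" by blast
    have "norm (f ((of_int a * z + of_int b) / (of_int c * z + of_int d)) / (of_int c * z + of_int d) ^ k) \<le> norm \<kappa> * Bg / 5 ^ k"
      if z: "Im z \<ge> 5" for z
    proof -
      define u where "u = z + of_int j"
      have u: "Im u > 0" "Im (u / 5) \<ge> 1" using z by (auto simp: u_def)
      then have u0: "u \<noteq> 0" by auto
      define v where "v = - 1 / u"
      have v: "Im v > 0" using Im_moebius_pos[of 0 0 "-1" 1 u] u by (simp add: v_def moebius_def)
      have den: "of_int (- (d - j * c)) * v + of_int c = (of_int c * z + of_int d) / u"
        using u0 by (simp add: v_def u_def field_simps)
      have D: "of_int c * z + of_int d \<noteq> 0" using moebius_denominator_nonzero[OF det] z by simp
      have "moebius (- (b - j * a)) a (- (d - j * c)) c v = (of_int a * z + of_int b) / (of_int c * z + of_int d)"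
      proof -
        have "of_int (- (b - j * a)) * v + of_int a = (of_int a * z + of_int b) / u"
          using u0 by (simp add: v_def u_def field_simps)
        then show ?thesis unfolding moebius_def den using u0 D by simp
      qed
      moreover have "slash_invariant k f (- (b - j * a)) a (- (d - j * c)) c"
        by (rule slash_invariant_Gamma0_5) (use det j in \<open>auto simp: algebra_simps dvd_diff_commute\<close>)
      ultimately have "f ((of_int a * z + of_int b) / (of_int c * z + of_int d)) = ((of_int c * z + of_int d) / u) ^ k * f v"
        using v den unfolding slash_invariant_def by metis
      also have "f v = \<kappa> * (u / 5) ^ k * g (u / 5)"
        using fricke[of "u / 5"] u by (simp add: v_def)
      finally have "f ((of_int a * z + of_int b) / (of_int c * z + of_int d)) / (of_int c * z + of_int d) ^ k = \<kappa> * g (u / 5) / 5 ^ k"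
        using D u0 by (simp add: power_divide)
      moreover have "norm (\<kappa> * g (u / 5) / 5 ^ k) \<le> norm \<kappa> * Bg / 5 ^ k"
        using bdd(2)[OF u(2)] by (simp add: norm_mult norm_divide norm_power divide_right_mono mult_left_mono)
      ultimately show ?thesis by simp
    qed
    then show ?thesis by blast
  qed
qed

end

section \<open>Reduction theory for the group extended by the Fricke involution\<close>

lemma small_linear_form:
  assumes z: "Im z > 0"
  obtains c d :: int where "coprime c d" "(norm (of_int c * z + of_int d))\<^sup>2 \<le> 5 * Im z"
proof (cases "Im z \<ge> 1")
  case True
  then show ?thesis using that[of 0 1] by simp
next
  case False
  define y where "y = Im z"
  have y: "0 < y" "y < 1" using z False by (auto simp: y_def)
  \<comment> \<open>With N between 1/sqrt y and 2/sqrt y, the real part of the form is at most sqrt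
    y and its imaginary part at most 2 sqrt y; the squares add up to 5 y.\<close>
  define N where "N = nat \<lceil>1 / sqrt y\<rceil>"
  have N1: "real N \<ge> 1 / sqrt y" unfolding N_def by (rule real_nat_ceiling_ge)
  have N2: "real N \<le> 2 / sqrt y"
  proof -
    have "real N \<le> 1 / sqrt y + 1" unfolding N_def using y by (simp add: of_nat_nat)
    moreover have "1 \<le> 1 / sqrt y" using y by (simp add: real_sqrt_le_1_iff)
    moreover have "1 / sqrt y + 1 / sqrt y = 2 / sqrt y" by simp
    ultimately show ?thesis by linarith
  qed
  have "N > 0" using N1 y by (intro gr0I) auto
  then obtain h k where hk: "coprime h k" "0 < k" "k \<le> int N" "\<bar>of_int k * Re z - of_int h\<bar> < 1 / N"
    using Dirichlet_approx_coprime by blast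
  have "(norm (of_int k * z + of_int (- h)))\<^sup>2 = (of_int k * Re z - of_int h)\<^sup>2 + (of_int k * y)\<^sup>2"
    by (simp add: cmod_power2 y_def)
  also have "\<dots> \<le> (sqrt y)\<^sup>2 + (2 / sqrt y * y)\<^sup>2"
  proof (intro add_mono)
    have "\<bar>of_int k * Re z - of_int h\<bar> \<le> \<bar>sqrt y\<bar>"
    proof -
      have "1 / real N \<le> sqrt y" using N1 y \<open>N > 0\<close> by (simp add: field_simps)
      then show ?thesis using hk(4) y by simp
    qed
    then show "(of_int k * Re z - of_int h)\<^sup>2 \<le> (sqrt y)\<^sup>2" by (simp only: abs_le_square_iff)
    have "of_int k * y \<le> 2 / sqrt y * y" using hk N2 y by (intro mult_right_mono) linarith+
    then show "(of_int k * y)\<^sup>2 \<le> (2 / sqrt y * y)\<^sup>2" using hk y by (intro power_mono) auto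
  qed
  also have "\<dots> = 5 * y" using y by (simp add: power_mult_distrib power_divide power2_eq_square)
  finally show ?thesis using that[of k "- h"] hk(1) by (simp add: y_def coprime_commute)
qed

text \<open>A small coprime form p z + q serves as denominator if 5 divides \<open>p\<close>, giving
  height at least 1/5. Otherwise it serves as numerator, which the involution exchanges with the
  denominator at the cost of a further factor 1/5; hence 1/25.\<close>

lemma Gamma0_5_fricke_orbit:
  assumes z: "Im z > 0"
  obtains a b c d :: int where "a * d - b * c = 1" "5 dvd c"
    "Im (moebius a b c d z) \<ge> 1 / 25 \<or> Im (- 1 / (5 * moebius a b c d z)) \<ge> 1 / 25"
proof -
  obtain p q :: int where pq: "coprime p q" "(norm (of_int p * z + of_int q))\<^sup>2 \<le> 5 * Im z"
    using small_linear_form[OF z] by blast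
  obtain x y where xy: "x * p + y * q = 1" using bezout_int[of p q] pq(1) by auto
  show ?thesis
  proof (cases "5 dvd p")
    case True
    have det: "y * q - (- x) * p = 1" using xy by (simp add: algebra_simps)
    have "Im (moebius y (- x) p q z) \<ge> 1 / 25"
      unfolding Im_moebius[OF det] using pq(2) z moebius_denominator_nonzero[OF det z] by (simp add: field_simps)
    then show ?thesis using that[OF det True] by blast
  next
    case False
    have "prime (5::int)" by simp
    then have "coprime p 5" using False prime_imp_coprime coprime_commute by blast
    then obtain u v where uv: "u * p + v * 5 = 1" using bezout_int[of p 5] by auto
    \<comment> \<open>The Bezout row (-y, x) has determinant 1 with (p, q); adding
      \<open>u * y\<close> times (p, q) keeps this and makes c equal to -5 v y.\<close>
    define c where "c = - y + (u * y) * p"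
    define d where "d = x + (u * y) * q"
    have det: "p * d - q * c = 1" using xy by (simp add: c_def d_def algebra_simps)
    have "c = - y * (1 - u * p)" by (simp add: c_def algebra_simps)
    also have "1 - u * p = v * 5" using uv by simp
    finally have c5: "5 dvd c" by simp
    define N where "N = of_int p * z + of_int q"
    define D where "D = of_int c * z + of_int d"
    have D0: "D \<noteq> 0" unfolding D_def by (rule moebius_denominator_nonzero[OF det z])
    have det2: "(- c) * q - (- d) * p = 1" using det by (simp add: algebra_simps)
    have N0: "N \<noteq> 0" unfolding N_def by (rule moebius_denominator_nonzero[OF det2 z])
    have W: "- 1 / (5 * moebius p q c d z) = moebius (- c) (- d) p q z / 5"
      using D0 N0 by (simp add: moebius_def flip: N_def D_def) (simp add: D_def field_simps)
    have "Im (- 1 / (5 * moebius p q c d z)) = Im z / (norm N)\<^sup>2 / 5"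
      by (simp only: W Im_divide_numeral Im_moebius[OF det2] N_def)
    also have "\<dots> \<ge> 1 / 25" using pq(2)[folded N_def] z N0 by (simp add: field_simps)
    finally show ?thesis using that[OF det c5] by blast
  qed
qed

lemma open_upper_half_plane [simp]: "open upper_half_plane"
  unfolding upper_half_plane_def by (rule open_halfspace_Im_gt)

lemma connected_upper_half_plane [simp]: "connected upper_half_plane"
  unfolding upper_half_plane_def by (intro convex_connected convex_halfspace_Im_gt)

lemma Im_fricke_pos: "Im z > 0 \<Longrightarrow> Im (- 1 / (5 * z)) > 0"
  using Im_moebius_pos[of 0 0 "-1" 1 "5 * z"] by (simp add: moebius_def)

lemma fricke_involution: "- 1 / (5 * (- 1 / (5 * z))) = (z :: complex)"
  by simp

lemma holomorphic_on_fricke: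
  assumes "f holomorphic_on upper_half_plane"
  shows "(\<lambda>z. f (- 1 / (5 * z))) holomorphic_on upper_half_plane"
proof -
  have "(f \<circ> (\<lambda>z. - 1 / (5 * z))) holomorphic_on upper_half_plane"
  proof (rule holomorphic_on_compose_gen[OF _ assms])
    show "(\<lambda>z. - 1 / (5 * z)) holomorphic_on upper_half_plane"
      by (intro holomorphic_intros) (auto simp: upper_half_plane_def)
  qed (use Im_fricke_pos in \<open>auto simp: upper_half_plane_def\<close>)
  then show ?thesis by (simp add: o_def)
qed

text \<open>The product of \<open>h\<close> with its Fricke transform is invariant under the group generated by
  \<open>\<Gamma>\<^sub>0(5)\<close> and the involution, which has a single cusp. It decays there, so its modulus has a
  maximum.\<close>

lemma weight_zero_vanishing:
  assumes hol: "h holomorphic_on upper_half_plane"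
    and inv: "\<And>a b c d. a * d - b * c = 1 \<Longrightarrow> 5 dvd c \<Longrightarrow> slash_invariant 0 h a b c d"
    and decay: "\<And>e. e > 0 \<Longrightarrow> \<exists>Y. \<forall>z. Im z \<ge> Y \<longrightarrow> norm (h z) < e"
    and bdd: "\<exists>B Y. \<forall>z. Im z \<ge> Y \<longrightarrow> norm (h (- 1 / (5 * z))) \<le> B"
    and z: "Im z > 0"
  shows "h z = 0"
proof -
  define P where "P z = h z * h (- 1 / (5 * z))" for z
  have inv': "h (moebius a b c d z) = h z" if "a * d - b * c = 1" "5 dvd c" "Im z > 0" for a b c d z
    using inv[OF that(1,2)] that(3) by (simp add: slash_invariant_def)
  have PG: "P (moebius a b c d z) = P z" if det: "a * d - b * c = 1" and c: "5 dvd c" and z: "Im z > 0" for a b c d z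
  proof -
    obtain e where e: "c = 5 * e" using c by auto
    have det': "d * a - (- e) * (- 5 * b) = 1" using det e by (simp add: algebra_simps)
    have D: "of_int c * z + of_int d \<noteq> 0" by (rule moebius_denominator_nonzero[OF det z])
    have z0: "z \<noteq> 0" using z by auto
    have "(- c) * b - (- d) * a = 1" using det by (simp add: algebra_simps)
    then have N: "of_int a * z + of_int b \<noteq> 0" using z by (rule moebius_denominator_nonzero)
    have "- 1 / (5 * moebius a b c d z) = - (of_int c * z + of_int d) / (5 * (of_int a * z + of_int b))"
      using D N by (simp add: moebius_def field_simps)
    also have "\<dots> = moebius d (- e) (- 5 * b) a (- 1 / (5 * z))"
    proof -
      have 1: "of_int d * (- 1 / (5 * z)) + of_int (- e) = - (of_int c * z + of_int d) / (5 * z)"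
        using z0 by (simp add: e field_simps)
      have 2: "of_int (- 5 * b) * (- 1 / (5 * z)) + of_int a = (of_int a * z + of_int b) / z"
        using z0 by (simp add: field_simps)
      have "x / (5 * n) = (x / (5 * z)) / (n / z)" for x n using z0 by simp
      then show ?thesis unfolding moebius_def 1 2 .
    qed
    finally have "h (- 1 / (5 * moebius a b c d z)) = h (- 1 / (5 * z))"
      using inv'[OF det' _ Im_fricke_pos[OF z]] by simp
    then show ?thesis using inv'[OF det c z] by (simp add: P_def)
  qed
  have PW: "P (- 1 / (5 * z)) = P z" for z
    unfolding P_def fricke_involution by (rule mult.commute)
  have Pshift: "P (z + of_int n) = P z" if "Im z > 0" for z n
    using PG[of 1 1 n 0 z] that by (simp add: moebius_def)
  have holP: "P holomorphic_on upper_half_plane"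
    unfolding P_def by (intro holomorphic_on_mult hol holomorphic_on_fricke)
  obtain B0 Y0 where B0: "\<And>z. Im z \<ge> Y0 \<Longrightarrow> norm (h (- 1 / (5 * z))) \<le> B0" using bdd by blast
  have decayP: "\<exists>Y. \<forall>z. Im z \<ge> Y \<longrightarrow> norm (P z) < e" if e: "e > 0" for e
  proof -
    define B where "B = max B0 1"
    obtain Y where Y: "\<And>z. Im z \<ge> Y \<Longrightarrow> norm (h z) < e / B"
      using decay[of "e / B"] e by (auto simp: B_def)
    have "norm (P z) < e" if "Im z \<ge> max Y Y0" for z
    proof -
      have "norm (P z) \<le> norm (h z) * B" unfolding P_def norm_mult
        using B0[of z] that by (intro mult_left_mono) (auto simp: B_def)
      also have "\<dots> < e / B * B" using Y[of z] that by (intro mult_strict_right_mono) (auto simp: B_def)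
      also have "\<dots> = e" by (simp add: B_def)
      finally show ?thesis .
    qed
    then show ?thesis by blast
  qed
  have P0: "P z0 = 0" if z0: "Im z0 > 0" for z0
  proof (rule ccontr)
    assume nz: "P z0 \<noteq> 0"
    then obtain Y where Y: "\<And>z. Im z \<ge> Y \<Longrightarrow> norm (P z) < norm (P z0)" using decayP[of "norm (P z0)"] by auto
    \<comment> \<open>Translations and \<open>Gamma0_5_fricke_orbit\<close> bring every point into
      this rectangle or above height Y, where \<open>P\<close> is smaller than at \<open>z0\<close>;
      so the maximum over the rectangle is global.\<close>
    define K where "K = cbox (Complex 0 (1/25)) (Complex 1 (max Y 1))"
    have KH: "K \<subseteq> upper_half_plane" by (auto simp: K_def in_cbox_complex_iff upper_half_plane_def)
    have rep: "\<exists>w. P w = P z \<and> (w \<in> K \<or> Im w \<ge> Y)" if z: "Im z > 0" for z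
    proof -
      obtain a b c d :: int where g: "a * d - b * c = 1" "5 dvd c"
          "Im (moebius a b c d z) \<ge> 1 / 25 \<or> Im (- 1 / (5 * moebius a b c d z)) \<ge> 1 / 25"
        using Gamma0_5_fricke_orbit[OF z] by blast
      then obtain w where w: "P w = P z" "Im w \<ge> 1 / 25" using PG[OF g(1,2) z] PW by metis
      define v where "v = w + of_int (- \<lfloor>Re w\<rfloor>)"
      have "P v = P w" unfolding v_def by (rule Pshift) (use w in simp)
      then have "P v = P z" using w by simp
      moreover have "v \<in> K \<or> Im v \<ge> Y"
      proof -
        have "0 \<le> Re v" "Re v \<le> 1" "Im v = Im w" unfolding v_def by (simp_all, linarith+)
        then show ?thesis using w(2) by (auto simp: K_def in_cbox_complex_iff)
      qed
      ultimately show ?thesis by blast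
    qed
    have "compact K" by (simp add: K_def)
    moreover have "\<i> \<in> K" by (simp add: K_def in_cbox_complex_iff)
    then have "K \<noteq> {}" by blast
    moreover have "continuous_on K (\<lambda>z. norm (P z))"
      using holP KH by (intro continuous_intros) (auto intro: holomorphic_on_imp_continuous_on continuous_on_subset)
    ultimately obtain x where x: "x \<in> K" "\<And>z. z \<in> K \<Longrightarrow> norm (P z) \<le> norm (P x)"
      using continuous_attains_sup[of K "\<lambda>z. norm (P z)"] by blast
    have z0x: "norm (P z0) \<le> norm (P x)"
      using rep[OF z0] x(2) Y by (metis less_irrefl)
    have max: "norm (P z) \<le> norm (P x)" if "Im z > 0" for z
      using rep[OF that] x(2) Y z0x by (metis less_imp_le order_trans)
    have "P constant_on upper_half_plane"
      by (rule maximum_modulus_principle[OF holP, of upper_half_plane x])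
        (use x KH max in \<open>auto simp: upper_half_plane_def[symmetric]\<close>, auto simp: upper_half_plane_def)
    then obtain c where c: "\<And>z. Im z > 0 \<Longrightarrow> P z = c" by (auto simp: constant_on_def upper_half_plane_def)
    have "norm (P (Complex 0 (max Y 1))) < norm (P z0)" by (intro Y) simp
    then show False using c[OF z0] c[of "Complex 0 (max Y 1)"] by simp
  qed
  show ?thesis
  proof (rule ccontr)
    assume nz: "h z \<noteq> 0"
    \<comment> \<open>Where \<open>h\<close> is nonzero, its Fricke transform vanishes. By the
      identity theorem the transform then vanishes everywhere, in particular at the image of
      \<open>z\<close>, where its value is \<open>h z\<close>.\<close>
    define U where "U = {w \<in> upper_half_plane. h w \<noteq> 0}"
    have "open U"
    proof -
      have "open (upper_half_plane \<inter> h -` (- {0}))"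
        using holomorphic_on_imp_continuous_on[OF hol] open_upper_half_plane
        by (intro continuous_open_preimage) auto
      also have "upper_half_plane \<inter> h -` (- {0}) = U" by (auto simp: U_def)
      finally show ?thesis .
    qed
    have zU: "z \<in> U" using nz z by (simp add: U_def upper_half_plane_def)
    define f where "f z = h (- 1 / (5 * z))" for z
    have "f holomorphic_on upper_half_plane"
      unfolding f_def by (rule holomorphic_on_fricke[OF hol])
    moreover have "f w = 0" if "w \<in> U" for w
      using that P0[of w] by (auto simp: U_def P_def f_def upper_half_plane_def)
    ultimately have "f w = 0" if "w \<in> upper_half_plane" for w
      using analytic_continuation_open[of U upper_half_plane f "\<lambda>_. 0" w] \<open>open U\<close> zU that
      by (auto simp: U_def)
    then have "f (- 1 / (5 * z)) = 0" using Im_fricke_pos[OF z] by (simp add: upper_half_plane_def)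
    then show False using nz unfolding f_def fricke_involution by simp
  qed
qed

section \<open>Forms with integral q-expansion\<close>

definition complex_fps :: "int fps \<Rightarrow> complex fps" where
  "complex_fps a = Abs_fps (\<lambda>n. of_int (a $ n))"

lemma complex_fps_nth [simp]: "complex_fps a $ n = of_int (a $ n)"
  by (simp add: complex_fps_def)

lemma complex_fps_simps:
  "complex_fps 0 = 0" "complex_fps 1 = 1" "complex_fps fps_X = fps_X"
  "complex_fps (a + b) = complex_fps a + complex_fps b"
  "complex_fps (a - b) = complex_fps a - complex_fps b"
  "complex_fps (a * b) = complex_fps a * complex_fps b"
  "complex_fps (fps_const c) = fps_const (of_int c)"
  "complex_fps (fps_deriv a) = fps_deriv (complex_fps a)"
  by (auto simp: fps_eq_iff fps_X_def fps_mult_nth)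

lemma complex_fps_power: "complex_fps (a ^ n) = complex_fps a ^ n"
  by (induction n) (simp_all add: complex_fps_simps)

text \<open>Radius at least 1 means convergence at the nome of every point of the upper half
  plane.\<close>

definition disc_convergent :: "int fps \<Rightarrow> bool" where
  "disc_convergent a \<longleftrightarrow> fps_conv_radius (complex_fps a) \<ge> 1"

lemma disc_convergentD:
  fixes q :: complex
  shows "disc_convergent a \<Longrightarrow> norm q < 1 \<Longrightarrow> ereal (norm q) < fps_conv_radius (complex_fps a)"
  unfolding disc_convergent_def by (metis ereal_less(3) less_le_trans one_ereal_def)

lemma disc_convergentI:
  assumes "\<And>q. norm q < 1 \<Longrightarrow> summable (\<lambda>n. of_int (a $ n) * q ^ n :: complex)"
  shows "disc_convergent a"
  unfolding disc_convergent_def fps_conv_radius_def one_ereal_def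
proof (rule conv_radius_geI_ex')
  fix r :: real assume "0 < r" "ereal r < ereal 1"
  then show "summable (\<lambda>n. fps_nth (complex_fps a) n * of_real r ^ n)"
    using assms[of "of_real r"] by simp
qed

lemma disc_convergent_const: "disc_convergent (fps_const c)"
  and disc_convergent_X: "disc_convergent fps_X"
  by (simp_all add: disc_convergent_def complex_fps_simps)

lemma disc_convergent_0: "disc_convergent 0"
  and disc_convergent_1: "disc_convergent 1"
  by (simp_all add: disc_convergent_def complex_fps_simps)

lemma disc_convergent_add: "disc_convergent a \<Longrightarrow> disc_convergent b \<Longrightarrow> disc_convergent (a + b)"
  unfolding disc_convergent_def complex_fps_simps
  by (meson fps_conv_radius_add min.boundedI order_trans)

lemma disc_convergent_mult: "disc_convergent a \<Longrightarrow> disc_convergent b \<Longrightarrow> disc_convergent (a * b)"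
  unfolding disc_convergent_def complex_fps_simps
  by (meson fps_conv_radius_mult min.boundedI order_trans)

lemma disc_convergent_power: "disc_convergent a \<Longrightarrow> disc_convergent (a ^ n)"
  by (induction n) (auto intro: disc_convergent_1 disc_convergent_mult)

lemma disc_convergent_deriv: "disc_convergent a \<Longrightarrow> disc_convergent (fps_deriv a)"
  unfolding disc_convergent_def complex_fps_simps
  by (meson fps_conv_radius_deriv order_trans)

lemmas disc_convergent_intros = disc_convergent_const disc_convergent_X disc_convergent_0 disc_convergent_1
  disc_convergent_add disc_convergent_mult disc_convergent_power disc_convergent_deriv

definition q_eval :: "int fps \<Rightarrow> complex \<Rightarrow> complex" where
  "q_eval a z = eval_fps (complex_fps a) (nome z)"

lemma q_eval_sums:
  assumes "disc_convergent a" "Im z > 0"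
  shows "(\<lambda>n. of_int (a $ n) * nome z ^ n) sums q_eval a z"
  using sums_eval_fps[OF disc_convergentD[OF assms(1) norm_nome_less_1[OF assms(2)]]]
  by (simp add: q_eval_def)

lemma q_eval_const: "q_eval (fps_const c) z = of_int c"
  and q_eval_X: "q_eval fps_X z = nome z"
  and q_eval_1: "q_eval 1 z = 1"
  by (simp_all add: q_eval_def complex_fps_simps)

lemma q_eval_add:
  assumes "disc_convergent a" "disc_convergent b" "Im z > 0"
  shows "q_eval (a + b) z = q_eval a z + q_eval b z"
  unfolding q_eval_def complex_fps_simps
  by (rule eval_fps_add) (use assms in \<open>auto intro: disc_convergentD norm_nome_less_1\<close>)

lemma q_eval_mult:
  assumes "disc_convergent a" "disc_convergent b" "Im z > 0"
  shows "q_eval (a * b) z = q_eval a z * q_eval b z"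
  unfolding q_eval_def complex_fps_simps
  by (rule eval_fps_mult) (use assms in \<open>auto intro: disc_convergentD norm_nome_less_1\<close>)

lemma q_eval_power:
  assumes "disc_convergent a" "Im z > 0"
  shows "q_eval (a ^ n) z = q_eval a z ^ n"
  by (induction n) (simp_all add: q_eval_1 q_eval_mult assms disc_convergent_power)

lemma q_eval_periodic: "q_eval a (z + 1) = q_eval a z"
  using nome_eq_1_iff[of 1] by (simp add: q_eval_def nome_add)

lemma holomorphic_on_q_eval:
  assumes "disc_convergent a"
  shows "q_eval a holomorphic_on upper_half_plane"
proof -
  have "(eval_fps (complex_fps a) \<circ> nome) holomorphic_on upper_half_plane"
  proof (rule holomorphic_on_compose_gen)
    show "nome holomorphic_on upper_half_plane" by (intro holomorphic_intros)
    show "eval_fps (complex_fps a) holomorphic_on eball 0 (fps_conv_radius (complex_fps a))"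
      by (intro holomorphic_intros) auto
    show "nome ` upper_half_plane \<subseteq> eball 0 (fps_conv_radius (complex_fps a))"
      using disc_convergentD[OF assms] norm_nome_less_1 by (auto simp: upper_half_plane_def)
  qed
  then show ?thesis by (simp add: o_def q_eval_def[abs_def])
qed

lemma has_field_derivative_q_eval:
  assumes "disc_convergent a" "Im z > 0"
  shows "(q_eval a has_field_derivative (2 * of_real pi * \<i> * q_eval (fps_X * fps_deriv a) z)) (at z)"
proof -
  have "(nome has_field_derivative (2 * of_real pi * \<i> * nome z)) (at z)"
    unfolding nome_def by (rule derivative_eq_intros refl | simp)+
  from DERIV_chain[OF has_field_derivative_eval_fps[OF disc_convergentD[OF assms(1) norm_nome_less_1[OF assms(2)]]] this]
  have "(q_eval a has_field_derivative (eval_fps (fps_deriv (complex_fps a)) (nome z) * (2 * of_real pi * \<i> * nome z))) (at z)"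
    by (simp add: o_def q_eval_def[abs_def])
  then show ?thesis
    using assms by (simp add: q_eval_mult disc_convergent_X disc_convergent_deriv q_eval_X)
      (simp add: q_eval_def complex_fps_simps mult_ac)
qed

lemma q_eval_bounded:
  assumes "disc_convergent a"
  obtains B where "B > 0" "\<And>z. Im z \<ge> 1 \<Longrightarrow> norm (q_eval a z) \<le> B"
proof -
  let ?r = "exp (- 2 * pi)"
  have "continuous_on (cball 0 ?r) (eval_fps (complex_fps a))"
  proof (rule continuous_on_subset[OF continuous_on_eval_fps])
    have "?r < 1" by simp
    then have "norm q < 1" if "q \<in> cball 0 ?r" for q :: complex
      using that by (metis dist_0_norm le_less_trans mem_cball)
    then show "cball 0 ?r \<subseteq> eball (0::complex) (fps_conv_radius (complex_fps a))"
      using disc_convergentD[OF assms] by (auto simp: dist_norm)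
  qed
  then have "bounded (eval_fps (complex_fps a) ` cball 0 ?r)"
    by (intro compact_imp_bounded compact_continuous_image) auto
  then obtain B where B: "B > 0" "\<And>q. norm q \<le> ?r \<Longrightarrow> norm (eval_fps (complex_fps a) q) \<le> B"
    by (auto simp: bounded_pos)
  show ?thesis
    using that[OF B(1)] B(2) by (simp add: q_eval_def norm_nome)
qed

lemma q_eval_decay:
  assumes a: "disc_convergent a" and "e > 0"
  shows "\<exists>Y. \<forall>z. Im z \<ge> Y \<longrightarrow> norm (q_eval (fps_X * a) z) < e"
proof -
  obtain B where B: "B > 0" "\<And>z. Im z \<ge> 1 \<Longrightarrow> norm (q_eval a z) \<le> B" using q_eval_bounded[OF a] by blast
  \<comment> \<open>Chosen so that the nome has modulus at most \<open>e / (2 * B)\<close> above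
    height Y.\<close>
  define Y where "Y = max 1 (ln (2 * B / e) / (2 * pi))"
  have "norm (q_eval (fps_X * a) z) < e" if "Im z \<ge> Y" for z
  proof -
    have z: "Im z \<ge> 1" "Im z \<ge> ln (2 * B / e) / (2 * pi)" using that by (auto simp: Y_def)
    then have "- 2 * pi * Im z \<le> - ln (2 * B / e)" by (simp add: field_simps)
    then have "exp (- 2 * pi * Im z) \<le> exp (- ln (2 * B / e))" by (simp only: exp_le_cancel_iff)
    also have "\<dots> = e / (2 * B)" using B(1) \<open>e > 0\<close> by (simp add: exp_minus)
    finally have "norm (nome z) * norm (q_eval a z) \<le> e / (2 * B) * B"
      using B(1) B(2)[OF z(1)] \<open>e > 0\<close> by (intro mult_mono) (auto simp: norm_nome)
    also have "\<dots> < e" using B(1) \<open>e > 0\<close> by simp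
    finally show ?thesis using z a by (simp add: q_eval_mult disc_convergent_X q_eval_X norm_mult)
  qed
  then show ?thesis by blast
qed

lemma nome_surj:
  assumes "q \<noteq> 0" "norm q < 1"
  obtains z where "Im z > 0" "nome z = q"
proof
  let ?z = "Ln q / (2 * of_real pi * \<i>)"
  show "nome ?z = q" using assms by (simp add: nome_def)
  then have "exp (- 2 * pi * Im ?z) < 1" using norm_nome[of ?z] assms by simp
  then show "Im ?z > 0" by (simp add: zero_less_mult_iff del: divide_const_simps)
qed

text \<open>The nome reaches only the punctured disc; the value at q = 0 follows by continuity, and
  the series vanishes because its sum does near 0.\<close>

lemma q_eval_eq_0D:
  assumes a: "disc_convergent a" and 0: "\<And>z. Im z > 0 \<Longrightarrow> q_eval a z = 0"
  shows "a = 0"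
proof -
  have r: "fps_conv_radius (complex_fps a) > 0"
    using disc_convergentD[OF a, of 0] by (simp add: zero_ereal_def)
  have nz: "eval_fps (complex_fps a) q = 0" if "q \<noteq> 0" "norm q < 1" for q
    using nome_surj[OF that] 0 by (metis q_eval_def)
  have ev: "\<forall>\<^sub>F q in at 0. eval_fps (complex_fps a) q = 0"
    unfolding eventually_at by (rule exI[of _ 1]) (use nz in auto)
  have "isCont (eval_fps (complex_fps a)) 0"
    using r by (intro continuous_eval_fps) (auto simp: zero_ereal_def)
  then have "eval_fps (complex_fps a) \<midarrow>0\<rightarrow> eval_fps (complex_fps a) 0" by (simp add: isCont_def)
  moreover have "eval_fps (complex_fps a) \<midarrow>0\<rightarrow> 0"
    by (rule tendsto_eventually[OF ev])
  ultimately have "eval_fps (complex_fps a) 0 = 0" by (rule tendsto_unique[OF at_neq_bot])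
  moreover have "\<forall>\<^sub>F q in nhds 0. q \<noteq> 0 \<longrightarrow> eval_fps (complex_fps a) q = 0"
    using ev by (simp add: eventually_at_filter)
  ultimately have "\<forall>\<^sub>F q in nhds 0. eval_fps (complex_fps a) q = eval_fps 0 q"
    by (auto elim!: eventually_mono)
  then have "complex_fps a = 0" using r by (intro eval_fps_eqD) auto
  then show ?thesis by (auto simp: fps_eq_iff)
qed

section \<open>The graded ring of forms and its integral elements\<close>

lemma modular_form_holomorphic: "modular_form_Gamma0_5 k f \<Longrightarrow> f holomorphic_on upper_half_plane"
  unfolding modular_form_Gamma0_5_def by blast

lemma modular_form_slash:
  assumes "modular_form_Gamma0_5 k f" "a * d - b * c = 1 \<and> 5 dvd c" "Im z > 0"
  shows "f ((of_int a * z + of_int b) / (of_int c * z + of_int d)) = (of_int c * z + of_int d) ^ k * f z"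
  using assms unfolding modular_form_Gamma0_5_def by blast

lemma modular_form_cusp:
  assumes "modular_form_Gamma0_5 k f" "a * d - b * c = 1"
  shows "\<exists>B Y. \<forall>z. Im z \<ge> Y \<longrightarrow>
    norm (f ((of_int a * z + of_int b) / (of_int c * z + of_int d)) / (of_int c * z + of_int d) ^ k) \<le> B"
  using assms unfolding modular_form_Gamma0_5_def by blast

lemma modular_form_add:
  assumes "modular_form_Gamma0_5 k f" "modular_form_Gamma0_5 k g"
  shows "modular_form_Gamma0_5 k (\<lambda>z. f z + g z)"
  unfolding modular_form_Gamma0_5_def
proof (intro conjI allI impI)
  show "(\<lambda>z. f z + g z) holomorphic_on upper_half_plane"
    by (intro holomorphic_intros modular_form_holomorphic[OF assms(1)] modular_form_holomorphic[OF assms(2)])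
next
  fix a b c d :: int and z assume *: "a * d - b * c = 1 \<and> 5 dvd c" "Im z > 0"
  show "f ((of_int a * z + of_int b) / (of_int c * z + of_int d)) + g ((of_int a * z + of_int b) / (of_int c * z + of_int d))
      = (of_int c * z + of_int d) ^ k * (f z + g z)"
    by (simp only: modular_form_slash[OF assms(1) *] modular_form_slash[OF assms(2) *] distrib_left)
next
  fix a b c d :: int assume det: "a * d - b * c = 1"
  let ?u = "\<lambda>f z. f ((of_int a * z + of_int b) / (of_int c * z + of_int d)) / (of_int c * z + of_int d) ^ k"
  obtain B Y where 1: "\<And>z. Im z \<ge> Y \<Longrightarrow> norm (?u f z) \<le> B"
    using modular_form_cusp[OF assms(1) det] by blast
  obtain B' Y' where 2: "\<And>z. Im z \<ge> Y' \<Longrightarrow> norm (?u g z) \<le> B'"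
    using modular_form_cusp[OF assms(2) det] by blast
  have "norm (?u (\<lambda>z. f z + g z) z) \<le> B + B'" if "Im z \<ge> max Y Y'" for z
  proof -
    have "?u (\<lambda>z. f z + g z) z = ?u f z + ?u g z" by (rule add_divide_distrib)
    moreover have "norm (?u f z + ?u g z) \<le> B + B'"
      using that by (intro norm_triangle_mono 1 2) auto
    ultimately show ?thesis by (simp only:)
  qed
  then show "\<exists>B Y. \<forall>z. Im z \<ge> Y \<longrightarrow> norm (?u (\<lambda>z. f z + g z) z) \<le> B" by blast
qed

lemma modular_form_mult:
  assumes "modular_form_Gamma0_5 k f" "modular_form_Gamma0_5 l g"
  shows "modular_form_Gamma0_5 (k + l) (\<lambda>z. f z * g z)"
  unfolding modular_form_Gamma0_5_def
proof (intro conjI allI impI)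
  show "(\<lambda>z. f z * g z) holomorphic_on upper_half_plane"
    by (intro holomorphic_intros modular_form_holomorphic[OF assms(1)] modular_form_holomorphic[OF assms(2)])
next
  fix a b c d :: int and z assume *: "a * d - b * c = 1 \<and> 5 dvd c" "Im z > 0"
  show "f ((of_int a * z + of_int b) / (of_int c * z + of_int d)) * g ((of_int a * z + of_int b) / (of_int c * z + of_int d))
      = (of_int c * z + of_int d) ^ (k + l) * (f z * g z)"
    unfolding modular_form_slash[OF assms(1) *] modular_form_slash[OF assms(2) *] power_add
    by (simp only: mult_ac)
next
  fix a b c d :: int assume det: "a * d - b * c = 1"
  let ?u = "\<lambda>k f z. f ((of_int a * z + of_int b) / (of_int c * z + of_int d)) / (of_int c * z + of_int d) ^ k"
  obtain B Y where 1: "\<And>z. Im z \<ge> Y \<Longrightarrow> norm (?u k f z) \<le> B"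
    using modular_form_cusp[OF assms(1) det] by blast
  obtain B' Y' where 2: "\<And>z. Im z \<ge> Y' \<Longrightarrow> norm (?u l g z) \<le> B'"
    using modular_form_cusp[OF assms(2) det] by blast
  have "norm (?u (k + l) (\<lambda>z. f z * g z) z) \<le> B * B'" if "Im z \<ge> max Y Y'" for z
  proof -
    have "?u (k + l) (\<lambda>z. f z * g z) z = ?u k f z * ?u l g z" by (simp add: power_add)
    then show ?thesis using 1[of z] 2[of z] that
      by (simp only: norm_mult) (intro mult_mono, auto intro: order_trans[OF norm_ge_zero])
  qed
  then show "\<exists>B Y. \<forall>z. Im z \<ge> Y \<longrightarrow> norm (?u (k + l) (\<lambda>z. f z * g z) z) \<le> B" by blast
qed

lemma modular_form_const: "modular_form_Gamma0_5 0 (\<lambda>_. c)"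
  unfolding modular_form_Gamma0_5_def by (auto intro!: holomorphic_intros)

text \<open>Identities such as \<open>q_eval_add\<close> hold only on the upper half plane, and
  being a form depends on nothing else: a cusp bound may always be moved up to height at least
  1.\<close>

lemma modular_form_cong:
  assumes "modular_form_Gamma0_5 k f" and eq: "\<And>z. Im z > 0 \<Longrightarrow> f z = g z"
  shows "modular_form_Gamma0_5 k g"
  unfolding modular_form_Gamma0_5_def
proof (intro conjI allI impI)
  show "g holomorphic_on upper_half_plane"
    using modular_form_holomorphic[OF assms(1)] eq
    by (rule holomorphic_transform) (simp add: upper_half_plane_def)
next
  fix a b c d :: int and z assume *: "a * d - b * c = 1 \<and> 5 dvd c" "Im z > 0"
  then have pos: "Im ((of_int a * z + of_int b) / (of_int c * z + of_int d)) > 0"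
    using Im_moebius_pos[of a d b c z] by (simp add: moebius_def)
  have "f ((of_int a * z + of_int b) / (of_int c * z + of_int d)) = (of_int c * z + of_int d) ^ k * f z"
    by (rule modular_form_slash[OF assms(1) *])
  then show "g ((of_int a * z + of_int b) / (of_int c * z + of_int d)) = (of_int c * z + of_int d) ^ k * g z"
    using eq[OF pos] eq * by simp
next
  fix a b c d :: int assume det: "a * d - b * c = 1"
  let ?u = "\<lambda>f z. f ((of_int a * z + of_int b) / (of_int c * z + of_int d)) / (of_int c * z + of_int d) ^ k"
  obtain B Y where 1: "\<And>z. Im z \<ge> Y \<Longrightarrow> norm (?u f z) \<le> B"
    using modular_form_cusp[OF assms(1) det] by blast
  have "norm (?u g z) \<le> B" if "Im z \<ge> max Y 1" for z
    using 1[of z] that eq Im_moebius_pos[OF det, of z] by (simp add: moebius_def)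
  then show "\<exists>B Y. \<forall>z. Im z \<ge> Y \<longrightarrow> norm (?u g z) \<le> B" by blast
qed

text \<open>The integral lift of \<open>Mk\<close>: forms represented by their q-expansions.\<close>

definition int_forms :: "nat \<Rightarrow> int fps set" where
  "int_forms k = {a. disc_convergent a \<and> modular_form_Gamma0_5 k (q_eval a)}"

lemma int_forms_add: "a \<in> int_forms k \<Longrightarrow> b \<in> int_forms k \<Longrightarrow> a + b \<in> int_forms k"
  unfolding int_forms_def
  by (auto intro: disc_convergent_add modular_form_cong[OF modular_form_add] simp: q_eval_add)

lemma int_forms_mult: "a \<in> int_forms k \<Longrightarrow> b \<in> int_forms l \<Longrightarrow> a * b \<in> int_forms (k + l)"
  unfolding int_forms_def
  by (auto intro: disc_convergent_mult modular_form_cong[OF modular_form_mult] simp: q_eval_mult)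

lemma int_forms_const: "fps_const c \<in> int_forms 0"
  using modular_form_const by (auto simp: int_forms_def disc_convergent_const q_eval_const[abs_def])

lemma int_forms_cmult: "a \<in> int_forms k \<Longrightarrow> fps_const c * a \<in> int_forms k"
  using int_forms_mult[OF int_forms_const, of a k c] by simp

lemma int_forms_power: "a \<in> int_forms k \<Longrightarrow> a ^ n \<in> int_forms (n * k)"
proof (induction n)
  case 0
  then show ?case using int_forms_const[of 1] by simp
qed (auto intro: int_forms_mult)

section \<open>Reduction of integral series modulo 2\<close>

definition reduce :: "int fps \<Rightarrow> bit fps" where
  "reduce a = Abs_fps (\<lambda>n. of_int (a $ n))"

lemma reduce_nth [simp]: "reduce a $ n = of_int (a $ n)"
  by (simp add: reduce_def)

lemma reduce_simps:
  "reduce 0 = 0" "reduce 1 = 1" "reduce fps_X = fps_X"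
  "reduce (a + b) = reduce a + reduce b"
  "reduce (a - b) = reduce a - reduce b"
  "reduce (a * b) = reduce a * reduce b"
  "reduce (fps_const c) = fps_const (of_int c)"
  by (rule fps_ext; simp add: fps_X_def fps_mult_nth)+

lemma reduce_power: "reduce (a ^ n) = reduce a ^ n"
  by (induction n) (simp_all add: reduce_simps)

lemma reduce_euler: "reduce euler_fps = euler_fps"
proof -
  have "reduce (\<Prod>k=1..n. 1 - fps_X ^ k) = (\<Prod>k=1..n. 1 - fps_X ^ k)" for n
    by (induction n) (simp_all add: reduce_simps reduce_power prod.nat_ivl_Suc' del: bit_fps_diff)
  then show ?thesis by (intro fps_ext) (metis euler_fps_nth order_refl reduce_nth)
qed

lemma nome_power: "exp (2 * of_real pi * \<i> * of_nat n * z) = nome z ^ n"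
  by (subst nome_mult_nat[symmetric]) (simp add: nome_def mult_ac)

text \<open>\<open>Mk\<close> starts from a function and a coefficient sequence. Since the nome is
  onto the punctured disc, convergence at every \<open>z\<close> gives
  \<open>disc_convergent\<close>, and the function is then \<open>q_eval\<close> of the
  series.\<close>

lemma Mk_eq: "Mk k = reduce ` int_forms k"
proof (intro equalityI subsetI)
  fix g assume "g \<in> Mk k"
  then obtain f a where f: "modular_form_Gamma0_5 k f" and a: "int_q_expansion f a"
    and g: "g = Abs_fps (\<lambda>n. of_int (a n))" by (auto simp: Mk_def)
  have sums: "(\<lambda>n. of_int (a n) * nome z ^ n) sums f z" if "Im z > 0" for z
    using a that unfolding int_q_expansion_def nome_power by blast
  define b where "b = Abs_fps a"
  have conv: "disc_convergent b"
  proof (rule disc_convergentI)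
    fix q :: complex assume q: "norm q < 1"
    show "summable (\<lambda>n. of_int (b $ n) * q ^ n)"
    proof (cases "q = 0")
      case False
      then obtain z where "Im z > 0" "nome z = q" using nome_surj q by blast
      then show ?thesis using sums by (auto simp: b_def sums_iff)
    qed simp
  qed
  have "f z = q_eval b z" if "Im z > 0" for z
    using q_eval_sums[OF conv that] sums[OF that] sums_unique2 by (auto simp: b_def)
  then have "b \<in> int_forms k" using modular_form_cong[OF f] conv by (auto simp: int_forms_def)
  moreover have "g = reduce b" by (simp add: g b_def reduce_def)
  ultimately show "g \<in> reduce ` int_forms k" by blast
next
  fix g assume "g \<in> reduce ` int_forms k"
  then obtain b where b: "b \<in> int_forms k" "g = reduce b" by blast
  have "int_q_expansion (q_eval b) (fps_nth b)"
    unfolding int_q_expansion_def nome_power using q_eval_sums b(1) by (auto simp: int_forms_def)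
  then show "g \<in> Mk k" using b by (auto simp: Mk_def int_forms_def reduce_def)
qed

section \<open>The Euler product as a power series\<close>

lemma eval_fps_prod_poly:
  "eval_fps (complex_fps (\<Prod>k=1..N. 1 - fps_X ^ k)) q = (\<Prod>k<N. 1 - q * q ^ k)"
  "fps_conv_radius (complex_fps (\<Prod>k=1..N. 1 - fps_X ^ k)) = \<infinity>"
proof (induction N)
  case (Suc N)
  let ?A = "complex_fps (\<Prod>k=1..N. 1 - fps_X ^ k)"
  have eq: "complex_fps (\<Prod>k=1..Suc N. 1 - fps_X ^ k) = ?A * (1 - fps_X ^ Suc N)"
    by (simp add: prod.nat_ivl_Suc' complex_fps_simps complex_fps_power mult.commute del: power_Suc)
  have r: "fps_conv_radius (1 - fps_X ^ Suc N :: complex fps) = \<infinity>"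
    using fps_conv_radius_diff[of "1 :: complex fps" "fps_X ^ Suc N"] by (simp del: power_Suc)
  show "fps_conv_radius (complex_fps (\<Prod>k=1..Suc N. 1 - fps_X ^ k)) = \<infinity>"
    unfolding eq using fps_conv_radius_mult[of ?A "1 - fps_X ^ Suc N"] Suc r by simp
  show "eval_fps (complex_fps (\<Prod>k=1..Suc N. 1 - fps_X ^ k)) q = (\<Prod>k<Suc N. 1 - q * q ^ k)"
    unfolding eq using Suc r by (subst eval_fps_mult) (simp_all add: eval_fps_diff del: power_Suc, simp)
qed (simp_all add: complex_fps_simps)

lemma qpoch_self_holomorphic: "(\<lambda>q. qpoch q q) holomorphic_on ball 0 1"
  by (rule holomorphic_on_qpoch) (auto intro: holomorphic_intros)

text \<open>Under locally uniform convergence Taylor coefficients converge, and those of the partial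
  products are eventually constant by \<open>euler_fps_nth\<close>.\<close>

lemma qpoch_self_has_fps_expansion: "(\<lambda>q. qpoch q q) has_fps_expansion complex_fps euler_fps"
proof -
  let ?f = "\<lambda>q. qpoch q q"
  have "?f analytic_on {0}"
    using qpoch_self_holomorphic by (auto simp: analytic_at intro!: exI[of _ "ball 0 1"])
  then have exp: "?f has_fps_expansion fps_expansion ?f 0" by (rule analytic_at_imp_has_fps_expansion_0)
  have "fps_expansion ?f 0 = complex_fps euler_fps"
  proof (rule fps_ext)
    fix n
    let ?g = "\<lambda>N q. \<Prod>k<N. 1 - q * q ^ k :: complex"
    have "uniform_limit (cball 0 (1/2)) ?g ?f sequentially"
      by (rule uniform_limit_qpoch) (auto intro: continuous_intros)
    then have "uniform_limit (ball 0 (1/2)) ?g ?f sequentially"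
      by (rule uniform_limit_on_subset) auto
    then have "(\<lambda>N. (deriv ^^ n) (?g N) 0) \<longlonglongrightarrow> (deriv ^^ n) ?f 0"
      by (rule higher_deriv_complex_uniform_limit) (auto intro!: always_eventually holomorphic_intros)
    then have "(\<lambda>N. (deriv ^^ n) (?g N) 0 / fact n) \<longlonglongrightarrow> (deriv ^^ n) ?f 0 / fact n"
      by (intro tendsto_divide) auto
    moreover have "\<forall>\<^sub>F N in sequentially. (deriv ^^ n) (?g N) 0 / fact n = of_int (euler_fps $ n)"
      using eventually_ge_at_top[of n]
    proof eventually_elim
      case (elim N)
      have "?g N has_fps_expansion complex_fps (\<Prod>k=1..N. 1 - fps_X ^ k)"
        unfolding has_fps_expansion_def eval_fps_prod_poly by simp
      then have "complex_fps (\<Prod>k=1..N. 1 - fps_X ^ k) $ n = (deriv ^^ n) (?g N) 0 / fact n"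
        by (rule fps_nth_fps_expansion)
      then show ?case using euler_fps_nth[OF elim, where 'a = int] by simp
    qed
    ultimately have "(\<lambda>N. of_int (euler_fps $ n)) \<longlonglongrightarrow> (deriv ^^ n) ?f 0 / fact n"
      by (rule Lim_transform_eventually)
    then have "(deriv ^^ n) ?f 0 / fact n = of_int (euler_fps $ n)"
      by (rule LIMSEQ_unique[OF _ tendsto_const])
    then show "fps_expansion ?f 0 $ n = complex_fps euler_fps $ n"
      using fps_nth_fps_expansion[OF exp, of n] by simp
  qed
  then show ?thesis using exp by simp
qed

text \<open>An expansion is a statement near 0. Holomorphy on the unit disc bounds the radius below,
  and the identity theorem carries the equality to the whole disc.\<close>

lemma has_fps_expansion_disc:
  assumes "f has_fps_expansion complex_fps a" "f holomorphic_on ball 0 1"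
  shows "disc_convergent a" "norm q < 1 \<Longrightarrow> eval_fps (complex_fps a) q = f q"
proof -
  have "fps_conv_radius (complex_fps a) \<ge> ereal 1"
    using assms by (intro holomorphic_on_imp_fps_conv_radius_ge) auto
  then show conv: "disc_convergent a" by (simp add: disc_convergent_def one_ereal_def)
  assume q: "norm q < 1"
  have ev: "\<forall>\<^sub>F q in nhds 0. eval_fps (complex_fps a) q = f q"
    using assms(1) by (simp add: has_fps_expansion_def)
  then obtain U where U: "open U" "0 \<in> U" "\<And>q. q \<in> U \<Longrightarrow> eval_fps (complex_fps a) q = f q"
    by (auto simp: eventually_nhds)
  have "eval_fps (complex_fps a) holomorphic_on ball 0 1"
    using disc_convergentD[OF conv] by (intro holomorphic_on_eval_fps) (auto simp: dist_norm)
  then show "eval_fps (complex_fps a) q = f q"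
    using assms(2) U q
    by (intro analytic_continuation_open[of "U \<inter> ball 0 1" "ball 0 1" "eval_fps (complex_fps a)" f q]) auto
qed

lemma disc_convergent_euler: "disc_convergent euler_fps"
  and eval_euler: "norm q < 1 \<Longrightarrow> eval_fps (complex_fps euler_fps) q = qpoch q q"
  using has_fps_expansion_disc[OF qpoch_self_has_fps_expansion qpoch_self_holomorphic] by auto

section \<open>Eta quotients of level 5\<close>

definition dilate :: "int fps \<Rightarrow> int fps" where
  "dilate a = a oo fps_X ^ 5"

lemma dilate_nth: "dilate a $ n = (if 5 dvd n then a $ (n div 5) else 0)"
  by (simp add: dilate_def fps_nth_compose_X_power)

lemma dilate_mult: "dilate (a * b) = dilate a * dilate b"
  unfolding dilate_def by (rule fps_compose_mult_distrib) simp

lemma dilate_1: "dilate 1 = 1"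
  by (simp add: dilate_def)

lemma dilate_power: "dilate (a ^ n) = dilate a ^ n"
  by (induction n) (simp_all add: dilate_mult dilate_1)

lemma dilate_X: "dilate fps_X = fps_X ^ 5"
  by (simp add: dilate_def)

lemma dilate_sums:
  assumes "disc_convergent a" "norm q < 1"
  shows "(\<lambda>n. of_int (dilate a $ n) * q ^ n) sums eval_fps (complex_fps a) (q ^ 5)"
proof -
  have "norm (q ^ 5) < 1" using assms(2) by (simp add: norm_power power_less_one_iff)
  then have "(\<lambda>n. of_int (a $ n) * (q ^ 5) ^ n) sums eval_fps (complex_fps a) (q ^ 5)"
    using sums_eval_fps[OF disc_convergentD[OF assms(1)]] by simp
  also have "(\<lambda>n. of_int (a $ n) * (q ^ 5) ^ n) = (\<lambda>n. of_int (dilate a $ (5 * n)) * q ^ (5 * n))"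
    by (simp add: dilate_nth power_mult)
  finally show ?thesis
    by (subst (asm) sums_mono_reindex[of "\<lambda>n. 5 * n"]) (auto simp: strict_mono_def dilate_nth elim!: dvdE)
qed

lemma disc_convergent_dilate:
  assumes "disc_convergent a"
  shows "disc_convergent (dilate a)"
  using dilate_sums[OF assms] by (intro disc_convergentI) (auto simp: sums_iff)

lemma q_eval_dilate:
  assumes "disc_convergent a" "Im z > 0"
  shows "q_eval (dilate a) z = q_eval a (5 * z)"
  using sums_unique2[OF q_eval_sums[OF disc_convergent_dilate[OF assms(1)] assms(2)]
      dilate_sums[OF assms(1) norm_nome_less_1[OF assms(2)]]]
    nome_mult_nat[of 5 z] by (simp add: q_eval_def)

text \<open>The reciprocal of a nonvanishing sum is holomorphic on the disc, and its Taylor series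
  is the formal inverse.\<close>

lemma inverse_disc_convergent:
  assumes ab: "a * b = 1" and a: "disc_convergent a"
    and nz: "\<And>q. norm q < 1 \<Longrightarrow> eval_fps (complex_fps a) q \<noteq> 0"
  shows "disc_convergent b"
proof -
  have r: "fps_conv_radius (complex_fps a) > 0"
    using disc_convergentD[OF a, of 0] by (simp add: zero_ereal_def)
  have "complex_fps a * complex_fps b = 1" using ab by (metis complex_fps_simps(2,6))
  moreover from this have a0: "complex_fps a $ 0 \<noteq> 0" by (metis fps_mult_nth_0 fps_one_nth mult_zero_left zero_neq_one)
  ultimately have "inverse (complex_fps a) = complex_fps b" by (simp add: fps_inverse_unique)
  moreover have "(\<lambda>q. inverse (eval_fps (complex_fps a) q)) has_fps_expansion inverse (complex_fps a)"
    by (intro has_fps_expansion_inverse eval_fps_has_fps_expansion r a0)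
  moreover have "(\<lambda>q. inverse (eval_fps (complex_fps a) q)) holomorphic_on ball 0 1"
    using nz disc_convergentD[OF a] by (intro holomorphic_intros) (auto simp: dist_norm)
  ultimately show ?thesis by (metis has_fps_expansion_disc(1))
qed

text \<open>The constant term is 1, so the inverse exists over the integers.\<close>

definition euler_inv :: "int fps" where
  "euler_inv = fps_right_inverse euler_fps 1"

lemma euler_inv: "euler_fps * euler_inv = 1"
  unfolding euler_inv_def by (rule fps_right_inverse) (simp add: euler_fps_def)

lemma disc_convergent_euler_inv: "disc_convergent euler_inv"
  using euler_inv disc_convergent_euler
  by (rule inverse_disc_convergent) (simp add: eval_euler qpoch_self_nonzero)

abbreviation "p1 \<equiv> euler_fps :: int fps"
abbreviation "p5 \<equiv> dilate euler_fps"
abbreviation "i1 \<equiv> euler_inv"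
abbreviation "i5 \<equiv> dilate euler_inv"

lemma euler_inv5: "p5 * i5 = 1"
  by (simp add: dilate_mult[symmetric] euler_inv dilate_1)

lemmas disc_convergent_euler_intros =
  disc_convergent_intros disc_convergent_dilate disc_convergent_euler disc_convergent_euler_inv

text \<open>The eta quotients \<open>\<eta>(z)\<^sup>1\<^sup>0 / \<eta>(5z)\<^sup>2\<close>, \<open>\<eta>(5z)\<^sup>1\<^sup>0 / \<eta>(z)\<^sup>2\<close> and
  \<open>\<eta>(z)\<^sup>4 \<eta>(5z)\<^sup>4\<close>, and the discriminant.\<close>

definition A_form :: "int fps" where "A_form = p1 ^ 10 * i5 ^ 2"
definition B_form :: "int fps" where "B_form = fps_X ^ 2 * p5 ^ 10 * i1 ^ 2"
definition C_form :: "int fps" where "C_form = fps_X * p1 ^ 4 * p5 ^ 4"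
definition D_form :: "int fps" where "D_form = fps_X * p1 ^ 24"

lemma cancel_inv:
  fixes x y :: "'a :: comm_semiring_1"
  assumes "x * y = 1"
  shows "x ^ (n + k) * y ^ n = x ^ k" "y ^ n * x ^ (n + k) = x ^ k"
proof -
  have "x ^ n * y ^ n = 1" using assms by (metis power_mult_distrib power_one)
  then show "x ^ (n + k) * y ^ n = x ^ k" "y ^ n * x ^ (n + k) = x ^ k"
    by (simp_all add: power_add mult_ac)
qed

lemma C_form_square: "C_form ^ 2 = A_form * B_form"
proof -
  have "A_form * B_form = fps_X ^ 2 * (p1 ^ (2 + 8) * i1 ^ 2) * (p5 ^ (2 + 8) * i5 ^ 2)"
    by (simp add: A_form_def B_form_def mult_ac)
  also have "\<dots> = fps_X ^ 2 * p1 ^ 8 * p5 ^ 8"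
    by (simp only: cancel_inv[OF euler_inv] cancel_inv[OF euler_inv5])
  also have "\<dots> = C_form ^ 2"
    by (simp add: C_form_def power_mult_distrib power_mult[symmetric])
  finally show ?thesis ..
qed

lemma D_form_eq: "D_form = A_form ^ 2 * C_form"
proof -
  have "A_form ^ 2 * C_form = fps_X * (p1 ^ 20 * p1 ^ 4) * (p5 ^ (4 + 0) * i5 ^ 4)"
    by (simp add: A_form_def C_form_def power_mult_distrib power_mult[symmetric] mult_ac)
  also have "p5 ^ (4 + 0) * i5 ^ 4 = p5 ^ 0" by (rule cancel_inv[OF euler_inv5])
  also have "p1 ^ 20 * p1 ^ 4 = p1 ^ 24" by (simp add: power_add[symmetric])
  finally show ?thesis by (simp add: D_form_def)
qed

lemma D5_form_eq: "dilate D_form = B_form ^ 2 * C_form"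
proof -
  have "B_form ^ 2 * C_form = (fps_X ^ 4 * fps_X) * (p5 ^ 20 * p5 ^ 4) * (p1 ^ (4 + 0) * i1 ^ 4)"
    by (simp add: B_form_def C_form_def power_mult_distrib power_mult[symmetric] mult_ac)
  also have "p1 ^ (4 + 0) * i1 ^ 4 = p1 ^ 0" by (rule cancel_inv[OF euler_inv])
  also have "p5 ^ 20 * p5 ^ 4 = p5 ^ 24" by (simp add: power_add[symmetric])
  also have "fps_X ^ 4 * fps_X = (fps_X ^ 5 :: int fps)" by (simp add: power_numeral_reduce mult_ac)
  finally show ?thesis by (simp add: D_form_def dilate_mult dilate_power dilate_X)
qed

lemma disc_convergent_forms: "disc_convergent A_form" "disc_convergent B_form"
  "disc_convergent C_form" "disc_convergent D_form"
  unfolding A_form_def B_form_def C_form_def D_form_def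
  by (intro disc_convergent_euler_intros)+

section \<open>Transformation laws of the eta quotients\<close>

definition eta_a :: "complex \<Rightarrow> complex" where "eta_a = q_eval A_form"
definition eta_b :: "complex \<Rightarrow> complex" where "eta_b = q_eval B_form"
definition eta_c :: "complex \<Rightarrow> complex" where "eta_c = q_eval C_form"
definition discriminant :: "complex \<Rightarrow> complex" where "discriminant = q_eval D_form"

lemma discriminant_eq:
  assumes "Im z > 0"
  shows "discriminant z = nome z * qpoch (nome z) (nome z) ^ 24"
  using assms eval_euler[OF norm_nome_less_1[OF assms]]
  by (simp add: discriminant_def D_form_def q_eval_mult q_eval_power disc_convergent_euler_intros q_eval_X)
     (simp add: q_eval_def)

lemma discriminant_nonzero: "Im z > 0 \<Longrightarrow> discriminant z \<noteq> 0"
  by (simp add: discriminant_eq qpoch_self_nonzero norm_nome_less_1)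

lemma discriminant_inversion: "Im z > 0 \<Longrightarrow> discriminant (- 1 / z) = z ^ 12 * discriminant z"
  using qpoch_inversion[of z] Im_neg_inverse_pos[of z] by (simp add: discriminant_eq)

lemma discriminant_periodic: "Im z > 0 \<Longrightarrow> discriminant (z + of_int n) = discriminant z"
  by (rule periodic_int[of discriminant]) (simp_all add: discriminant_def q_eval_periodic)

lemma eta_relations:
  assumes "Im z > 0"
  shows "eta_c z ^ 2 = eta_a z * eta_b z" "discriminant z = eta_a z ^ 2 * eta_c z"
    "discriminant (5 * z) = eta_b z ^ 2 * eta_c z"
proof -
  show "eta_c z ^ 2 = eta_a z * eta_b z"
    unfolding eta_c_def eta_a_def eta_b_def
    by (simp add: assms disc_convergent_forms C_form_square flip: q_eval_mult q_eval_power)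
  show "discriminant z = eta_a z ^ 2 * eta_c z"
    unfolding eta_c_def eta_a_def discriminant_def D_form_eq
    by (simp add: assms disc_convergent_forms q_eval_mult q_eval_power disc_convergent_power)
  have "discriminant (5 * z) = q_eval (dilate D_form) z"
    by (simp add: discriminant_def q_eval_dilate assms disc_convergent_forms)
  then show "discriminant (5 * z) = eta_b z ^ 2 * eta_c z"
    unfolding eta_c_def eta_b_def D5_form_eq
    by (simp add: assms disc_convergent_forms q_eval_mult q_eval_power disc_convergent_power)
qed

lemma eta_nonzero:
  assumes "Im z > 0"
  shows "eta_a z \<noteq> 0" "eta_b z \<noteq> 0" "eta_c z \<noteq> 0"
  using eta_relations[OF assms] discriminant_nonzero[OF assms] discriminant_nonzero[of "5 * z"] assms by auto

text \<open>The sixth power of \<open>eta_c\<close> involves only discriminants, so its laws are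
  known and \<open>power_ratio_constant\<close> can take the root.\<close>

lemma eta_c_power6:
  assumes "Im z > 0"
  shows "eta_c z ^ 6 = discriminant z * discriminant (5 * z)"
proof -
  have "eta_c z ^ 6 = eta_c z ^ 2 * (eta_c z ^ 2) ^ 2" by (simp add: power_numeral_reduce)
  also have "(eta_c z ^ 2) ^ 2 = (eta_a z * eta_b z) ^ 2" using eta_relations(1)[OF assms] by simp
  finally show ?thesis unfolding eta_relations(2,3)[OF assms] by (simp add: power2_eq_square mult_ac)
qed

lemma holomorphic_eta: "eta_a holomorphic_on upper_half_plane" "eta_b holomorphic_on upper_half_plane"
  "eta_c holomorphic_on upper_half_plane"
  by (simp_all add: eta_a_def eta_b_def eta_c_def holomorphic_on_q_eval disc_convergent_forms)

text \<open>The ratio is continuous on a connected set with values among the finitely many n-th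
  roots of \<open>K\<close>.\<close>

lemma power_ratio_constant:
  assumes hol: "f holomorphic_on upper_half_plane" "g holomorphic_on upper_half_plane"
    and nz: "\<And>z. Im z > 0 \<Longrightarrow> g z \<noteq> 0"
    and eq: "\<And>z. Im z > 0 \<Longrightarrow> f z ^ n = K * g z ^ n" and n: "n > 0"
  obtains \<kappa> where "\<And>z. Im z > 0 \<Longrightarrow> f z = \<kappa> * g z"
proof -
  have "(\<lambda>z. f z / g z) constant_on upper_half_plane"
  proof (rule continuous_finite_range_constant)
    show "continuous_on upper_half_plane (\<lambda>z. f z / g z)"
      using hol nz by (intro continuous_intros holomorphic_on_imp_continuous_on) (auto simp: upper_half_plane_def)
    have "(f z / g z) ^ n = K" if "Im z > 0" for z
      using eq[OF that] nz[OF that] by (simp add: power_divide)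
    then have "(\<lambda>z. f z / g z) ` upper_half_plane \<subseteq> {w. w ^ n = K}" by (auto simp: upper_half_plane_def)
    moreover have "finite {w :: complex. w ^ n = K}" using n by (rule finite_nth_roots)
    ultimately show "finite ((\<lambda>z. f z / g z) ` upper_half_plane)" by (rule finite_subset)
  qed simp
  then obtain \<kappa> where "\<And>z. Im z > 0 \<Longrightarrow> f z / g z = \<kappa>"
    by (auto simp: constant_on_def upper_half_plane_def)
  then show ?thesis using that nz by (metis nonzero_divide_eq_eq)
qed

lemma discriminant_fricke:
  assumes "Im z > 0"
  shows "discriminant (- 1 / (5 * z)) = 5 ^ 12 * z ^ 12 * discriminant (5 * z)"
    "discriminant (5 * (- 1 / (5 * z))) = z ^ 12 * discriminant z"
proof -
  show "discriminant (- 1 / (5 * z)) = 5 ^ 12 * z ^ 12 * discriminant (5 * z)"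
    using discriminant_inversion[of "5 * z"] assms by (simp add: power_mult_distrib)
  have "5 * (- 1 / (5 * z)) = - 1 / z" by simp
  then show "discriminant (5 * (- 1 / (5 * z))) = z ^ 12 * discriminant z"
    using discriminant_inversion[OF assms] by (simp only:)
qed

lemma eta_c_fricke: obtains \<kappa> where "\<kappa> \<noteq> 0" "\<And>z. Im z > 0 \<Longrightarrow> eta_c (- 1 / (5 * z)) = \<kappa> * z ^ 4 * eta_c z"
proof -
  obtain \<kappa> where \<kappa>: "\<And>z. Im z > 0 \<Longrightarrow> eta_c (- 1 / (5 * z)) = \<kappa> * (z ^ 4 * eta_c z)"
  proof (rule power_ratio_constant)
    show "(\<lambda>z. eta_c (- 1 / (5 * z))) holomorphic_on upper_half_plane"
      by (rule holomorphic_on_fricke[OF holomorphic_eta(3)])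
    show "(\<lambda>z. z ^ 4 * eta_c z) holomorphic_on upper_half_plane"
      by (intro holomorphic_intros holomorphic_eta)
    show "z ^ 4 * eta_c z \<noteq> 0" if "Im z > 0" for z using eta_nonzero[OF that] that by auto
    show "eta_c (- 1 / (5 * z)) ^ 6 = 5 ^ 12 * (z ^ 4 * eta_c z) ^ 6" if z: "Im z > 0" for z
      unfolding power_mult_distrib eta_c_power6[OF z] eta_c_power6[OF Im_fricke_pos[OF z]] discriminant_fricke[OF z]
      by (simp add: power_mult[symmetric] power_add[symmetric] mult_ac)
  qed auto
  moreover have "\<kappa> \<noteq> 0" using \<kappa>[of \<i>] eta_nonzero(3)[OF Im_fricke_pos[of \<i>]] by auto
  ultimately show ?thesis using that by (simp add: mult.assoc)
qed

text \<open>The involution exchanges Delta(z) and Delta(5z), that is a^2 c and b^2 c, up to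
  elementary factors. Dividing by the law of c leaves squares.\<close>

lemma eta_a_fricke: obtains \<kappa> where "\<kappa> \<noteq> 0" "\<And>z. Im z > 0 \<Longrightarrow> eta_a (- 1 / (5 * z)) = \<kappa> * z ^ 4 * eta_b z"
proof -
  obtain k where k: "k \<noteq> 0" "\<And>z. Im z > 0 \<Longrightarrow> eta_c (- 1 / (5 * z)) = k * z ^ 4 * eta_c z"
    using eta_c_fricke by blast
  obtain \<kappa> where \<kappa>: "\<And>z. Im z > 0 \<Longrightarrow> eta_a (- 1 / (5 * z)) = \<kappa> * (z ^ 4 * eta_b z)"
  proof (rule power_ratio_constant)
    show "(\<lambda>z. eta_a (- 1 / (5 * z))) holomorphic_on upper_half_plane"
      by (rule holomorphic_on_fricke[OF holomorphic_eta(1)])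
    show "(\<lambda>z. z ^ 4 * eta_b z) holomorphic_on upper_half_plane"
      by (intro holomorphic_intros holomorphic_eta)
    show "z ^ 4 * eta_b z \<noteq> 0" if "Im z > 0" for z using eta_nonzero[OF that] that by auto
    show "eta_a (- 1 / (5 * z)) ^ 2 = (5 ^ 12 / k) * (z ^ 4 * eta_b z) ^ 2" if z: "Im z > 0" for z
    proof -
      have "eta_a (- 1 / (5 * z)) ^ 2 * (k * z ^ 4 * eta_c z) = 5 ^ 12 * z ^ 12 * (eta_b z ^ 2 * eta_c z)"
        using eta_relations(2)[OF Im_fricke_pos[OF z]] discriminant_fricke(1)[OF z] eta_relations(3)[OF z] k(2)[OF z] by metis
      then have "(eta_a (- 1 / (5 * z)) ^ 2 * k) * (z ^ 4 * eta_c z) = (5 ^ 12 * (z ^ 4 * eta_b z) ^ 2) * (z ^ 4 * eta_c z)"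
        by (simp add: power_mult_distrib power_mult[symmetric] power_add[symmetric] mult_ac flip: power_add)
      moreover have "z ^ 4 * eta_c z \<noteq> 0" using eta_nonzero[OF z] z by auto
      ultimately have "eta_a (- 1 / (5 * z)) ^ 2 * k = 5 ^ 12 * (z ^ 4 * eta_b z) ^ 2"
        by (metis mult_right_cancel)
      then show ?thesis using k(1) by (simp add: field_simps)
    qed
  qed auto
  moreover have "\<kappa> \<noteq> 0" using \<kappa>[of \<i>] eta_nonzero(1)[OF Im_fricke_pos[of \<i>]] by auto
  ultimately show ?thesis using that by (simp add: mult.assoc)
qed

lemma eta_b_fricke: obtains \<kappa> where "\<kappa> \<noteq> 0" "\<And>z. Im z > 0 \<Longrightarrow> eta_b (- 1 / (5 * z)) = \<kappa> * z ^ 4 * eta_a z"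
proof -
  obtain k where k: "k \<noteq> 0" "\<And>z. Im z > 0 \<Longrightarrow> eta_a (- 1 / (5 * z)) = k * z ^ 4 * eta_b z"
    using eta_a_fricke by blast
  \<comment> \<open>The law of \<open>eta_a\<close> is solved at -1/(5z); 625 = 5^4 comes from the
    fourth power of that point.\<close>
  have "eta_b (- 1 / (5 * z)) = (625 / k) * z ^ 4 * eta_a z" if z: "Im z > 0" for z
  proof -
    have "z \<noteq> 0" using z by auto
    have "eta_a z = k * (- 1 / (5 * z)) ^ 4 * eta_b (- 1 / (5 * z))"
      using k(2)[OF Im_fricke_pos[OF z]] unfolding fricke_involution .
    then show ?thesis using k(1) \<open>z \<noteq> 0\<close> by (simp add: field_simps)
  qed
  then show ?thesis using that[of "625 / k"] k(1) by simp
qed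

lemma Im_elliptic_pos: "Im z > 0 \<Longrightarrow> Im ((2 * z - 1) / (5 * z - 2)) > 0"
  using Im_moebius_pos[of 2 "-2" "-1" 5 z] by (simp add: moebius_def)

lemma elliptic_denominators:
  assumes "Im z > 0"
  shows "5 * z - 2 \<noteq> 0" "2 * z - 1 \<noteq> 0" "z \<noteq> 0"
  using moebius_denominator_nonzero[of 2 "-2" "-1" 5 z] moebius_denominator_nonzero[of 1 "-1" 0 2 z] assms
  by (auto simp: complex_eq_iff)

text \<open>With S: z -> -1/z and T: z -> z + 1, the elliptic element acts as S T^(-2) S T^2 S. In
  the variable 5z it becomes T^2 S T^(-2).\<close>

lemma discriminant_elliptic:
  assumes z: "Im z > 0"
  shows "discriminant ((2 * z - 1) / (5 * z - 2)) = (5 * z - 2) ^ 12 * discriminant z"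
    "discriminant (5 * ((2 * z - 1) / (5 * z - 2))) = (5 * z - 2) ^ 12 * discriminant (5 * z)"
proof -
  note nz = elliptic_denominators[OF z]
  define t where "t = - 1 / z + of_int 2"
  have "Im (- 1 / z) > 0" using z by (rule Im_neg_inverse_pos)
  then have t: "Im t > 0" by (simp add: t_def)
  define w where "w = - 1 / t + of_int (- 2)"
  have "Im (- 1 / t) > 0" using t by (rule Im_neg_inverse_pos)
  then have w: "Im w > 0" by (simp add: w_def)
  have t_eq: "t = (2 * z - 1) / z" using nz by (simp add: t_def field_simps)
  have w_eq: "w = - (5 * z - 2) / (2 * z - 1)" unfolding w_def t_eq using nz by (simp add: field_simps)
  have "discriminant (- 1 / w) = w ^ 12 * discriminant w" by (rule discriminant_inversion[OF w])
  also have "discriminant w = discriminant (- 1 / t)" unfolding w_def by (rule discriminant_periodic[OF \<open>Im (- 1 / t) > 0\<close>])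
  also have "discriminant (- 1 / t) = t ^ 12 * discriminant t" by (rule discriminant_inversion[OF t])
  also have "discriminant t = discriminant (- 1 / z)" unfolding t_def by (rule discriminant_periodic[OF \<open>Im (- 1 / z) > 0\<close>])
  also have "discriminant (- 1 / z) = z ^ 12 * discriminant z" by (rule discriminant_inversion[OF z])
  also have "w ^ 12 * (t ^ 12 * (z ^ 12 * discriminant z)) = (w * t * z) ^ 12 * discriminant z" by (simp add: power_mult_distrib)
  also have "w * t * z = - (5 * z - 2)" unfolding w_eq t_eq using nz by simp
  also have "(- (5 * z - 2)) ^ 12 = (5 * z - 2) ^ 12" by (rule power_minus_even) simp
  also have "- 1 / w = (2 * z - 1) / (5 * z - 2)" unfolding w_eq using nz by (simp add: field_simps)
  finally show "discriminant ((2 * z - 1) / (5 * z - 2)) = (5 * z - 2) ^ 12 * discriminant z" .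
  define u where "u = 5 * z + of_int (- 2)"
  have u: "Im u > 0" "Im (5 * z) > 0" using z by (simp_all add: u_def)
  have "5 * ((2 * z - 1) / (5 * z - 2)) = - 1 / u + of_int 2" using nz by (simp add: u_def field_simps)
  then have "discriminant (5 * ((2 * z - 1) / (5 * z - 2))) = discriminant (- 1 / u)"
    using discriminant_periodic[OF Im_neg_inverse_pos[OF u(1)], of 2] by simp
  also have "\<dots> = u ^ 12 * discriminant u" by (rule discriminant_inversion[OF u(1)])
  also have "discriminant u = discriminant (5 * z)" unfolding u_def by (rule discriminant_periodic[OF u(2)])
  finally show "discriminant (5 * ((2 * z - 1) / (5 * z - 2))) = (5 * z - 2) ^ 12 * discriminant (5 * z)"
    by (simp add: u_def)
qed

lemma holomorphic_on_elliptic: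
  assumes "f holomorphic_on upper_half_plane"
  shows "(\<lambda>z. f ((2 * z - 1) / (5 * z - 2))) holomorphic_on upper_half_plane"
proof -
  have "(f \<circ> (\<lambda>z. (2 * z - 1) / (5 * z - 2))) holomorphic_on upper_half_plane"
  proof (rule holomorphic_on_compose_gen[OF _ assms])
    show "(\<lambda>z. (2 * z - 1) / (5 * z - 2)) holomorphic_on upper_half_plane"
      using elliptic_denominators by (intro holomorphic_intros) (auto simp: upper_half_plane_def)
  qed (use Im_elliptic_pos in \<open>auto simp: upper_half_plane_def\<close>)
  then show ?thesis by (simp add: o_def)
qed

text \<open>The multiplier of the elliptic element is read off at its fixed point \<open>(2 + \<i>)/5\<close>, where
  the automorphy factor is \<open>\<i>\<^sup>4 = 1\<close>.\<close>

lemma elliptic_multiplier_trivial: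
  assumes hol: "f holomorphic_on upper_half_plane" and nz: "\<And>z. Im z > 0 \<Longrightarrow> f z \<noteq> 0"
    and eq: "\<And>z. Im z > 0 \<Longrightarrow> f ((2 * z - 1) / (5 * z - 2)) ^ n = ((5 * z - 2) ^ 4 * f z) ^ n"
    and n: "n > 0" and z: "Im z > 0"
  shows "f ((2 * z - 1) / (5 * z - 2)) = (5 * z - 2) ^ 4 * f z"
proof -
  obtain \<kappa> where \<kappa>: "\<And>z. Im z > 0 \<Longrightarrow> f ((2 * z - 1) / (5 * z - 2)) = \<kappa> * ((5 * z - 2) ^ 4 * f z)"
  proof (rule power_ratio_constant[where K = 1])
    show "(\<lambda>z. f ((2 * z - 1) / (5 * z - 2))) holomorphic_on upper_half_plane"
      by (rule holomorphic_on_elliptic[OF hol])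
    show "(\<lambda>z. (5 * z - 2) ^ 4 * f z) holomorphic_on upper_half_plane"
      by (intro holomorphic_intros hol)
    show "(5 * z - 2) ^ 4 * f z \<noteq> 0" if "Im z > 0" for z
      using nz[OF that] elliptic_denominators[OF that] by simp
  qed (use eq n in auto)
  define z0 where "z0 = (2 + \<i>) / 5"
  have z0: "Im z0 > 0" "5 * z0 - 2 = \<i>" by (simp_all add: z0_def complex_eq_iff)
  have "(2 * z0 - 1) / \<i> = z0" by (simp add: z0_def field_simps complex_eq_iff)
  then have "f z0 = \<kappa> * f z0" using \<kappa>[OF z0(1)] unfolding z0(2) by (simp add: power_numeral_reduce)
  then have "\<kappa> = 1" using nz[OF z0(1)] by simp
  then show ?thesis using \<kappa>[OF z] by simp
qed

lemma eta_elliptic: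
  assumes z: "Im z > 0"
  shows "eta_a ((2 * z - 1) / (5 * z - 2)) = (5 * z - 2) ^ 4 * eta_a z"
    "eta_b ((2 * z - 1) / (5 * z - 2)) = (5 * z - 2) ^ 4 * eta_b z"
    "eta_c ((2 * z - 1) / (5 * z - 2)) = (5 * z - 2) ^ 4 * eta_c z"
proof -
  have c: "eta_c ((2 * z - 1) / (5 * z - 2)) = (5 * z - 2) ^ 4 * eta_c z" if z: "Im z > 0" for z
  proof (rule elliptic_multiplier_trivial[OF holomorphic_eta(3) eta_nonzero(3) _ _ z, of 6])
    show "eta_c ((2 * z - 1) / (5 * z - 2)) ^ 6 = ((5 * z - 2) ^ 4 * eta_c z) ^ 6" if z: "Im z > 0" for z
      unfolding power_mult_distrib eta_c_power6[OF z] eta_c_power6[OF Im_elliptic_pos[OF z]] discriminant_elliptic[OF z]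
      by (simp add: power_mult[symmetric] power_add[symmetric] mult_ac flip: power_add)
  qed auto
  then show "eta_c ((2 * z - 1) / (5 * z - 2)) = (5 * z - 2) ^ 4 * eta_c z" using z by blast
  \<comment> \<open>Divides the law of y^2 c, a discriminant, by the law of c already
    proved.\<close>
  have sq: "x ^ 2 = (w ^ 4 * y) ^ 2" if "x ^ 2 * (w ^ 4 * c) = w ^ 12 * (y ^ 2 * c)" "c \<noteq> 0" "w \<noteq> 0" for x y w c :: complex
  proof -
    have w12: "w ^ 12 = (w ^ 4) ^ 2 * w ^ 4" by (simp flip: power_mult power_add)
    have "w ^ 12 * (y ^ 2 * c) = (w ^ 4 * y) ^ 2 * (w ^ 4 * c)"
      unfolding w12 power_mult_distrib by (simp only: mult_ac)
    then have "x ^ 2 * (w ^ 4 * c) = (w ^ 4 * y) ^ 2 * (w ^ 4 * c)" using that(1) by (simp only:)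
    moreover have "w ^ 4 * c \<noteq> 0" using that by simp
    ultimately show ?thesis by (metis mult_right_cancel)
  qed
  show "eta_a ((2 * z - 1) / (5 * z - 2)) = (5 * z - 2) ^ 4 * eta_a z"
  proof (rule elliptic_multiplier_trivial[OF holomorphic_eta(1) eta_nonzero(1) _ _ z, of 2])
    show "eta_a ((2 * z - 1) / (5 * z - 2)) ^ 2 = ((5 * z - 2) ^ 4 * eta_a z) ^ 2" if z: "Im z > 0" for z
      using eta_relations(2)[OF Im_elliptic_pos[OF z]] discriminant_elliptic(1)[OF z] eta_relations(2)[OF z] c[OF z]
        eta_nonzero(3)[OF z] elliptic_denominators(1)[OF z] by (intro sq[where c = "eta_c z"]) auto
  qed auto
  show "eta_b ((2 * z - 1) / (5 * z - 2)) = (5 * z - 2) ^ 4 * eta_b z"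
  proof (rule elliptic_multiplier_trivial[OF holomorphic_eta(2) eta_nonzero(2) _ _ z, of 2])
    show "eta_b ((2 * z - 1) / (5 * z - 2)) ^ 2 = ((5 * z - 2) ^ 4 * eta_b z) ^ 2" if z: "Im z > 0" for z
      using eta_relations(3)[OF Im_elliptic_pos[OF z]] discriminant_elliptic(2)[OF z] eta_relations(3)[OF z] c[OF z]
        eta_nonzero(3)[OF z] elliptic_denominators(1)[OF z] by (intro sq[where c = "eta_c z"]) auto
  qed auto
qed

lemma int_formsI:
  assumes "disc_convergent a" "disc_convergent b" "fricke_pair k (q_eval a) (q_eval b) \<kappa>"
  shows "a \<in> int_forms k"
proof -
  obtain B where B: "\<And>z. Im z \<ge> 1 \<Longrightarrow> norm (q_eval a z) \<le> B" using q_eval_bounded[OF assms(1)] by blast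
  obtain B' where B': "\<And>z. Im z \<ge> 1 \<Longrightarrow> norm (q_eval b z) \<le> B'" using q_eval_bounded[OF assms(2)] by blast
  show ?thesis
    using fricke_pair.modular_form[OF assms(3) holomorphic_on_q_eval[OF assms(1)] B B'] assms(1)
    by (simp add: int_forms_def)
qed

lemma eta_forms: "A_form \<in> int_forms 4" "B_form \<in> int_forms 4" "C_form \<in> int_forms 4"
proof -
  have per: "eta_a (z + 1) = eta_a z" "eta_b (z + 1) = eta_b z" "eta_c (z + 1) = eta_c z" for z
    by (simp_all add: eta_a_def eta_b_def eta_c_def q_eval_periodic)
  obtain k where k: "\<And>z. Im z > 0 \<Longrightarrow> eta_a (- 1 / (5 * z)) = k * z ^ 4 * eta_b z" using eta_a_fricke by blast
  have "fricke_pair 4 eta_a eta_b k"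
    by unfold_locales (simp_all only: k eta_elliptic per even_numeral)
  then show "A_form \<in> int_forms 4"
    by (intro int_formsI[OF disc_convergent_forms(1,2)]) (simp add: eta_a_def eta_b_def)
  obtain k where k: "\<And>z. Im z > 0 \<Longrightarrow> eta_b (- 1 / (5 * z)) = k * z ^ 4 * eta_a z" using eta_b_fricke by blast
  have "fricke_pair 4 eta_b eta_a k"
    by unfold_locales (simp_all only: k eta_elliptic per even_numeral)
  then show "B_form \<in> int_forms 4"
    by (intro int_formsI[OF disc_convergent_forms(2,1)]) (simp add: eta_a_def eta_b_def)
  obtain k where k: "\<And>z. Im z > 0 \<Longrightarrow> eta_c (- 1 / (5 * z)) = k * z ^ 4 * eta_c z" using eta_c_fricke by blast
  have "fricke_pair 4 eta_c eta_c k"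
    by unfold_locales (simp_all only: k eta_elliptic per even_numeral)
  then show "C_form \<in> int_forms 4"
    by (intro int_formsI[OF disc_convergent_forms(3,3)]) (simp add: eta_c_def)
qed

text \<open>\<open>E_form\<close> is the logarithmic derivative \<open>q d/dq\<close> of the Hauptmodul
  \<open>T = C / A = q s\<^sup>2\<close>, hence of weight 2, and congruent to 1 modulo 2.\<close>

definition s_form :: "int fps" where "s_form = p5 ^ 3 * i1 ^ 3"
definition s_inv :: "int fps" where "s_inv = p1 ^ 3 * i5 ^ 3"
definition T_form :: "int fps" where "T_form = fps_X * s_form ^ 2"
definition E_form :: "int fps" where "E_form = 1 + fps_const 2 * (fps_X * fps_deriv s_form * s_inv)"

lemma s_form_inv: "s_form * s_inv = 1"
proof -
  have "s_form * s_inv = (p1 * i1) ^ 3 * (p5 * i5) ^ 3"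
    by (simp only: s_form_def s_inv_def power_mult_distrib mult_ac)
  then show ?thesis by (simp add: euler_inv euler_inv5)
qed

lemma T_form_log_deriv: "fps_X * fps_deriv T_form = T_form * E_form"
proof -
  have "fps_deriv T_form = s_form ^ 2 + fps_X * (fps_const 2 * s_form * fps_deriv s_form)"
    by (simp add: T_form_def power2_eq_square algebra_simps fps_const_mult_left[symmetric])
  moreover have "T_form * E_form =
      fps_X * s_form ^ 2 + fps_const 2 * fps_X * fps_X * s_form * fps_deriv s_form * (s_form * s_inv)"
    by (simp add: T_form_def E_form_def power2_eq_square algebra_simps)
  ultimately show ?thesis unfolding s_form_inv by (simp add: algebra_simps)
qed

lemma A_T_form: "A_form * T_form = C_form"
proof -
  have "A_form * T_form = fps_X * (i1 ^ 6 * p1 ^ (6 + 4)) * (i5 ^ 2 * p5 ^ (2 + 4))"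
    by (simp add: A_form_def T_form_def s_form_def power_mult_distrib power_mult[symmetric] mult_ac)
  then show ?thesis
    by (simp only: cancel_inv[OF euler_inv] cancel_inv[OF euler_inv5] C_form_def)
qed

lemma disc_convergent_T: "disc_convergent T_form" "disc_convergent E_form"
  unfolding T_form_def E_form_def s_form_def s_inv_def by (intro disc_convergent_euler_intros)+

lemma q_eval_T: "Im z > 0 \<Longrightarrow> q_eval T_form z = eta_c z / eta_a z"
  using q_eval_mult[OF disc_convergent_forms(1) disc_convergent_T(1), of z] eta_nonzero[of z]
  by (simp add: A_T_form eta_a_def eta_c_def field_simps)

lemma q_eval_T_nonzero: "Im z > 0 \<Longrightarrow> q_eval T_form z \<noteq> 0"
  using eta_nonzero[of z] by (simp add: q_eval_T)

lemma q_eval_T_deriv: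
  assumes "Im z > 0"
  shows "(q_eval T_form has_field_derivative (2 * of_real pi * \<i> * (q_eval T_form z * q_eval E_form z))) (at z)"
  using has_field_derivative_q_eval[OF disc_convergent_T(1) assms]
  by (simp add: T_form_log_deriv q_eval_mult disc_convergent_T assms)

lemma derivative_unique_upper_half_plane:
  assumes "(f has_field_derivative D) (at z)" "(g has_field_derivative D') (at z)" "Im z > 0"
    and "\<And>w. Im w > 0 \<Longrightarrow> f w = g w"
  shows "D = D'"
proof -
  have "(g has_field_derivative D) (at z)"
    by (rule has_field_derivative_transform_within_open[OF assms(1) open_upper_half_plane])
      (use assms in \<open>auto simp: upper_half_plane_def\<close>)
  then show ?thesis using assms(2) by (rule DERIV_unique)
qed

text \<open>The weight-0 function T is invariant. Differentiating this, with (5z-2)^(-2) the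
  derivative of the transformation, gives weight 2 for the logarithmic derivative.\<close>

lemma E_form_elliptic:
  assumes z: "Im z > 0"
  shows "q_eval E_form ((2 * z - 1) / (5 * z - 2)) = (5 * z - 2) ^ 2 * q_eval E_form z"
proof -
  note nz = elliptic_denominators(1)[OF z]
  have inv: "q_eval T_form ((2 * w - 1) / (5 * w - 2)) = q_eval T_form w" if w: "Im w > 0" for w
    using elliptic_denominators(1)[OF w]
    by (simp add: q_eval_T[OF Im_elliptic_pos[OF w]] q_eval_T[OF w] eta_elliptic[OF w])
  let ?e = "(2 * z - 1) / (5 * z - 2)"
  have "((\<lambda>w. (2 * w - 1) / (5 * w - 2)) has_field_derivative (1 / (5 * z - 2) ^ 2)) (at z)"
    using nz by (auto intro!: derivative_eq_intros simp: field_simps power2_eq_square)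
  then have "((\<lambda>w. q_eval T_form ((2 * w - 1) / (5 * w - 2))) has_field_derivative
      (2 * of_real pi * \<i> * (q_eval T_form ?e * q_eval E_form ?e) * (1 / (5 * z - 2) ^ 2))) (at z)"
    by (rule DERIV_chain2[where f = "q_eval T_form" and g = "\<lambda>w. (2 * w - 1) / (5 * w - 2)",
          OF q_eval_T_deriv[OF Im_elliptic_pos[OF z]]])
  from derivative_unique_upper_half_plane[OF this q_eval_T_deriv[OF z] z inv, unfolded inv[OF z]]
  have "(2 * of_real pi * \<i> * q_eval T_form z) * (q_eval E_form ?e / (5 * z - 2) ^ 2) =
      (2 * of_real pi * \<i> * q_eval T_form z) * q_eval E_form z" by (simp add: mult_ac)
  moreover have "2 * of_real pi * \<i> * q_eval T_form z \<noteq> 0" using q_eval_T_nonzero[OF z] by simp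
  ultimately have "q_eval E_form ?e / (5 * z - 2) ^ 2 = q_eval E_form z" using mult_left_cancel by blast
  then show ?thesis using nz by (simp add: nonzero_divide_eq_eq mult.commute)
qed

text \<open>Since c^2 = a b, the involution sends T to a constant multiple of 1/T. Inversion
  accounts for the minus sign, the derivative 1/(5z^2) for the factor 5 z^2.\<close>

lemma E_form_fricke:
  assumes z: "Im z > 0"
  shows "q_eval E_form (- 1 / (5 * z)) = - 5 * z ^ 2 * q_eval E_form z"
proof -
  have z0: "z \<noteq> 0" using z by auto
  obtain k where k: "k \<noteq> 0" "\<And>z. Im z > 0 \<Longrightarrow> eta_a (- 1 / (5 * z)) = k * z ^ 4 * eta_b z" using eta_a_fricke by blast
  obtain l where l: "l \<noteq> 0" "\<And>z. Im z > 0 \<Longrightarrow> eta_c (- 1 / (5 * z)) = l * z ^ 4 * eta_c z" using eta_c_fricke by blast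
  have inv: "q_eval T_form (- 1 / (5 * w)) = (l / k) / q_eval T_form w" if w: "Im w > 0" for w
  proof -
    have "w \<noteq> 0" using w by auto
    then show ?thesis
      using eta_relations(1)[OF w] eta_nonzero[OF w] k(1)
      unfolding q_eval_T[OF Im_fricke_pos[OF w]] q_eval_T[OF w] k(2)[OF w] l(2)[OF w]
      by (simp add: field_simps power2_eq_square)
  qed
  let ?e = "- 1 / (5 * z)"
  have "((\<lambda>w. - 1 / (5 * w)) has_field_derivative (1 / (5 * z ^ 2))) (at z)"
    using z0 by (auto intro!: derivative_eq_intros simp: field_simps power2_eq_square)
  then have 1: "((\<lambda>w. q_eval T_form (- 1 / (5 * w))) has_field_derivative
      (2 * of_real pi * \<i> * (q_eval T_form ?e * q_eval E_form ?e) * (1 / (5 * z ^ 2)))) (at z)"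
    by (rule DERIV_chain2[where f = "q_eval T_form" and g = "\<lambda>w. - 1 / (5 * w)",
          OF q_eval_T_deriv[OF Im_fricke_pos[OF z]]])
  have 2: "((\<lambda>w. (l / k) / q_eval T_form w) has_field_derivative
      (- (2 * of_real pi * \<i> * (q_eval T_form ?e * q_eval E_form z)))) (at z)"
    unfolding inv[OF z]
    by (rule derivative_eq_intros q_eval_T_deriv[OF z] refl)+
      (use q_eval_T_nonzero[OF z] in \<open>auto simp: field_simps power2_eq_square\<close>)
  have "2 * of_real pi * \<i> * q_eval T_form ?e \<noteq> 0"
    using q_eval_T_nonzero[OF Im_fricke_pos[OF z]] by simp
  moreover from derivative_unique_upper_half_plane[OF 1 2 z inv]
  have "(2 * of_real pi * \<i> * q_eval T_form ?e) * (q_eval E_form ?e / (5 * z ^ 2)) =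
      (2 * of_real pi * \<i> * q_eval T_form ?e) * (- q_eval E_form z)" by (simp add: mult_ac)
  ultimately have "q_eval E_form ?e / (5 * z ^ 2) = - q_eval E_form z" using mult_left_cancel by blast
  then show ?thesis using z0 by (simp add: field_simps)
qed

text \<open>Squaring moves E to weight 4, the step by which weights in \<open>M\<close> grow; 25 is
  the square of the factor -5.\<close>

lemma E_form_square: "E_form ^ 2 \<in> int_forms 4"
proof (rule int_formsI)
  show "disc_convergent (E_form ^ 2)" "disc_convergent (E_form ^ 2)"
    by (intro disc_convergent_power disc_convergent_T)+
  show "fricke_pair 4 (q_eval (E_form ^ 2)) (q_eval (E_form ^ 2)) 25"
  proof
    show "q_eval (E_form ^ 2) ((2 * z - 1) / (5 * z - 2)) = (5 * z - 2) ^ 4 * q_eval (E_form ^ 2) z" if "Im z > 0" for z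
      by (simp add: q_eval_power disc_convergent_T that Im_elliptic_pos E_form_elliptic power_mult_distrib power_mult[symmetric])
    show "q_eval (E_form ^ 2) (- 1 / (5 * z)) = 25 * z ^ 4 * q_eval (E_form ^ 2) z" if z: "Im z > 0" for z
      unfolding q_eval_power[OF disc_convergent_T(2) Im_fricke_pos[OF z]] q_eval_power[OF disc_convergent_T(2) z]
        E_form_fricke[OF z] by (simp add: power_mult_distrib power_mult[symmetric])
  qed (simp_all add: q_eval_periodic)
qed

text \<open>The leading 1 comes from the factor q of q s^2, and the 2 from the square.\<close>

lemma reduce_E_form: "reduce (E_form ^ 2) = 1"
proof -
  have "fps_const (0::bit) = 0" by simp
  then have "reduce E_form = 1" by (simp add: E_form_def reduce_simps)
  then show ?thesis by (simp add: reduce_power)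
qed

lemma disc_convergent_shift:
  assumes "disc_convergent a" shows "disc_convergent (fps_shift n a)"
proof -
  have "complex_fps (fps_shift n a) = fps_shift n (complex_fps a)" by (simp add: fps_eq_iff)
  then show ?thesis using assms by (simp add: disc_convergent_def)
qed

text \<open>\<open>B_form\<close> has a double zero at infinity and no other zero, not even at the cusp 0; so division
  by its \<open>m\<close>-th power leaves a function of weight 0 that vanishes at infinity.\<close>

lemma int_forms_vanishing:
  assumes a: "a \<in> int_forms (4 * m)" and low: "\<And>n. n \<le> 2 * m \<Longrightarrow> a $ n = 0"
  shows "a = 0"
proof -
  have conv: "disc_convergent a" and mf: "modular_form_Gamma0_5 (4 * m) (q_eval a)"
    using a by (auto simp: int_forms_def)
  have mb: "modular_form_Gamma0_5 4 eta_b" using eta_forms(2) by (simp add: int_forms_def eta_b_def)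
  define r where "r = fps_shift (2 * m + 1) a"
  have ar: "a = fps_X ^ (2 * m + 1) * r"
    by (rule fps_ext) (auto simp: r_def fps_X_power_mult_nth low simp del: power_Suc)
  \<comment> \<open>The unit part of B^m is inverted formally. As \<open>a\<close> has order above
    2m, one factor \<open>fps_X\<close> survives the division and provides the decay.\<close>
  define w where "w = r * (i5 ^ 10 * p1 ^ 2) ^ m"
  have wconv: "disc_convergent w"
    unfolding w_def r_def by (intro disc_convergent_euler_intros disc_convergent_shift conv)
  have aw: "a = (fps_X * w) * B_form ^ m"
  proof -
    have "(fps_X * w) * B_form ^ m = fps_X * fps_X ^ (2 * m) * r * ((p5 * i5) ^ (10 * m) * (p1 * i1) ^ (2 * m))"
      by (simp add: w_def B_form_def power_mult_distrib power_mult[symmetric] mult_ac)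
    then show ?thesis unfolding euler_inv euler_inv5 by (simp add: ar)
  qed
  define h where "h = q_eval (fps_X * w)"
  have hconv: "disc_convergent (fps_X * w)" by (intro disc_convergent_intros wconv)
  have hb: "q_eval a z = h z * eta_b z ^ m" if "Im z > 0" for z
    unfolding aw h_def eta_b_def
    by (simp add: q_eval_mult q_eval_power that hconv disc_convergent_forms disc_convergent_power)
  have h_eq: "h z = q_eval a z / eta_b z ^ m" if "Im z > 0" for z
    using hb[OF that] eta_nonzero(2)[OF that] by simp
  have "h z = 0" if z: "Im z > 0" for z
  proof (rule weight_zero_vanishing[OF _ _ _ _ z])
    show "h holomorphic_on upper_half_plane" unfolding h_def by (rule holomorphic_on_q_eval[OF hconv])
    show "slash_invariant 0 h a' b c d" if det: "a' * d - b * c = 1" and c: "5 dvd c" for a' b c d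
      unfolding slash_invariant_def
    proof (intro allI impI)
      fix z :: complex assume z: "Im z > 0"
      let ?j = "of_int c * z + of_int d"
      have j: "?j \<noteq> 0" by (rule moebius_denominator_nonzero[OF det z])
      have dc: "a' * d - b * c = 1 \<and> 5 dvd c" using det c by simp
      have "q_eval a (moebius a' b c d z) = ?j ^ (4 * m) * q_eval a z"
        "eta_b (moebius a' b c d z) = ?j ^ 4 * eta_b z"
        unfolding moebius_def using modular_form_slash[OF mf dc z] modular_form_slash[OF mb dc z] by blast+
      then show "h (moebius a' b c d z) = ?j ^ 0 * h z"
        using j by (simp add: h_eq[OF Im_moebius_pos[OF det z]] h_eq[OF z] power_mult_distrib power_mult)
    qed
    show "\<exists>Y. \<forall>z. Im z \<ge> Y \<longrightarrow> norm (h z) < e" if "e > 0" for e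
      unfolding h_def by (rule q_eval_decay[OF wconv that])
    show "\<exists>B Y. \<forall>z. Im z \<ge> Y \<longrightarrow> norm (h (- 1 / (5 * z))) \<le> B"
    proof -
      obtain k where k: "k \<noteq> 0" "\<And>z. Im z > 0 \<Longrightarrow> eta_b (- 1 / (5 * z)) = k * z ^ 4 * eta_a z" using eta_b_fricke by blast
      have "\<exists>B Y. \<forall>z. Im z \<ge> Y \<longrightarrow> norm (q_eval a (- 1 / z) / z ^ (4 * m)) \<le> B"
        using modular_form_cusp[OF mf, of 0 0 "-1" 1] by simp
      then obtain B Y where B: "\<And>z. Im z \<ge> Y \<Longrightarrow> norm (q_eval a (- 1 / z) / z ^ (4 * m)) \<le> B" by blast
      \<comment> \<open>The inverse of \<open>A_form\<close>: at the cusp 0 the denominator B^m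
        becomes A^m, which is a unit at infinity, so its reciprocal is bounded.\<close>
      define ia where "ia = i1 ^ 10 * p5 ^ 2"
      have iac: "disc_convergent ia" unfolding ia_def by (intro disc_convergent_euler_intros)
      have "A_form * ia = (p1 * i1) ^ 10 * (p5 * i5) ^ 2"
        by (simp only: A_form_def ia_def power_mult_distrib mult_ac)
      then have "A_form * ia = 1" by (simp add: euler_inv euler_inv5)
      then have ia: "eta_a z * q_eval ia z = 1" if "Im z > 0" for z
        using q_eval_mult[OF disc_convergent_forms(1) iac that] by (simp add: eta_a_def q_eval_1)
      obtain B' where B': "\<And>z. Im z \<ge> 1 \<Longrightarrow> norm (q_eval ia z) \<le> B'" using q_eval_bounded[OF iac] by blast
      have "norm (h (- 1 / (5 * z))) \<le> B * norm ((5 ^ 4 / k) ^ m) * B' ^ m" if z: "Im z \<ge> max Y 1" for z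
      proof -
        have z': "Im z > 0" "z \<noteq> 0" "Im (5 * z) \<ge> Y" using z by auto
        have "h (- 1 / (5 * z)) = q_eval a (- 1 / (5 * z)) / (k * z ^ 4 * eta_a z) ^ m"
          using h_eq[OF Im_fricke_pos[OF z'(1)]] k(2)[OF z'(1)] by simp
        also have "\<dots> = q_eval a (- 1 / (5 * z)) / (5 * z) ^ (4 * m) * (5 ^ 4 / k) ^ m * (1 / eta_a z) ^ m"
          using z'(2) k(1) eta_nonzero(1)[OF z'(1)]
          unfolding power_mult power_mult_distrib power_divide by (simp add: field_simps)
        also have "1 / eta_a z = q_eval ia z" using ia[OF z'(1)] eta_nonzero(1)[OF z'(1)] by (simp add: field_simps)
        finally have h_bound: "h (- 1 / (5 * z)) =
            q_eval a (- 1 / (5 * z)) / (5 * z) ^ (4 * m) * (5 ^ 4 / k) ^ m * q_eval ia z ^ m" .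
        have nonneg: "0 \<le> B" "0 \<le> B'" using B[OF z'(3)] B'[of z] z order_trans[OF norm_ge_zero] by auto
        show ?thesis
          unfolding h_bound norm_mult norm_power[of "q_eval ia z"]
          by (intro mult_mono power_mono B B' z' mult_nonneg_nonneg zero_le_power norm_ge_zero nonneg order_refl)
            (use z in auto)
      qed
      then show ?thesis by blast
    qed
  qed
  then have "q_eval a z = 0" if "Im z > 0" for z using hb[OF that] that by simp
  then show ?thesis by (rule q_eval_eq_0D[OF conv])
qed

section \<open>Reduction modulo 2\<close>

text \<open>Indexed by the order of vanishing \<open>n\<close> at infinity; the power of A fills the
  weight up to 4m. For \<open>n <= 2 * m\<close> the subtractions do not truncate.\<close>

definition basis_form :: "nat \<Rightarrow> nat \<Rightarrow> int fps" where
  "basis_form m n = (if even n then A_form ^ (m - n div 2) * B_form ^ (n div 2)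
     else A_form ^ (m - 1 - n div 2) * B_form ^ (n div 2) * C_form)"

lemma basis_form_int_forms:
  assumes "n \<le> 2 * m"
  shows "basis_form m n \<in> int_forms (4 * m)"
proof (cases "even n")
  case True
  have "A_form ^ (m - n div 2) * B_form ^ (n div 2) \<in> int_forms ((m - n div 2) * 4 + (n div 2) * 4)"
    by (intro int_forms_mult int_forms_power eta_forms)
  moreover have "(m - n div 2) * 4 + (n div 2) * 4 = 4 * m" using assms by simp
  ultimately show ?thesis using True by (simp add: basis_form_def)
next
  case False
  have "A_form ^ (m - 1 - n div 2) * B_form ^ (n div 2) * C_form \<in> int_forms ((m - 1 - n div 2) * 4 + (n div 2) * 4 + 4)"
    by (intro int_forms_mult int_forms_power eta_forms)
  moreover have "(m - 1 - n div 2) * 4 + (n div 2) * 4 + 4 = 4 * m" using assms False by (auto elim!: oddE)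
  ultimately show ?thesis using False by (simp add: basis_form_def)
qed

lemma euler_nth_0: "p1 $ 0 = 1" "i1 $ 0 = 1" "p5 $ 0 = 1" "i5 $ 0 = 1"
proof -
  show p: "p1 $ 0 = 1" by (simp add: euler_fps_def)
  have "(p1 * i1) $ 0 = 1" by (simp add: euler_inv)
  then show "i1 $ 0 = 1" using p by simp
  then show "p5 $ 0 = 1" "i5 $ 0 = 1" using p by (simp_all add: dilate_nth)
qed

lemma basis_form_leading: "i < n \<Longrightarrow> basis_form m n $ i = 0" "basis_form m n $ n = 1"
proof -
  define v where "v = (if even n then A_form ^ (m - n div 2) * (p5 ^ 10 * i1 ^ 2) ^ (n div 2)
     else A_form ^ (m - 1 - n div 2) * (p5 ^ 10 * i1 ^ 2) ^ (n div 2) * (p1 ^ 4 * p5 ^ 4))"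
  have "basis_form m n = fps_X ^ n * v"
  proof (cases "even n")
    case True
    have "B_form ^ (n div 2) = fps_X ^ n * (p5 ^ 10 * i1 ^ 2) ^ (n div 2)"
      using True by (simp add: B_form_def power_mult_distrib power_mult[symmetric] mult_ac)
    then show ?thesis using True by (simp add: basis_form_def v_def mult_ac)
  next
    case False
    then have n: "n = Suc (2 * (n div 2))" by simp
    have "B_form ^ (n div 2) * C_form = fps_X ^ Suc (2 * (n div 2)) * (p5 ^ 10 * i1 ^ 2) ^ (n div 2) * (p1 ^ 4 * p5 ^ 4)"
      by (simp add: B_form_def C_form_def power_mult_distrib power_mult[symmetric] mult_ac)
    then have "B_form ^ (n div 2) * C_form = fps_X ^ n * (p5 ^ 10 * i1 ^ 2) ^ (n div 2) * (p1 ^ 4 * p5 ^ 4)"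
      by (simp only: n[symmetric])
    then show ?thesis using False by (simp add: basis_form_def v_def mult_ac)
  qed
  moreover have "v $ 0 = 1"
    by (simp add: v_def A_form_def fps_power_zeroth euler_nth_0)
  ultimately show "i < n \<Longrightarrow> basis_form m n $ i = 0" "basis_form m n $ n = 1"
    by (simp_all add: fps_X_power_mult_nth)
qed

text \<open>Elimination from the lowest coefficient: \<open>k\<close> counts the indices up to 2m
  not yet cleared. When none is left, \<open>int_forms_vanishing\<close> gives 0.\<close>

lemma reduce_in_span:
  assumes "a \<in> int_forms (4 * m)"
  shows "reduce a \<in> span_Z2 ((\<lambda>n. reduce (basis_form m n)) ` {..2 * m})"
proof -
  have "reduce a \<in> span_Z2 ((\<lambda>n. reduce (basis_form m n)) ` {..2 * m})"
    if "a \<in> int_forms (4 * m)" "\<And>n. n < 2 * m + 1 - k \<Longrightarrow> a $ n = 0" for a k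
    using that
  proof (induction k arbitrary: a)
    case 0
    then have "a = 0" by (intro int_forms_vanishing) auto
    then show ?case by (simp add: reduce_simps span_Z2_0)
  next
    case (Suc k)
    show ?case
    proof (cases "k \<le> 2 * m")
      case False
      then show ?thesis using Suc by auto
    next
      case True
      define N where "N = 2 * m - k"
      have N: "N \<le> 2 * m" "2 * m + 1 - k = Suc N" "2 * m + 1 - Suc k = N" using True by (auto simp: N_def)
      define b where "b = a + fps_const (- (a $ N)) * basis_form m N"
      have "b \<in> int_forms (4 * m)"
        unfolding b_def by (intro int_forms_add int_forms_cmult Suc.prems basis_form_int_forms N)
      moreover have "b $ n = 0" if "n < 2 * m + 1 - k" for n
        using that Suc.prems(2)[of n] basis_form_leading(1)[of n N m] basis_form_leading(2)[of m N] unfolding N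
        by (cases "n = N") (auto simp: b_def)
      ultimately have "reduce b \<in> span_Z2 ((\<lambda>n. reduce (basis_form m n)) ` {..2 * m})" by (rule Suc.IH)
      moreover have "fps_const (of_int (a $ N)) * reduce (basis_form m N) \<in> span_Z2 ((\<lambda>n. reduce (basis_form m n)) ` {..2 * m})"
        using N(1) by (cases "of_int (a $ N) :: bit") (auto intro: span_Z2_0 span_Z2_base)
      ultimately have "reduce b + fps_const (of_int (a $ N)) * reduce (basis_form m N) \<in> span_Z2 ((\<lambda>n. reduce (basis_form m n)) ` {..2 * m})"
        by (rule span_Z2_add)
      moreover have "reduce a = reduce (b + fps_const (a $ N) * basis_form m N)"
        by (simp add: b_def algebra_simps flip: fps_const_neg)
      ultimately show ?thesis by (simp add: reduce_simps)
    qed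
  qed
  from this[of a "2 * m + 1"] assms show ?thesis by simp
qed

section \<open>Parity of series and the relation A + B = 1\<close>

definition even_fps :: "bit fps \<Rightarrow> bool" where "even_fps g \<longleftrightarrow> (\<forall>n. odd n \<longrightarrow> g $ n = 0)"
definition odd_fps :: "bit fps \<Rightarrow> bool" where "odd_fps g \<longleftrightarrow> (\<forall>n. even n \<longrightarrow> g $ n = 0)"

lemma even_fps_square: "even_fps (f ^ 2)"
  by (simp add: even_fps_def bit_fps_square_nth)

lemma even_fps_mult: "even_fps f \<Longrightarrow> even_fps g \<Longrightarrow> even_fps (f * g)"
  unfolding even_fps_def fps_mult_nth
  by (intro allI impI sum.neutral ballI) (metis even_add le_add_diff_inverse2 atLeastAtMost_iff mult_zero_left mult_zero_right)

lemma odd_even_fps_mult: "odd_fps f \<Longrightarrow> even_fps g \<Longrightarrow> odd_fps (f * g)"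
  unfolding even_fps_def odd_fps_def fps_mult_nth
  by (intro allI impI sum.neutral ballI) (metis even_add le_add_diff_inverse2 atLeastAtMost_iff mult_zero_left mult_zero_right)

lemma odd_fps_mult: "odd_fps f \<Longrightarrow> odd_fps g \<Longrightarrow> even_fps (f * g)"
  unfolding even_fps_def odd_fps_def fps_mult_nth
  by (intro allI impI sum.neutral ballI) (metis even_add le_add_diff_inverse2 atLeastAtMost_iff mult_zero_left mult_zero_right)

lemma even_fps_add: "even_fps f \<Longrightarrow> even_fps g \<Longrightarrow> even_fps (f + g)"
  and odd_fps_add: "odd_fps f \<Longrightarrow> odd_fps g \<Longrightarrow> odd_fps (f + g)"
  by (auto simp: even_fps_def odd_fps_def)

lemma even_fps_1: "even_fps 1"
  by (auto simp: even_fps_def elim!: oddE)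

lemma even_fps_power: "even_fps f \<Longrightarrow> even_fps (f ^ n)"
  by (induction n) (auto intro: even_fps_1 even_fps_mult)

lemma odd_fps_power:
  assumes "odd_fps f"
  shows "if even n then even_fps (f ^ n) else odd_fps (f ^ n)"
proof (induction n)
  case (Suc n)
  then show ?case using odd_fps_mult[OF assms] odd_even_fps_mult[OF assms] by auto
qed (simp add: even_fps_1)

lemma odd_fps_monomial:
  assumes "odd_fps f" "odd_fps g" "odd (i + j)"
  shows "odd_fps (f ^ i * g ^ j)"
proof (cases "even i")
  case True
  then have "even_fps (f ^ i)" "odd_fps (g ^ j)"
    using odd_fps_power[OF assms(1), of i] odd_fps_power[OF assms(2), of j] assms(3) by auto
  then show ?thesis using odd_even_fps_mult by (subst mult.commute) blast
next
  case False
  then have "odd_fps (f ^ i)" "even_fps (g ^ j)"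
    using odd_fps_power[OF assms(1), of i] odd_fps_power[OF assms(2), of j] assms(3) by auto
  then show ?thesis by (rule odd_even_fps_mult)
qed

abbreviation "ra \<equiv> reduce A_form"
abbreviation "rb \<equiv> reduce B_form"
abbreviation "rc \<equiv> reduce C_form"

text \<open>All eta exponents are even, and squares are even series modulo 2; the parities
  follow.\<close>

lemma reduce_forms_square: "ra = reduce (p1 ^ 5 * i5) ^ 2" "rb = reduce (fps_X * p5 ^ 5 * i1) ^ 2"
  "rc = fps_X * reduce (p1 ^ 2 * p5 ^ 2) ^ 2"
  by (simp_all add: A_form_def B_form_def C_form_def reduce_simps reduce_power power_mult_distrib power_mult[symmetric] mult_ac)

lemma parity_forms: "even_fps ra" "even_fps rb" "odd_fps rc"
proof -
  show "even_fps ra" "even_fps rb" unfolding reduce_forms_square by (rule even_fps_square)+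
  have "(fps_X * f ^ 2) $ n = 0" if "even n" for n and f :: "bit fps"
    using that by (cases n) (auto simp: bit_fps_square_nth)
  then show "odd_fps rc" unfolding reduce_forms_square odd_fps_def by blast
qed

text \<open>The reduction 1 of \<open>E_form ^ 2\<close> is a combination of \<open>ra\<close>,
  \<open>rb\<close> and \<open>rc\<close>; the coefficients of index 0, 1 and 2 determine
  it.\<close>

lemma reduce_A_plus_B: "ra + rb = 1"
proof -
  have nth: "ra $ 0 = 1" "ra $ 1 = 0" "ra $ 2 = 1" "rb $ 0 = 0" "rb $ 1 = 0" "rb $ 2 = 1" "rc $ 0 = 0" "rc $ 1 = 1"
  proof -
    \<comment> \<open>Squaring doubles indices, so coefficient 2 of \<open>ra\<close> is coefficient
      1 of its root, which is -5 and hence odd.\<close>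
    have p11: "p1 $ 1 = -1" by (simp add: euler_fps_def)
    have i51: "i5 $ 1 = 0" by (simp add: dilate_nth)
    have "(p1 ^ 5 * i5) $ 1 = (p1 ^ 5) $ 0 * i5 $ 1 + (p1 ^ 5) $ 1 * i5 $ 0"
      by (simp add: fps_mult_nth)
    also have "(p1 ^ 5) $ 1 = - 5"
      unfolding fps_power_first p11 euler_nth_0 by simp
    finally have "(p1 ^ 5 * i5) $ 1 = - 5" using i51 euler_nth_0 by simp
    then show "ra $ 2 = 1" unfolding reduce_forms_square bit_fps_square_nth by simp
    show "ra $ 0 = 1" unfolding reduce_forms_square bit_fps_square_nth by (simp add: fps_power_zeroth euler_nth_0)
    show "ra $ 1 = 0" "rb $ 1 = 0" using parity_forms by (auto simp: even_fps_def)
    show "rb $ 0 = 0" by (simp add: B_form_def)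
    show "rb $ 2 = 1" unfolding reduce_forms_square bit_fps_square_nth
      by (simp add: fps_power_zeroth euler_nth_0 mult.assoc)
    show "rc $ 0 = 0" "rc $ 1 = 1" by (simp_all add: C_form_def fps_power_zeroth euler_nth_0 mult.assoc)
  qed
  have "(1 :: bit fps) \<in> span_Z2 ((\<lambda>n. reduce (basis_form 1 n)) ` {..2})"
    using reduce_in_span[of "E_form ^ 2" 1] E_form_square by (simp add: reduce_E_form)
  moreover have "(\<lambda>n. reduce (basis_form 1 n)) ` {..2} = {ra, rb, rc}"
    by (auto simp: basis_form_def atMost_Suc numeral_2_eq_2)
  ultimately have 1: "(1 :: bit fps) \<in> span_Z2 {ra, rb, rc}" by simp
  have "\<exists>x y z. h = fps_const x * ra + fps_const y * rb + fps_const z * rc" if "h \<in> span_Z2 {ra, rb, rc}" for h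
    using that
  proof (induction rule: span_Z2_induct)
    case 0
    show ?case by (rule exI[of _ 0])+ simp
  next
    case (add u h)
    then obtain x y z where h: "h = fps_const x * ra + fps_const y * rb + fps_const z * rc" by blast
    from add(1) consider "u = ra" | "u = rb" | "u = rc" by blast
    then show ?case
    proof cases
      case 1
      have "u + h = fps_const (1 + x) * ra + fps_const y * rb + fps_const z * rc"
        unfolding 1 h fps_const_add[symmetric] by (simp add: algebra_simps)
      then show ?thesis by blast
    next
      case 2
      have "u + h = fps_const x * ra + fps_const (1 + y) * rb + fps_const z * rc"
        unfolding 2 h fps_const_add[symmetric] by (simp add: algebra_simps)
      then show ?thesis by blast
    next
      case 3
      have "u + h = fps_const x * ra + fps_const y * rb + fps_const (1 + z) * rc"
        unfolding 3 h fps_const_add[symmetric] by (simp add: algebra_simps)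
      then show ?thesis by blast
    qed
  qed
  from this[OF 1] obtain x y z where eq: "1 = fps_const x * ra + fps_const y * rb + fps_const z * rc" by blast
  have e: "(1 :: bit fps) $ n = x * ra $ n + y * rb $ n + z * rc $ n" for n
    by (subst eq) simp
  have "x = 1" using e[of 0] unfolding nth by simp
  moreover have "z = 0" using e[of 1] unfolding nth by simp
  moreover have "y = 1" using e[of 2] calculation unfolding nth by (cases y) auto
  ultimately show ?thesis using eq by simp
qed

lemma reduce_C_square: "rc ^ 2 = ra * rb"
  by (simp add: C_form_square reduce_simps flip: reduce_power)

lemma F_eq_forms: "F = ra ^ 2 * rc"
proof -
  have "F = reduce D_form" by (simp add: F_eq D_form_def reduce_simps reduce_power reduce_euler)
  then show ?thesis by (simp add: D_form_eq reduce_simps reduce_power)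
qed

lemma G_eq_forms: "G = rb ^ 2 * rc"
proof -
  have "F = reduce D_form" by (simp add: F_eq D_form_def reduce_simps reduce_power reduce_euler)
  then have F_nth: "F $ n = of_int (D_form $ n)" for n by (metis reduce_nth)
  have "G = reduce (dilate D_form)"
    by (rule fps_ext) (simp add: G_def dilate_nth F_nth)
  then show ?thesis by (simp add: D5_form_eq reduce_simps reduce_power)
qed

lemma span_Z2_subset:
  assumes "S \<subseteq> span_Z2 S'"
  shows "span_Z2 S \<subseteq> span_Z2 S'"
proof
  fix h assume "h \<in> span_Z2 S"
  then show "h \<in> span_Z2 S'"
    by (induction rule: span_Z2_induct) (use assms in \<open>auto intro: span_Z2_0 span_Z2_add\<close>)
qed

text \<open>Substituting 1 + \<open>rb\<close> for \<open>ra\<close> turns basis forms of even index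
  into polynomials in \<open>rb\<close>, and those of odd index into \<open>rc\<close> times such
  polynomials.\<close>

lemma reduce_even_odd:
  assumes "a \<in> int_forms (4 * m)"
  obtains u v where "reduce a = u + v" "u \<in> span_Z2 (range (\<lambda>n. rb ^ n))" "v \<in> span_Z2 (range (\<lambda>n. rc * rb ^ n))"
proof -
  have ra: "ra = 1 + rb" using reduce_A_plus_B by (metis bit_fps_add_left_self add.commute)
  have stable: "ra ^ i * x \<in> span_Z2 (range (\<lambda>n. c * rb ^ n))" if "x \<in> span_Z2 (range (\<lambda>n. c * rb ^ n))" for i x c
  proof (induction i)
    case (Suc i)
    have B: "rb * y \<in> span_Z2 (range (\<lambda>n. c * rb ^ n))" if "y \<in> span_Z2 (range (\<lambda>n. c * rb ^ n))" for y
      using that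
    proof (induction rule: span_Z2_induct)
      case (add x y)
      then obtain n where "x = c * rb ^ n" by blast
      then have "rb * x = c * rb ^ Suc n" by (simp add: mult_ac)
      then have "rb * x \<in> span_Z2 (range (\<lambda>n. c * rb ^ n))" by (intro span_Z2_base) blast
      then show ?case using add by (simp add: distrib_left span_Z2_add)
    qed (simp add: span_Z2_0)
    have "ra ^ Suc i * x = ra ^ i * x + rb * (ra ^ i * x)" by (simp add: ra algebra_simps)
    then show ?case using span_Z2_add[OF Suc B[OF Suc]] by simp
  qed (use that in simp)
  have basis: "reduce (basis_form m n) \<in> span_Z2 (range (\<lambda>k. (if even n then 1 else rc) * rb ^ k))" for n
  proof (cases "even n")
    case True
    have "ra ^ (m - n div 2) * (1 * rb ^ (n div 2)) \<in> span_Z2 (range (\<lambda>n. 1 * rb ^ n))"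
      by (rule stable, rule span_Z2_base) blast
    then show ?thesis using True by (simp add: basis_form_def reduce_simps reduce_power)
  next
    case False
    have "ra ^ (m - 1 - n div 2) * (rc * rb ^ (n div 2)) \<in> span_Z2 (range (\<lambda>n. rc * rb ^ n))"
      by (rule stable, rule span_Z2_base) blast
    then show ?thesis using False by (simp add: basis_form_def reduce_simps reduce_power mult_ac)
  qed
  have "\<exists>u v. h = u + v \<and> u \<in> span_Z2 (range (\<lambda>n. rb ^ n)) \<and> v \<in> span_Z2 (range (\<lambda>n. rc * rb ^ n))"
    if "h \<in> span_Z2 ((\<lambda>n. reduce (basis_form m n)) ` {..2 * m})" for h
    using that
  proof (induction rule: span_Z2_induct)
    case 0
    show ?case by (rule exI[of _ 0])+ (simp add: span_Z2_0)
  next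
    case (add x h)
    then obtain u v where uv: "h = u + v" "u \<in> span_Z2 (range (\<lambda>n. rb ^ n))" "v \<in> span_Z2 (range (\<lambda>n. rc * rb ^ n))" by blast
    obtain n where n: "x = reduce (basis_form m n)" using add(1) by blast
    show ?case
    proof (cases "even n")
      case True
      then have "x \<in> span_Z2 (range (\<lambda>n. rb ^ n))" using basis[of n] n by simp
      then show ?thesis using uv by (intro exI[of _ "x + u"] exI[of _ v]) (auto simp: add.assoc intro: span_Z2_add)
    next
      case False
      then have "x \<in> span_Z2 (range (\<lambda>n. rc * rb ^ n))" using basis[of n] n by simp
      then show ?thesis using uv by (intro exI[of _ u] exI[of _ "x + v"]) (auto simp: add_ac intro: span_Z2_add)
    qed
  qed
  from this[OF reduce_in_span[OF assms]] show ?thesis using that by blast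
qed

lemma M_odd_subset: "M_odd \<subseteq> span_Z2 {F ^ i * G ^ j | i j. odd (i + j)}"
proof
  fix h assume "h \<in> M_odd"
  then obtain m a where a: "a \<in> int_forms (4 * m)" "h = reduce a" and odd: "odd_fps h"
    by (auto simp: M_odd_def M_def Mk_eq odd_fps_def)
  obtain u v where uv: "h = u + v" "u \<in> span_Z2 (range (\<lambda>n. rb ^ n))" "v \<in> span_Z2 (range (\<lambda>n. rc * rb ^ n))"
    using reduce_even_odd[OF a(1)] a(2) by blast
  \<comment> \<open>\<open>u\<close> is even, and as the sum of the odd series h and v it is also
    odd; hence it is 0.\<close>
  have "even_fps u" using uv(2)
  proof (induction rule: span_Z2_induct)
    case (add x y)
    then show ?case by (auto intro: even_fps_add even_fps_power parity_forms)
  qed (simp add: even_fps_def)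
  moreover have "odd_fps v" using uv(3)
  proof (induction rule: span_Z2_induct)
    case (add x y)
    then show ?case by (auto intro: odd_fps_add odd_even_fps_mult even_fps_power parity_forms)
  qed (simp add: odd_fps_def)
  ultimately have "u $ n = 0" for n
    using odd uv(1) by (cases "even n") (auto simp: even_fps_def odd_fps_def)
  then have "u = 0" by (simp add: fps_eq_iff)
  then have "h \<in> span_Z2 (range (\<lambda>n. rc * rb ^ n))" using uv by simp
  also have "\<dots> \<subseteq> span_Z2 {F ^ i * G ^ j | i j. odd (i + j)}"
    using odd_span_contains[OF reduce_A_plus_B reduce_C_square F_eq_forms G_eq_forms]
    by (intro span_Z2_subset) blast
  finally show "h \<in> span_Z2 {F ^ i * G ^ j | i j. odd (i + j)}" .
qed

text \<open>The weights of the two lifts may differ. Powers of \<open>E_form ^ 2\<close> bring both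
  to weight 4(m + n) and leave the reductions unchanged.\<close>

lemma M_add:
  assumes "f \<in> M" "g \<in> M"
  shows "f + g \<in> M"
proof -
  from assms obtain m n a b where a: "a \<in> int_forms (4 * m)" "f = reduce a"
    and b: "b \<in> int_forms (4 * n)" "g = reduce b" by (auto simp: M_def Mk_eq)
  have lift: "(E_form ^ 2) ^ k * c \<in> int_forms (4 * (k + l))" if "c \<in> int_forms (4 * l)" for k l c
    using int_forms_mult[OF int_forms_power[OF E_form_square] that, of k] by (simp add: algebra_simps)
  have "(E_form ^ 2) ^ n * a + (E_form ^ 2) ^ m * b \<in> int_forms (4 * (m + n))"
    using lift[OF a(1), of n] lift[OF b(1), of m] by (intro int_forms_add) (simp_all add: add.commute)
  moreover have "reduce ((E_form ^ 2) ^ n * a + (E_form ^ 2) ^ m * b) = f + g"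
    by (simp only: reduce_simps reduce_power[of "E_form ^ 2"] reduce_E_form a(2) b(2) power_one mult_1)
  ultimately show ?thesis unfolding M_def Mk_eq by (metis (no_types, lifting) UNIV_I UN_I image_eqI)
qed

lemma monomial_in_M: "F ^ i * G ^ j \<in> M"
proof -
  have "(A_form ^ 2 * C_form) ^ i * (B_form ^ 2 * C_form) ^ j \<in> int_forms (i * (2 * 4 + 4) + j * (2 * 4 + 4))"
    by (intro int_forms_mult int_forms_power eta_forms)
  also have "i * (2 * 4 + 4) + j * (2 * 4 + 4) = 4 * (3 * (i + j))" by simp
  finally have "reduce ((A_form ^ 2 * C_form) ^ i * (B_form ^ 2 * C_form) ^ j) \<in> M"
    unfolding M_def Mk_eq by blast
  then show ?thesis by (simp add: reduce_simps reduce_power F_eq_forms G_eq_forms)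
qed

theorem theorem1p13:
  shows "M_odd = span_Z2 {F ^ i * G ^ j | i j. odd (i + j)}"
proof
  show "span_Z2 {F ^ i * G ^ j | i j. odd (i + j)} \<subseteq> M_odd"
  proof
    fix h assume "h \<in> span_Z2 {F ^ i * G ^ j | i j. odd (i + j)}"
    then have "h \<in> M \<and> odd_fps h"
    proof (induction rule: span_Z2_induct)
      case 0
      have "reduce (fps_const 0) \<in> M" unfolding M_def Mk_eq using int_forms_const[of 0] by (intro UN_I[of 0]) auto
      then show ?case by (simp add: reduce_simps odd_fps_def)
    next
      case (add x y)
      have "odd_fps F" "odd_fps G" unfolding F_eq_forms G_eq_forms
        by (subst mult.commute, intro odd_even_fps_mult even_fps_square parity_forms)+
      moreover obtain i j where "x = F ^ i * G ^ j" "odd (i + j)" using add(1) by blast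
      ultimately show ?case using add(2) by (metis M_add monomial_in_M odd_fps_add odd_fps_monomial)
    qed
    then show "h \<in> M_odd" by (simp add: M_odd_def odd_fps_def)
  qed
qed (rule M_odd_subset)

end
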